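(* Let $X$ be a non-empty compact metrizable space, $T : X \to X$ a continuous map, and $\mathcal{C} \subset C(X)$. If $(X,T,\mathcal{C})$ has finite type, then for every closed face $K$ of $M_{\mathcal{C}}(X,T)$, there exists a continuous function $\phi \in C(X)$ such that $K = M_{\mathcal{C}}^*(X,T;\phi)$.
   Context: $C(X)$ is the space of continuous functions $X \to \mathbb{R}$. $M(X,T)$ is the set of $T$-invariant Borel probability measures on $X$, with the weak$^*$ topology, and for $\mathcal{C} \subset C(X)$, $M_{\mathcal{C}}(X,T) = \{\mu \in M(X,T) : \int g \, d\mu = 0 \text{ for all } g \in \mathcal{C}\}$. For $\phi \in C(X)$, $M_{\mathcal{C}}^*(X,T;\phi)$ is the set of all $\mu \in M_{\mathcal{C}}(X,T)$ with $\int \phi \, d\mu = \sup_{\nu \in M_{\mathcal{C}}(X,T)} \int \phi \, d\nu$. The triple $(X,T,\mathcal{C})$ has finite type if there exists a finite set $\mathcal{C}' \subset C(X)$ such that $M_{\mathcal{C}}(X,T) = M_{\mathcal{C}'}(X,T)$. A face of a convex set $Q$ is a non-empty convex subset $F \subset Q$ such that whenever $v_1, v_2 \in Q$, $\alpha \in (0,1)$ and $\alpha v_1 + (1-\alpha) v_2 \in F$, then $v_1, v_2 \in F$. *)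

theory Defs
  imports "HOL-Probability.Probability"
begin

text \<open>The library's \<^const>\<open>borel\<close> is tied to a topology given by a type class; this is
  the Borel sigma-algebra of an arbitrary topological space.\<close>

definition borel_sigma :: "'a topology \<Rightarrow> 'a measure" where
  "borel_sigma X = sigma (topspace X) {U. openin X U}"

text \<open>HOL functions are total, so one element of \<open>C(X)\<close> is represented by all functions that agree
  with it on \<^term>\<open>topspace X\<close>. The values elsewhere influence no integral below.\<close>

definition cont_functions :: "'a topology \<Rightarrow> ('a \<Rightarrow> real) set" where
  "cont_functions X = {f. continuous_map X euclideanreal f}"

definition invariant_measures :: "'a topology \<Rightarrow> ('a \<Rightarrow> 'a) \<Rightarrow> 'a measure set" where
  "invariant_measures X T =
     {\<mu>. sets \<mu> = sets (borel_sigma X) \<and> prob_space \<mu> \<and>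
          (\<forall>A\<in>sets \<mu>. emeasure \<mu> (T -` A \<inter> topspace X) = emeasure \<mu> A)}"

text \<open>The weak* topology: the coarsest one for which \<open>\<mu> \<mapsto> \<integral>f d\<mu>\<close> is continuous for every
  \<open>f \<in> C(X)\<close>, obtained by pulling back the topology of pointwise convergence.\<close>

definition weak_star_topology :: "'a topology \<Rightarrow> ('a \<Rightarrow> 'a) \<Rightarrow> 'a measure topology" where
  "weak_star_topology X T =
     pullback_topology (invariant_measures X T)
       (\<lambda>\<mu>. \<lambda>f\<in>cont_functions X. integral\<^sup>L \<mu> f)
       (product_topology (\<lambda>_. euclideanreal) (cont_functions X))"

definition constrained_measures ::
    "'a topology \<Rightarrow> ('a \<Rightarrow> 'a) \<Rightarrow> ('a \<Rightarrow> real) set \<Rightarrow> 'a measure set" where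
  "constrained_measures X T C =
     {\<mu> \<in> invariant_measures X T. \<forall>g\<in>C. integral\<^sup>L \<mu> g = 0}"

definition maximizing_measures ::
    "'a topology \<Rightarrow> ('a \<Rightarrow> 'a) \<Rightarrow> ('a \<Rightarrow> real) set \<Rightarrow> ('a \<Rightarrow> real) \<Rightarrow> 'a measure set" where
  "maximizing_measures X T C \<phi> =
     {\<mu> \<in> constrained_measures X T C.
        integral\<^sup>L \<mu> \<phi> = (SUP \<nu>\<in>constrained_measures X T C. integral\<^sup>L \<nu> \<phi>)}"

definition finite_type :: "'a topology \<Rightarrow> ('a \<Rightarrow> 'a) \<Rightarrow> ('a \<Rightarrow> real) set \<Rightarrow> bool" where
  "finite_type X T C \<longleftrightarrow>
     (\<exists>C'. finite C' \<and> C' \<subseteq> cont_functions X \<and>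
        constrained_measures X T C = constrained_measures X T C')"

text \<open>Measures do not form a real vector space in the library, so convex combinations are defined
  explicitly: \<open>mixture \<alpha> \<mu> \<nu>\<close> is \<open>\<alpha> \<mu> + (1 - \<alpha>) \<nu>\<close>. It is used only for \<open>0 \<le> \<alpha> \<le> 1\<close> and
  measures on a common sigma-algebra.\<close>

definition mixture :: "real \<Rightarrow> 'a measure \<Rightarrow> 'a measure \<Rightarrow> 'a measure" where
  "mixture \<alpha> \<mu> \<nu> =
     measure_of (space \<mu>) (sets \<mu>)
       (\<lambda>A. ennreal \<alpha> * emeasure \<mu> A + ennreal (1 - \<alpha>) * emeasure \<nu> A)"

lemma sets_mixture [simp]: "sets (mixture \<alpha> \<mu> \<nu>) = sets \<mu>"
  by (simp add: mixture_def)

lemma space_mixture [simp]: "space (mixture \<alpha> \<mu> \<nu>) = space \<mu>"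
  by (simp add: mixture_def)

lemma emeasure_mixture:
  assumes "sets \<nu> = sets \<mu>" "A \<in> sets \<mu>"
  shows "emeasure (mixture \<alpha> \<mu> \<nu>) A = ennreal \<alpha> * emeasure \<mu> A + ennreal (1 - \<alpha>) * emeasure \<nu> A"
proof (rule emeasure_measure_of[OF mixture_def])
  show "countably_additive (sets (mixture \<alpha> \<mu> \<nu>))
      (\<lambda>A. ennreal \<alpha> * emeasure \<mu> A + ennreal (1 - \<alpha>) * emeasure \<nu> A)"
  proof (rule countably_additiveI)
    fix F :: "nat \<Rightarrow> 'a set"
    assume F: "range F \<subseteq> sets (mixture \<alpha> \<mu> \<nu>)" "disjoint_family F"
    then have "(\<Sum>i. emeasure \<mu> (F i)) = emeasure \<mu> (\<Union>i. F i)"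
      and "(\<Sum>i. emeasure \<nu> (F i)) = emeasure \<nu> (\<Union>i. F i)"
      using assms(1) by (auto intro!: suminf_emeasure)
    then show "(\<Sum>i. ennreal \<alpha> * emeasure \<mu> (F i) + ennreal (1 - \<alpha>) * emeasure \<nu> (F i)) =
        ennreal \<alpha> * emeasure \<mu> (\<Union>i. F i) + ennreal (1 - \<alpha>) * emeasure \<nu> (\<Union>i. F i)"
      by (simp add: suminf_add[symmetric])
  qed
qed (use assms sets.space_closed in \<open>auto simp: positive_def\<close>)

definition convex_measures :: "'a measure set \<Rightarrow> bool" where
  "convex_measures F \<longleftrightarrow> (\<forall>\<mu>\<in>F. \<forall>\<nu>\<in>F. \<forall>\<alpha>. 0 \<le> \<alpha> \<and> \<alpha> \<le> 1 \<longrightarrow> mixture \<alpha> \<mu> \<nu> \<in> F)"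

text \<open>The library's \<^term>\<open>(face_of)\<close> needs a real vector space and admits the empty face.\<close>

definition is_face :: "'a measure set \<Rightarrow> 'a measure set \<Rightarrow> bool" where
  "is_face F Q \<longleftrightarrow>
     F \<noteq> {} \<and> F \<subseteq> Q \<and> convex_measures F \<and>
     (\<forall>v1\<in>Q. \<forall>v2\<in>Q. \<forall>\<alpha>. 0 < \<alpha> \<and> \<alpha> < 1 \<and> mixture \<alpha> v1 v2 \<in> F \<longrightarrow> v1 \<in> F \<and> v2 \<in> F)"

end

theory Submission
  imports Defs
begin

text \<open>
  Why every closed face \<open>K\<close> of \<open>Q = M\<^sub>C(X,T)\<close> is exposed by a continuous function. By finite type, \<open>Q\<close>
  is the set of invariant probability measures that annihilate a finite set \<open>G\<close> of continuous
  functions. The goal is a continuous \<open>\<phi>\<close> whose integral is nonnegative on \<open>Q\<close> and vanishes there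
  exactly on \<open>K\<close>; then \<open>K\<close> consists of the maximizing measures of \<open>-\<phi>\<close>. As \<open>C(X)\<close> is separable, a
  weighted sum of countably many functions gives such a \<open>\<phi>\<close>, provided that for each \<open>\<mu>\<close> in \<open>Q\<close> outside
  \<open>K\<close> there is one that is nonnegative on \<open>Q\<close>, zero on \<open>K\<close> and positive at \<open>\<mu>\<close>
  (\<open>separating_function\<close>).

  By duality, such a function exists for every \<open>\<mu>\<close> as soon as the convex cone
  \<open>\<real>\<^sub>\<ge>\<^sub>0 Q - \<real>\<^sub>\<ge>\<^sub>0 K\<close> of signed measures is weak* closed: it does not contain \<open>-\<mu>\<close>, because an
  equation \<open>\<mu> + a q = b k\<close> would put \<open>\<mu>\<close> into the face. The key is a bound
  (\<open>bounded_decomposition\<close>): every element \<open>w\<close> of the cone has a representation \<open>a q - b k\<close> with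
  \<open>a + b\<close> at most a fixed multiple of the total variation of \<open>w\<close>.

  The bound comes from two facts. First, the invariant measures form a lattice cone, so \<open>w\<close> has
  invariant positive and negative parts, and the negative part is dominated by a multiple of an
  element of \<open>K\<close>. These parts need not satisfy the constraints \<open>G\<close>. Second, let \<open>F\<close> be the cone of
  finite invariant measures dominated by a multiple of an element of \<open>K\<close>. If \<open>f \<le> c k\<close>, then
  \<open>c k - f\<close> also lies in \<open>F\<close> and its integrals over \<open>G\<close> are those of \<open>f\<close> with the opposite sign. So
  the vectors of integrals over \<open>G\<close> of members of \<open>F\<close> fill a linear subspace of a finite-dimensional
  space, and hence the integrals of \<open>f\<close> can be cancelled by a member of \<open>F\<close> whose mass is at most
  a constant times that of \<open>f\<close> (\<open>bounded_negation\<close>). Adding such a correcting measure to both parts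
  of \<open>w\<close> makes both satisfy the constraints. A member of \<open>F\<close> that annihilates \<open>G\<close> is a multiple of
  an element of \<open>K\<close>, because \<open>K\<close> is a face (\<open>face_cone_null\<close>).

  The passage from the bound to actual functions is an explicit form of the Krein--Smulian and
  Hahn--Banach theorems. A minimax theorem turns the pointwise estimate for each \<open>w\<close> into one
  function for all \<open>w\<close> (\<open>separation\<close>). It shows that a function which is exposing up to an error
  \<open>e\<close> can be moved by at most \<open>c e\<close> to halve the error (\<open>almost_exposing_improve\<close>); iterating removes
  the error (\<open>almost_exposing_perturb\<close>). The starting point, with an arbitrarily small error and
  value 1 at \<open>\<mu>\<close>, is another application of the minimax theorem (\<open>almost_exposing_start\<close>).

  Compactness of the set of probability measures is derived from Helly's selection theorem on the
  real line, by writing \<open>X\<close> as a continuous image of a compact set of reals.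
\<close>

section \<open>Separating sequences of sets and binary codes\<close>

lemma continuous_map_suminf:
  fixes f :: "nat \<Rightarrow> 'a \<Rightarrow> real"
  assumes cont: "\<And>n. continuous_map X euclideanreal (f n)"
    and bound: "\<And>n x. x \<in> topspace X \<Longrightarrow> \<bar>f n x\<bar> \<le> b n"
    and "summable b"
  shows "continuous_map X euclideanreal (\<lambda>x. \<Sum>n. f n x)"
proof -
  have u: "uniform_limit (topspace X) (\<lambda>n x. \<Sum>i<n. f i x) (\<lambda>x. \<Sum>i. f i x) sequentially"
    by (rule Weierstrass_m_test) (use assms in auto)
  have "continuous_map X Met_TC.mtopology (\<lambda>x. \<Sum>n. f n x)"
  proof (rule Met_TC.continuous_map_uniform_limit[where F = sequentially and f = "\<lambda>n x. \<Sum>i<n. f i x"])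
    show "\<forall>\<^sub>F n in sequentially. continuous_map X Met_TC.mtopology (\<lambda>x. \<Sum>i<n. f i x)"
      using cont by (intro always_eventually allI) (auto intro!: continuous_map_sum)
  qed (use uniform_limitD[OF u] in auto)
  then show ?thesis by simp
qed

text \<open>Balls and concentric closed balls around finite \<open>1/(n+1)\<close>-nets. Recording which of the sets
  \<open>U n\<close> contain a point will determine the point, and the pairs leave room for a closed condition on
  both answers: \<open>x \<in> D n\<close> or \<open>x \<notin> U n\<close>.\<close>

lemma separating_sequence:
  fixes X :: "'a topology"
  assumes "compact_space X" "metrizable_space X"
  obtains U :: "nat \<Rightarrow> 'a set" and D :: "nat \<Rightarrow> 'a set" where
    "\<And>n. openin X (U n)" "\<And>n. closedin X (D n)" "\<And>n. U n \<subseteq> D n"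
    "\<And>x y. x \<in> topspace X \<Longrightarrow> y \<in> topspace X \<Longrightarrow> x \<noteq> y \<Longrightarrow> \<exists>n. x \<in> U n \<and> y \<notin> D n"
proof -
  obtain M d where "Metric_space M d" and X: "X = Metric_space.mtopology M d"
    using assms(2) unfolding metrizable_space_def by auto
  interpret Metric_space M d by fact
  have "mtotally_bounded M"
    using assms(1) unfolding X by (simp add: compactin_imp_mtotally_bounded compact_space_def)
  then have "\<exists>F. finite F \<and> F \<subseteq> M \<and> M \<subseteq> (\<Union>x\<in>F. mball x (1 / Suc n))" for n
    unfolding mtotally_bounded_def by simp
  then obtain F where F: "\<And>n. finite (F n)" "\<And>n. F n \<subseteq> M" "\<And>n. M \<subseteq> (\<Union>x\<in>F n. mball x (1 / Suc n))"
    by metis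
  \<comment> \<open>The pair of empty sets keeps the family nonempty in case \<open>X\<close> is empty.\<close>
  define P where "P = insert ({}, {}) (\<Union>n. (\<lambda>x. (mball x (1 / Suc n), mcball x (1 / Suc n))) ` F n)"
  have "countable P"
    unfolding P_def by (intro countable_insert countable_UN countable_image) (auto intro: countable_finite F)
  moreover have "P \<noteq> {}"
    by (simp add: P_def)
  ultimately have P: "range (from_nat_into P) = P"
    by (simp add: range_from_nat_into)
  have P_cases: "openin X A" "closedin X B" "A \<subseteq> B" if "(A, B) \<in> P" for A B
    using that unfolding P_def X by auto
  have mem: "(fst (from_nat_into P n), snd (from_nat_into P n)) \<in> P" for n
    using P by auto
  show ?thesis
  proof (rule that[of "\<lambda>n. fst (from_nat_into P n)" "\<lambda>n. snd (from_nat_into P n)"])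
    fix x y assume "x \<in> topspace X" "y \<in> topspace X" "x \<noteq> y"
    then have xy: "x \<in> M" "y \<in> M" "0 < d x y"
      by (auto simp: X)
    obtain n where n: "1 / Suc n < d x y / 2"
      using nat_approx_posE[of "d x y / 2"] xy by auto
    obtain z where z: "z \<in> F n" "x \<in> mball z (1 / Suc n)"
      using F(3)[of n] xy by auto
    have "y \<notin> mcball z (1 / Suc n)"
    proof
      assume "y \<in> mcball z (1 / Suc n)"
      then have "d x y \<le> d x z + d z y" "d z y \<le> 1 / Suc n" "d x z \<le> 1 / Suc n"
        using z xy triangle[of x z y] by (auto simp: commute)
      with n show False by linarith
    qed
    moreover have "(mball z (1 / Suc n), mcball z (1 / Suc n)) \<in> range (from_nat_into P)"
      using z unfolding P by (auto simp: P_def)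
    ultimately show "\<exists>n. x \<in> fst (from_nat_into P n) \<and> y \<notin> snd (from_nat_into P n)"
      using z by (metis (no_types, lifting) fst_conv rangeE snd_conv)
  qed (use P_cases[OF mem] in auto)
qed

text \<open>Base 4 leaves gaps between the digits, which makes the code injective on all sequences.\<close>

definition binary_code :: "(nat \<Rightarrow> bool) \<Rightarrow> real" where
  "binary_code b = (\<Sum>n. of_bool (b n) / 4 ^ n)"

lemma summable_quarter: "summable (\<lambda>n. 1 / 4 ^ n :: real)"
  using summable_geometric[of "1/4::real"] by (simp add: power_one_over)

lemma summable_binary_code: "summable (\<lambda>n. of_bool (b n) / 4 ^ n :: real)"
  by (rule summable_comparison_test[OF _ summable_quarter]) (auto intro!: exI[of _ 0])

lemma binary_code_bounds: "0 \<le> binary_code b" "binary_code b \<le> 4/3"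
proof -
  show "0 \<le> binary_code b"
    unfolding binary_code_def by (rule suminf_nonneg[OF summable_binary_code]) auto
  have "binary_code b \<le> (\<Sum>n. 1 / 4 ^ n)"
    unfolding binary_code_def
    by (rule suminf_le[OF _ summable_binary_code summable_quarter]) auto
  also have "\<dots> = 4/3"
    using suminf_geometric[of "1/4::real"] by (simp add: power_one_over)
  finally show "binary_code b \<le> 4/3" .
qed

lemma binary_code_Suc: "binary_code b = of_bool (b 0) + binary_code (\<lambda>n. b (Suc n)) / 4"
proof -
  have "(\<Sum>n. of_bool (b (Suc n)) / 4 ^ Suc n) = binary_code b - of_bool (b 0)"
    using suminf_split_head[OF summable_binary_code, of b] by (simp add: binary_code_def)
  moreover have "(\<Sum>n. of_bool (b (Suc n)) / 4 ^ Suc n :: real) = binary_code (\<lambda>n. b (Suc n)) / 4"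
    using suminf_divide[OF summable_binary_code, of "\<lambda>n. b (Suc n)" 4]
    by (simp add: binary_code_def mult.commute)
  ultimately show ?thesis by simp
qed

lemma inj_binary_code: "inj binary_code"
proof (rule injI, rule ext)
  fix b c :: "nat \<Rightarrow> bool" and n
  assume "binary_code b = binary_code c"
  then show "b n = c n"
  proof (induction n arbitrary: b c)
    case 0
    then show ?case
      using binary_code_Suc[of b] binary_code_Suc[of c]
        binary_code_bounds[of "\<lambda>n. b (Suc n)"] binary_code_bounds[of "\<lambda>n. c (Suc n)"]
      by (cases "b 0"; cases "c 0") auto
  next
    case (Suc n)
    have "binary_code (\<lambda>n. b (Suc n)) = binary_code (\<lambda>n. c (Suc n))"
      using binary_code_Suc[of b] binary_code_Suc[of c] Suc.prems
        binary_code_bounds[of "\<lambda>n. b (Suc n)"] binary_code_bounds[of "\<lambda>n. c (Suc n)"]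
      by (cases "b 0"; cases "c 0") auto
    from Suc.IH[OF this] show ?case .
  qed
qed

abbreviation binary_sequences :: "(nat \<Rightarrow> bool) topology" where
  "binary_sequences \<equiv> product_topology (\<lambda>_. discrete_topology UNIV) UNIV"

lemma continuous_map_binary_code: "continuous_map binary_sequences euclideanreal binary_code"
  unfolding binary_code_def
proof (rule continuous_map_suminf)
  fix n
  have "continuous_map binary_sequences (discrete_topology UNIV) (\<lambda>b. b n)"
    by (rule continuous_map_product_projection) simp
  then have "continuous_map binary_sequences euclideanreal ((\<lambda>t. of_bool t / 4 ^ n) \<circ> (\<lambda>b. b n))"
    by (rule continuous_map_compose) simp
  then show "continuous_map binary_sequences euclideanreal (\<lambda>b. of_bool (b n) / 4 ^ n)"
    by (simp add: o_def)
next
  show "summable (\<lambda>n. 1 / 4 ^ n :: real)" by (rule summable_quarter)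
qed auto

section \<open>The Borel sigma-algebra and continuous functions\<close>

lemma borel_sigma_sets: "sets (borel_sigma X) = sigma_sets (topspace X) {U. openin X U}"
  and borel_sigma_space [simp]: "space (borel_sigma X) = topspace X"
proof -
  have "{U. openin X U} \<subseteq> Pow (topspace X)"
    using openin_subset by auto
  then show "sets (borel_sigma X) = sigma_sets (topspace X) {U. openin X U}"
    "space (borel_sigma X) = topspace X"
    unfolding borel_sigma_def by auto
qed

lemma openin_borel_sigma: "openin X U \<Longrightarrow> U \<in> sets (borel_sigma X)"
  by (auto simp: borel_sigma_sets)

lemma closedin_borel_sigma:
  assumes "closedin X D" shows "D \<in> sets (borel_sigma X)"
proof -
  have "topspace X - (topspace X - D) \<in> sets (borel_sigma X)"
    using sets.compl_sets[OF openin_borel_sigma[of X "topspace X - D"]] assms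
    by (auto simp: closedin_def)
  then show ?thesis
    using closedin_subset[OF assms] by (simp add: double_diff)
qed

lemma measurable_borel_sigma:
  assumes "\<And>x. x \<in> space M \<Longrightarrow> f x \<in> topspace X"
    and "\<And>U. openin X U \<Longrightarrow> f -` U \<inter> space M \<in> sets M"
  shows "f \<in> measurable M (borel_sigma X)"
  unfolding borel_sigma_def
  by (rule measurable_measure_of) (use assms openin_subset[of X] in auto)

lemma continuous_map_measurable:
  assumes "continuous_map X Y f"
  shows "f \<in> measurable (borel_sigma X) (borel_sigma Y)"
proof (rule measurable_borel_sigma)
  fix U assume "openin Y U"
  then have "openin X {x \<in> topspace X. f x \<in> U}"
    using assms by (simp add: continuous_map_def)
  then show "f -` U \<inter> space (borel_sigma X) \<in> sets (borel_sigma X)"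
    by (auto simp: vimage_def Int_def conj_commute intro: openin_borel_sigma)
qed (use assms in \<open>auto simp: continuous_map_def\<close>)

lemma borel_sigma_euclidean: "sets (borel_sigma euclidean) = sets borel"
  by (simp add: borel_sigma_def borel_def)

lemma cont_functions_measurable:
  assumes "f \<in> cont_functions X"
  shows "f \<in> borel_measurable (borel_sigma X)"
  using continuous_map_measurable[of X euclideanreal f] assms
  by (simp add: cont_functions_def measurable_cong_sets[OF refl borel_sigma_euclidean])

section \<open>Compact metrizable spaces as images of compact sets of reals\<close>

text \<open>A sequence \<open>b\<close> of bits codes \<open>x\<close> if \<open>x \<in> D n\<close> whenever \<open>b n\<close>, and \<open>x \<notin> U n\<close> otherwise. This
  relation between bits and points is closed, hence compact, and it determines \<open>x\<close> from \<open>b\<close>; so its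
  projection to the codes is a compact set on which decoding is continuous. The section \<open>s\<close> uses the
  bits of \<open>x \<in> U n\<close>; it need not be continuous, but it is Borel.\<close>

lemma cantor_parametrization:
  fixes X :: "'a topology"
  assumes "compact_space X" "metrizable_space X"
  shows "\<exists>S (\<pi> :: real \<Rightarrow> 'a) s. compact S \<and> continuous_map (subtopology euclideanreal S) X \<pi> \<and>
    s \<in> borel_measurable (borel_sigma X) \<and> (\<forall>x\<in>topspace X. s x \<in> S \<and> \<pi> (s x) = x)"
proof -
  obtain U D :: "nat \<Rightarrow> 'a set" where
    U: "\<forall>n. openin X (U n)" and D: "\<forall>n. closedin X (D n)" and UD: "\<forall>n. U n \<subseteq> D n"
    and sep: "\<forall>x\<in>topspace X. \<forall>y\<in>topspace X. x \<noteq> y \<longrightarrow> (\<exists>n. x \<in> U n \<and> y \<notin> D n)"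
    using separating_sequence[OF assms] by metis
  note U = U[rule_format] and D = D[rule_format] and UD = UD[rule_format]
  let ?P = "prod_topology binary_sequences X"
  define G where "G = {(b, x). x \<in> topspace X \<and> (\<forall>n. if b n then x \<in> D n else x \<notin> U n)}"
  have cont_bit: "continuous_map ?P (discrete_topology UNIV) (\<lambda>p. fst p n)" for n
    using continuous_map_compose[OF continuous_map_fst continuous_map_product_projection[of n UNIV "\<lambda>_. discrete_topology UNIV"]]
    by (simp add: o_def)
  have "G = (\<Inter>n. {p \<in> topspace ?P. fst p n \<in> {True} \<and> snd p \<in> D n} \<union>
                {p \<in> topspace ?P. fst p n \<in> {False} \<and> snd p \<in> topspace X - U n})"
    using closedin_subset[OF D] by (auto simp: G_def split: if_splits)
  moreover have "closedin ?P \<dots>"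
  proof (intro closedin_INT closedin_Un)
    fix n
    have 1: "closedin ?P {p \<in> topspace ?P. fst p n \<in> {t}}" for t
      by (rule closedin_continuous_map_preimage[OF cont_bit]) simp
    have 2: "closedin ?P {p \<in> topspace ?P. snd p \<in> C}" if "closedin X C" for C
      by (rule closedin_continuous_map_preimage[OF continuous_map_snd that])
    have 3: "closedin ?P ({p \<in> topspace ?P. fst p n \<in> {t}} \<inter> {p \<in> topspace ?P. snd p \<in> C})"
      if "closedin X C" for C t
      by (intro closedin_Int 1 2 that)
    have eq: "{p \<in> topspace ?P. fst p n \<in> {t} \<and> snd p \<in> C} =
        {p \<in> topspace ?P. fst p n \<in> {t}} \<inter> {p \<in> topspace ?P. snd p \<in> C}" for t C
      by auto
    show "closedin ?P {p \<in> topspace ?P. fst p n \<in> {True} \<and> snd p \<in> D n}"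
      unfolding eq by (rule 3[OF D])
    show "closedin ?P {p \<in> topspace ?P. fst p n \<in> {False} \<and> snd p \<in> topspace X - U n}"
      unfolding eq by (rule 3[OF closedin_diff[OF closedin_topspace U]])
  qed auto
  ultimately have G_closed: "closedin ?P G" by simp
  have "compact_space ?P"
    using assms(1) by (simp add: compact_space_prod_topology compact_space_product_topology compact_space_discrete_topology)
  then have G_compact: "compactin ?P (G \<inter> Z)" if "closedin ?P Z" for Z
    using closedin_compact_space closedin_Int[OF G_closed that] by blast
  have image_compact: "compact ((binary_code \<circ> fst) ` (G \<inter> Z))" if "closedin ?P Z" for Z
    using image_compactin[OF G_compact[OF that], of euclideanreal "binary_code \<circ> fst"]
      continuous_map_compose[OF continuous_map_fst continuous_map_binary_code] by auto
  have single: "x = y" if "(b, x) \<in> G" "(b, y) \<in> G" for b x y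
  proof (rule ccontr)
    assume "x \<noteq> y"
    moreover have "x \<in> topspace X" "y \<in> topspace X" using that by (auto simp: G_def)
    ultimately obtain n where "x \<in> U n" "y \<notin> D n" using sep by metis
    with that show False by (auto simp: G_def split: if_splits)
  qed
  define S where "S = (binary_code \<circ> fst) ` G"
  define \<pi> where "\<pi> t = (THE x. (inv binary_code t, x) \<in> G)" for t
  have \<pi>: "\<pi> (binary_code b) = x" if "(b, x) \<in> G" for b x
    unfolding \<pi>_def using that single by (auto simp: inv_f_f[OF inj_binary_code])
  define s where "s x = binary_code (\<lambda>n. x \<in> U n)" for x
  have sG: "((\<lambda>n. x \<in> U n), x) \<in> G" if "x \<in> topspace X" for x
    using that UD by (auto simp: G_def)
  show ?thesis
  proof (intro exI conjI ballI)
    show "compact S"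
      using image_compact[OF closedin_topspace] closedin_subset[OF G_closed] unfolding S_def
      by (simp add: Int_absorb2)
    show "continuous_map (subtopology euclideanreal S) X \<pi>"
      unfolding continuous_map_closedin
    proof (intro conjI allI impI)
      show "\<pi> \<in> topspace (subtopology euclideanreal S) \<rightarrow> topspace X" 
        using \<pi> by (auto simp: S_def G_def)
      fix C assume C: "closedin X C"
      have "{t \<in> S. \<pi> t \<in> C} = (binary_code \<circ> fst) ` (G \<inter> {p \<in> topspace ?P. snd p \<in> C})"
        using \<pi> closedin_subset[OF G_closed] by (force simp: S_def image_iff)
      then have "compact {t \<in> S. \<pi> t \<in> C}"
        using image_compact[OF closedin_continuous_map_preimage[OF continuous_map_snd C]] by simp
      then show "closedin (subtopology euclideanreal S) {x \<in> topspace (subtopology euclideanreal S). \<pi> x \<in> C}"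
        by (auto intro!: closed_subset compact_imp_closed)
    qed
    have [measurable]: "U n \<in> sets (borel_sigma X)" for n
      by (rule openin_borel_sigma[OF U])
    have "(\<lambda>x. of_bool (x \<in> U n) / 4 ^ n :: real) \<in> borel_measurable (borel_sigma X)" for n
      by (measurable)
    then show "s \<in> borel_measurable (borel_sigma X)"
      unfolding s_def binary_code_def by (rule borel_measurable_suminf)
    fix x assume "x \<in> topspace X"
    from sG[OF this] show "s x \<in> S" "\<pi> (s x) = x"
      using \<pi> by (force simp: s_def S_def)+
  qed
qed

section \<open>Sequential compactness of measures, separability of continuous functions\<close>

lemma cont_functions_bounded:
  assumes "compact_space X" "f \<in> cont_functions X"
  obtains B where "0 \<le> B" "\<And>x. x \<in> topspace X \<Longrightarrow> \<bar>f x\<bar> \<le> B"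
proof -
  have "compactin euclideanreal (f ` topspace X)"
    using image_compactin[of X "topspace X" euclideanreal f] assms
    by (simp add: cont_functions_def compact_space_def)
  then have "bounded (f ` topspace X)"
    by (simp add: compact_imp_bounded)
  then obtain B where B: "\<forall>x\<in>topspace X. \<bar>f x\<bar> \<le> B"
    by (auto simp: bounded_iff)
  show ?thesis
    by (rule that[of "\<bar>B\<bar>"]) (use B in auto)
qed

lemma cont_functions_integrable:
  assumes "compact_space X" "f \<in> cont_functions X"
    and "finite_measure \<mu>" "sets \<mu> = sets (borel_sigma X)"
  shows "integrable \<mu> f"
proof -
  interpret finite_measure \<mu> by fact
  obtain B where B: "\<And>x. x \<in> topspace X \<Longrightarrow> \<bar>f x\<bar> \<le> B"
    using cont_functions_bounded[OF assms(1,2)] by blast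
  have "f \<in> borel_measurable \<mu>"
    using cont_functions_measurable[OF assms(2)] by (simp add: measurable_cong_sets[OF assms(4) refl])
  moreover have "space \<mu> = topspace X"
    using sets_eq_imp_space_eq[OF assms(4)] by simp
  ultimately show ?thesis
    using B by (intro integrable_const_bound[of _ B]) auto
qed

text \<open>Push the measures to the line with the Borel section, extract a weak limit there by Helly's
  theorem, and push it back with the continuous decoding map. All measures on the line live on the
  compact set \<open>S\<close>: this gives tightness, the limit also lives on \<open>S\<close> because it integrates the
  distance to \<open>S\<close> to 0, and functions continuous on \<open>S\<close> extend to the line by Tietze's theorem.\<close>

theorem measures_sequentially_compact:
  fixes X :: "'a topology" and \<mu> :: "nat \<Rightarrow> 'a measure"
  assumes X: "compact_space X" "metrizable_space X"
    and prob: "\<And>n. prob_space (\<mu> n)" and sets: "\<And>n. sets (\<mu> n) = sets (borel_sigma X)"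
  shows "\<exists>r \<nu>. strict_mono (r :: nat \<Rightarrow> nat) \<and> prob_space \<nu> \<and> sets \<nu> = sets (borel_sigma X) \<and>
    (\<forall>f\<in>cont_functions X. (\<lambda>n. \<integral>x. f x \<partial>\<mu> (r n)) \<longlonglongrightarrow> (\<integral>x. f x \<partial>\<nu>))"
proof -
  obtain S \<pi> s where S: "compact S" and \<pi>: "continuous_map (subtopology euclideanreal S) X \<pi>"
    and s: "s \<in> borel_measurable (borel_sigma X)"
    and retr: "\<forall>x\<in>topspace X. s x \<in> S \<and> \<pi> (s x) = x"
    using cantor_parametrization[OF X] by blast
  have sS: "s x \<in> S" and \<pi>s: "\<pi> (s x) = x" if "x \<in> topspace X" for x
    using retr that by auto
  have space: "space (\<mu> n) = topspace X" for n
    using sets_eq_imp_space_eq[OF sets] by simp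
  obtain x0 where x0: "x0 \<in> topspace X"
    using prob_space.not_empty[OF prob[of 0]] space[of 0] by blast
  have "S \<noteq> {}" using sS[OF x0] by auto
  have s': "s \<in> borel_measurable (\<mu> n)" for n
    using s by (simp add: measurable_cong_sets[OF sets refl])
  define N where "N n = distr (\<mu> n) borel s" for n
  have N: "real_distribution (N n)" for n
    unfolding N_def by (rule prob_space.real_distribution_distr[OF prob s'])
  obtain B where B: "\<And>t. t \<in> S \<Longrightarrow> \<bar>t\<bar> \<le> B"
    using compact_imp_bounded[OF S] by (auto simp: bounded_iff)
  have "tight N"
    unfolding tight_def
  proof (intro conjI allI impI)
    fix e :: real assume "e > 0"
    have "measure (N n) {-(\<bar>B\<bar> + 1)<..\<bar>B\<bar> + 1} = 1" for n
    proof -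
      have "s -` {-(\<bar>B\<bar> + 1)<..\<bar>B\<bar> + 1} \<inter> space (\<mu> n) = space (\<mu> n)"
        using B[OF sS] by (force simp: space)
      then show ?thesis
        unfolding N_def by (subst measure_distr[OF s']) (simp_all add: prob_space.prob_space[OF prob])
    qed
    then show "\<exists>a b. a < b \<and> (\<forall>n. 1 - e < measure (N n) {a<..b})"
      using \<open>e > 0\<close> by (intro exI[of _ "-(\<bar>B\<bar> + 1)"] exI[of _ "\<bar>B\<bar> + 1"]) auto
  qed (rule N)
  from tight_imp_convergent_subsubsequence[OF this strict_mono_id]
  obtain r M where r: "strict_mono (r :: nat \<Rightarrow> nat)" and M: "real_distribution M"
    and conv: "weak_conv_m (N \<circ> r) M" by auto
  interpret M: real_distribution M by fact
  have lim: "(\<lambda>n. \<integral>x. g (s x) \<partial>\<mu> (r n)) \<longlonglongrightarrow> (\<integral>t. g t \<partial>M)"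
    if g: "continuous_on UNIV g" "\<And>t. \<bar>g t\<bar> \<le> b" for g :: "real \<Rightarrow> real" and b
  proof -
    have "(\<lambda>n. integral\<^sup>L ((N \<circ> r) n) g) \<longlonglongrightarrow> integral\<^sup>L M g"
    proof (rule weak_conv_imp_integral_bdd_continuous_conv[of "N \<circ> r" M g b])
    qed (use N M conv g in \<open>auto simp: continuous_on_eq_continuous_at\<close>)
    moreover have "integral\<^sup>L ((N \<circ> r) n) g = (\<integral>x. g (s x) \<partial>\<mu> (r n))" for n
      unfolding N_def o_def
      by (rule integral_distr[OF s']) (use g in \<open>simp add: borel_measurable_continuous_onI\<close>)
    ultimately show ?thesis by simp
  qed
  have "(\<integral>t. min 1 (infdist t S) \<partial>M) = 0"
  proof -
    have "(\<integral>x. min 1 (infdist (s x) S) \<partial>\<mu> n) = 0" for n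
    proof -
      have "(\<integral>x. min 1 (infdist (s x) S) \<partial>\<mu> n) = (\<integral>x. 0 \<partial>\<mu> n)"
        by (rule Bochner_Integration.integral_cong) (use sS in \<open>auto simp: space\<close>)
      then show ?thesis by simp
    qed
    moreover have "(\<lambda>n. \<integral>x. min 1 (infdist (s x) S) \<partial>\<mu> (r n)) \<longlonglongrightarrow> (\<integral>t. min 1 (infdist t S) \<partial>M)"
      by (rule lim[of _ 1]) (auto intro!: continuous_intros simp: infdist_nonneg)
    ultimately show ?thesis
      by (simp add: LIMSEQ_const_iff)
  qed
  moreover have "(\<lambda>t. min 1 (infdist t S)) \<in> borel_measurable M"
    by (simp add: measurable_cong_sets[OF M.events_eq_borel refl])
      (intro borel_measurable_continuous_onI continuous_intros)
  then have "integrable M (\<lambda>t. min 1 (infdist t S))"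
    by (intro M.integrable_const_bound[of _ 1]) (auto simp: infdist_nonneg)
  ultimately have "AE t in M. min 1 (infdist t S) = 0"
    by (subst (asm) integral_nonneg_eq_0_iff_AE) (auto simp: infdist_nonneg)
  then have AE_S: "AE t in M. t \<in> S"
    by eventually_elim (use in_closed_iff_infdist_zero[OF compact_imp_closed[OF S] \<open>S \<noteq> {}\<close>] in \<open>auto simp: min_def split: if_splits\<close>)
  define \<pi>' where "\<pi>' t = (if t \<in> S then \<pi> t else x0)" for t
  have \<pi>'_top: "\<pi>' t \<in> topspace X" for t
    using x0 \<pi> by (auto simp: \<pi>'_def continuous_map_def)
  have \<pi>': "\<pi>' \<in> measurable M (borel_sigma X)"
  proof (rule measurable_borel_sigma)
    fix U assume U: "openin X U"
    have "openin (subtopology euclideanreal S) {t \<in> S. \<pi> t \<in> U}"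
      using \<pi> U by (simp add: continuous_map_def)
    then obtain V where V: "open V" "{t \<in> S. \<pi> t \<in> U} = S \<inter> V"
      by (auto simp: openin_open)
    have UV: "\<pi> t \<in> U \<longleftrightarrow> t \<in> V" if "t \<in> S" for t
      using V(2) that by blast
    have [measurable]: "S \<in> sets borel" "V \<in> sets borel"
      using V(1) compact_imp_closed[OF S] by auto
    have "\<pi>' -` U \<inter> space M = (S \<inter> V) \<union> (if x0 \<in> U then UNIV - S else {})"
      using UV by (auto simp: \<pi>'_def split: if_splits)
    also have "\<dots> \<in> sets M"
      unfolding M.events_eq_borel by (cases "x0 \<in> U") (auto intro!: sets.Un sets.Int sets.Diff)
    finally show "\<pi>' -` U \<inter> space M \<in> sets M" .
  qed (rule \<pi>'_top)
  define \<nu> where "\<nu> = distr M (borel_sigma X) \<pi>'"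
  have "(\<lambda>n. \<integral>x. f x \<partial>\<mu> (r n)) \<longlonglongrightarrow> (\<integral>x. f x \<partial>\<nu>)" if f: "f \<in> cont_functions X" for f
  proof -
    obtain b where b: "0 \<le> b" "\<And>x. x \<in> topspace X \<Longrightarrow> \<bar>f x\<bar> \<le> b"
      using cont_functions_bounded[OF X(1) f] by blast
    have \<pi>_top: "\<pi> t \<in> topspace X" if "t \<in> S" for t
      using \<pi> that by (auto simp: continuous_map_def)
    have "continuous_map (subtopology euclideanreal S) euclideanreal (f \<circ> \<pi>)"
      using continuous_map_compose[OF \<pi>, of euclideanreal f] f unfolding cont_functions_def by blast
    moreover have "normal_space euclideanreal" "closedin euclideanreal S"
      using compact_imp_closed[OF S] by (simp_all add: metrizable_imp_normal_space metrizable_space_euclidean)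
    moreover have "(f \<circ> \<pi>) ` S \<subseteq> {- b..b}"
      using b(2)[OF \<pi>_top] by (force simp: abs_le_iff)
    moreover have "- b \<le> b" using b(1) by simp
    ultimately obtain F where F: "continuous_map euclideanreal euclideanreal F"
      "\<And>t. t \<in> S \<Longrightarrow> F t = (f \<circ> \<pi>) t" "F ` topspace euclideanreal \<subseteq> {-b..b}"
      using Tietze_extension_closed_real_interval[of euclideanreal S "f \<circ> \<pi>" "-b" b] that by blast
    have Fc: "continuous_on UNIV F" using F(1) by simp
    have "\<bar>F t\<bar> \<le> b" for t using F(3) by (auto simp: abs_le_iff image_subset_iff minus_le_iff)
    from lim[OF Fc this] have 1: "(\<lambda>n. \<integral>x. F (s x) \<partial>\<mu> (r n)) \<longlonglongrightarrow> (\<integral>t. F t \<partial>M)" .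
    have 2: "(\<integral>x. F (s x) \<partial>\<mu> (r n)) = (\<integral>x. f x \<partial>\<mu> (r n))" for n
      by (rule Bochner_Integration.integral_cong) (use F(2) sS \<pi>s in \<open>auto simp: space\<close>)
    have "(\<integral>x. f x \<partial>\<nu>) = (\<integral>t. f (\<pi>' t) \<partial>M)"
      unfolding \<nu>_def by (rule integral_distr[OF \<pi>' cont_functions_measurable[OF f]])
    also have "\<dots> = (\<integral>t. F t \<partial>M)"
    proof (rule integral_cong_AE)
      show "(\<lambda>t. f (\<pi>' t)) \<in> borel_measurable M"
        using measurable_compose[OF \<pi>' cont_functions_measurable[OF f]] .
      show "F \<in> borel_measurable M"
        using Fc by (simp add: measurable_cong_sets[OF M.events_eq_borel refl] borel_measurable_continuous_onI)
      show "AE t in M. f (\<pi>' t) = F t"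
        using AE_S by eventually_elim (simp add: F(2) \<pi>'_def)
    qed
    finally show ?thesis using 1 2 by simp
  qed
  moreover have "prob_space \<nu>" "sets \<nu> = sets (borel_sigma X)"
    unfolding \<nu>_def by (auto intro: M.prob_space_distr[OF \<pi>'])
  ultimately show ?thesis using r by blast
qed

text \<open>Composed with the decoding map, a continuous function becomes a continuous function on a
  compact set of reals, so rational polynomials in the code approximate it. Any subset \<open>P\<close> then
  contains a countable dense subset of itself.\<close>

lemma countable_dense_subset:
  fixes X :: "'a topology"
  assumes X: "compact_space X" "metrizable_space X" and P: "P \<subseteq> cont_functions X"
  shows "\<exists>D\<subseteq>P. countable D \<and> (\<forall>f\<in>P. \<forall>e>0. \<exists>g\<in>D. \<forall>x\<in>topspace X. \<bar>f x - g x\<bar> < e)"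
proof -
  obtain S \<pi> s where S: "compact S" and \<pi>: "continuous_map (subtopology euclideanreal S) X \<pi>"
    and retr: "\<forall>x\<in>topspace X. s x \<in> S \<and> \<pi> (s x) = x"
    using cantor_parametrization[OF X] by blast
  have sS: "s x \<in> S" and \<pi>s: "\<pi> (s x) = x" if "x \<in> topspace X" for x
    using retr that by auto
  obtain B where B: "\<And>t. t \<in> S \<Longrightarrow> \<bar>t\<bar> \<le> B"
    using compact_imp_bounded[OF S] by (auto simp: bounded_iff)
  define q :: "rat list \<Rightarrow> 'a \<Rightarrow> real" where "q as x = (\<Sum>i<length as. of_rat (as ! i) * s x ^ i)" for as x
  have approx: "\<exists>as. \<forall>x\<in>topspace X. \<bar>f x - q as x\<bar> < e" if f: "f \<in> cont_functions X" and "e > 0" for f e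
  proof -
    have "continuous_on S (f \<circ> \<pi>)"
      using continuous_map_compose[OF \<pi>] f by (force simp: cont_functions_def)
    moreover have "0 < e / 2" using \<open>e > 0\<close> by simp
    ultimately obtain g where g: "real_polynomial_function g"
      "\<And>t. t \<in> S \<Longrightarrow> \<bar>(f \<circ> \<pi>) t - g t\<bar> < e / 2"
      by (rule Stone_Weierstrass_real_polynomial_function[OF S]) (rule that)
    then obtain a n where a: "g = (\<lambda>t. \<Sum>i\<le>n. a i * t ^ i)"
      using real_polynomial_function_iff_sum by blast
    define C where "C = 1 + (\<Sum>i\<le>n. \<bar>B\<bar> ^ i)"
    have "C > 0" unfolding C_def by (intro add_pos_nonneg sum_nonneg) auto
    have "\<exists>r. \<bar>a i - of_rat r\<bar> < e / (2 * C)" for i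
    proof -
      obtain r where "a i < of_rat r" "of_rat r < a i + e / (2 * C)"
        using of_rat_dense[of "a i" "a i + e / (2 * C)"] \<open>e > 0\<close> \<open>C > 0\<close> by auto
      then show ?thesis by (intro exI[of _ r]) linarith
    qed
    then obtain r where r: "\<And>i. \<bar>a i - of_rat (r i)\<bar> < e / (2 * C)" by metis
    let ?as = "map r [0..<Suc n]"
    have "\<bar>f x - q ?as x\<bar> < e" if x: "x \<in> topspace X" for x
    proof -
      have q: "q ?as x = (\<Sum>i\<le>n. of_rat (r i) * s x ^ i)"
        unfolding q_def by (intro sum.cong) (auto simp del: upt_Suc simp: nth_append)
      have "\<bar>g (s x) - q ?as x\<bar> = \<bar>\<Sum>i\<le>n. (a i - of_rat (r i)) * s x ^ i\<bar>"
        unfolding q a by (simp add: sum_subtractf algebra_simps)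
      also have "\<dots> \<le> (\<Sum>i\<le>n. \<bar>(a i - of_rat (r i)) * s x ^ i\<bar>)"
        by (rule sum_abs)
      also have "\<dots> \<le> (\<Sum>i\<le>n. e / (2 * C) * \<bar>B\<bar> ^ i)"
      proof (rule sum_mono)
        fix i
        have "\<bar>s x\<bar> \<le> \<bar>B\<bar>" using B[OF sS[OF x]] by linarith
        then show "\<bar>(a i - of_rat (r i)) * s x ^ i\<bar> \<le> e / (2 * C) * \<bar>B\<bar> ^ i"
          unfolding abs_mult power_abs
          using r[of i] by (intro mult_mono power_mono) auto
      qed
      also have "\<dots> = e / (2 * C) * (C - 1)"
        by (simp add: C_def sum_distrib_left)
      also have "\<dots> < e / 2"
        using \<open>e > 0\<close> \<open>C > 0\<close> by (simp add: field_simps)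
      finally have "\<bar>g (s x) - q ?as x\<bar> < e / 2" .
      moreover have "\<bar>f x - g (s x)\<bar> < e / 2"
        using g(2)[OF sS[OF x]] \<pi>s[OF x] by simp
      ultimately show ?thesis by linarith
    qed
    then show ?thesis by blast
  qed
  define A where "A p = {f \<in> P. \<forall>x\<in>topspace X. \<bar>f x - q (fst p) x\<bar> < 1 / Suc (snd p)}" for p
  define D where "D = (\<lambda>p. SOME f. f \<in> A p) ` {p. A p \<noteq> {}}"
  have some: "(SOME f. f \<in> A p) \<in> A p" if "A p \<noteq> {}" for p
    using that by (simp add: some_in_eq)
  show ?thesis
  proof (intro exI[of _ D] conjI ballI allI impI)
    show "D \<subseteq> P" using some by (auto simp: D_def A_def)
    show "countable D" unfolding D_def by (intro countable_image) auto
  next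
    fix f and e :: real assume f: "f \<in> P" "e > 0"
    obtain n where n: "1 / Suc n < e / 2"
      using nat_approx_posE[of "e / 2"] f by auto
    obtain as where as: "\<forall>x\<in>topspace X. \<bar>f x - q as x\<bar> < 1 / Suc n"
      using approx[of f "1 / Suc n"] f P by auto
    let ?g = "SOME g. g \<in> A (as, n)"
    have "f \<in> A (as, n)" using as f by (simp add: A_def)
    then have ne: "A (as, n) \<noteq> {}" by blast
    have "\<forall>x\<in>topspace X. \<bar>?g x - q as x\<bar> < 1 / Suc n"
      using some[OF ne] by (simp add: A_def)
    with as n have "\<forall>x\<in>topspace X. \<bar>f x - ?g x\<bar> < e"
      by (smt (verit) field_sum_of_halves)
    then show "\<exists>g\<in>D. \<forall>x\<in>topspace X. \<bar>f x - g x\<bar> < e"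
      using ne by (intro bexI[of _ ?g]) (auto simp: D_def)
  qed
qed

section \<open>Regularity of finite Borel measures\<close>

lemma cont_functions_const [simp]: "(\<lambda>x. c) \<in> cont_functions X"
  by (simp add: cont_functions_def)

lemma cont_functions_add: "f \<in> cont_functions X \<Longrightarrow> g \<in> cont_functions X \<Longrightarrow> (\<lambda>x. f x + g x) \<in> cont_functions X"
  and cont_functions_diff: "f \<in> cont_functions X \<Longrightarrow> g \<in> cont_functions X \<Longrightarrow> (\<lambda>x. f x - g x) \<in> cont_functions X"
  and cont_functions_mult: "f \<in> cont_functions X \<Longrightarrow> (\<lambda>x. c * f x) \<in> cont_functions X"
  and cont_functions_max: "f \<in> cont_functions X \<Longrightarrow> g \<in> cont_functions X \<Longrightarrow> (\<lambda>x. max (f x) (g x)) \<in> cont_functions X"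
  by (simp_all add: cont_functions_def continuous_map_add continuous_map_diff
      continuous_map_real_mult_left continuous_map_real_max)

text \<open>The sets with approximable indicator contain the open sets (an open set is an increasing union
  of closed sets; apply Urysohn's lemma) and form a sigma-algebra.\<close>

lemma continuous_dense_in_L1:
  fixes X :: "'a topology"
  assumes X: "metrizable_space X" and fin: "finite_measure \<mu>"
    and sets: "sets \<mu> = sets (borel_sigma X)" and "A \<in> sets \<mu>" and "0 < e"
  shows "\<exists>\<psi>\<in>cont_functions X. (\<forall>x\<in>topspace X. 0 \<le> \<psi> x \<and> \<psi> x \<le> 1) \<and>
    (\<integral>x. \<bar>\<psi> x - indicat_real A x\<bar> \<partial>\<mu>) < e"
proof -
  interpret finite_measure \<mu> by fact
  have space: "space \<mu> = topspace X"
    using sets_eq_imp_space_eq[OF sets] by simp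
  define W where "W = {\<psi> \<in> cont_functions X. \<forall>x\<in>topspace X. 0 \<le> \<psi> x \<and> \<psi> x \<le> 1}"
  define err where "err \<psi> A = (\<integral>x. \<bar>\<psi> x - indicat_real A x\<bar> \<partial>\<mu>)" for \<psi> A
  have meas: "\<psi> \<in> borel_measurable \<mu>" if "\<psi> \<in> W" for \<psi>
    using that cont_functions_measurable[of \<psi> X]
    by (simp add: W_def measurable_cong_sets[OF sets refl])
  have int: "integrable \<mu> (\<lambda>x. \<bar>\<psi> x - indicat_real A x\<bar>)" if "\<psi> \<in> W" "A \<in> sets \<mu>" for \<psi> A
    using meas[OF that(1)] that
    by (intro integrable_const_bound[of _ 1] AE_I2) (auto simp: W_def space indicator_def abs_le_iff)
  have err_le: "err \<psi> A \<le> err \<psi>' B + measure \<mu> D"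
    if "\<psi> \<in> W" "\<psi>' \<in> W" "A \<in> sets \<mu>" "B \<in> sets \<mu>" "D \<in> sets \<mu>"
      "\<And>x. x \<in> topspace X \<Longrightarrow> \<bar>\<psi> x - indicat_real A x\<bar> \<le> \<bar>\<psi>' x - indicat_real B x\<bar> + indicat_real D x"
    for \<psi> \<psi>' A B D
  proof -
    have "err \<psi> A \<le> (\<integral>x. \<bar>\<psi>' x - indicat_real B x\<bar> + indicat_real D x \<partial>\<mu>)"
      unfolding err_def using that
      by (intro integral_mono Bochner_Integration.integrable_add int) (auto simp: space emeasure_eq_measure)
    also have "\<dots> = err \<psi>' B + measure \<mu> D"
      unfolding err_def using that
      by (subst Bochner_Integration.integral_add) (auto intro!: int simp: emeasure_eq_measure)
    finally show ?thesis .
  qed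
  define approx where "approx A \<longleftrightarrow> A \<in> sets \<mu> \<and> (\<forall>e>0. \<exists>\<psi>\<in>W. err \<psi> A < e)" for A
  have approx_Un: "approx (A \<union> B)" if A: "approx A" and B: "approx B" for A B
    unfolding approx_def
  proof (intro conjI allI impI)
    show AB: "A \<union> B \<in> sets \<mu>" using A B by (auto simp: approx_def)
    fix e :: real assume "e > 0"
    then obtain \<psi> \<eta> where \<psi>: "\<psi> \<in> W" "err \<psi> A < e / 2" and \<eta>: "\<eta> \<in> W" "err \<eta> B < e / 2"
      using A B unfolding approx_def by (meson half_gt_zero)
    define \<rho> where "\<rho> x = max (\<psi> x) (\<eta> x)" for x
    have \<rho>: "\<rho> \<in> W"
      using \<psi>(1) \<eta>(1) by (auto simp: \<rho>_def[abs_def] W_def intro: cont_functions_max)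
    have "err \<rho> (A \<union> B) \<le> (\<integral>x. \<bar>\<psi> x - indicat_real A x\<bar> + \<bar>\<eta> x - indicat_real B x\<bar> \<partial>\<mu>)"
      unfolding err_def
    proof (intro integral_mono Bochner_Integration.integrable_add int \<rho> \<psi>(1) \<eta>(1) AB)
      fix x assume "x \<in> space \<mu>"
      then have "0 \<le> \<psi> x" "\<psi> x \<le> 1" "0 \<le> \<eta> x" "\<eta> x \<le> 1"
        using \<psi>(1) \<eta>(1) by (auto simp: W_def space)
      then show "\<bar>\<rho> x - indicat_real (A \<union> B) x\<bar> \<le> \<bar>\<psi> x - indicat_real A x\<bar> + \<bar>\<eta> x - indicat_real B x\<bar>"
        unfolding \<rho>_def by (cases "x \<in> A"; cases "x \<in> B") (auto simp: max_def)
    qed (use A B in \<open>auto simp: approx_def\<close>)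
    also have "\<dots> = err \<psi> A + err \<eta> B"
      unfolding err_def using A B \<psi>(1) \<eta>(1)
      by (intro Bochner_Integration.integral_add int) (auto simp: approx_def)
    finally show "\<exists>\<psi>\<in>W. err \<psi> (A \<union> B) < e"
      using \<psi>(2) \<eta>(2) \<rho> by (intro bexI[of _ \<rho>]) auto
  qed
  have small_tail: "\<exists>n. measure \<mu> ((\<Union>i. B i) - B n) < e"
    if B: "range B \<subseteq> sets \<mu>" "incseq B" and "e > 0" for B :: "nat \<Rightarrow> 'a set" and e
  proof -
    have "(\<lambda>n. measure \<mu> (B n)) \<longlonglongrightarrow> measure \<mu> (\<Union>i. B i)"
      by (rule finite_Lim_measure_incseq[OF B])
    then have "eventually (\<lambda>n. \<bar>measure \<mu> (B n) - measure \<mu> (\<Union>i. B i)\<bar> < e) sequentially"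
      using \<open>e > 0\<close> by (auto simp: tendsto_iff dist_real_def)
    then obtain n where n: "\<bar>measure \<mu> (B n) - measure \<mu> (\<Union>i. B i)\<bar> < e"
      by (auto simp: eventually_sequentially)
    have "measure \<mu> ((\<Union>i. B i) - B n) = measure \<mu> (\<Union>i. B i) - measure \<mu> (B n)"
      by (rule finite_measure_Diff) (use B in auto)
    with n show ?thesis by (intro exI[of _ n]) linarith
  qed
  have approx_incseq: "approx (\<Union>i. B i)" if B: "\<And>n. approx (B n)" "incseq B" for B :: "nat \<Rightarrow> 'a set"
    unfolding approx_def
  proof (intro conjI allI impI)
    have Bs: "range B \<subseteq> sets \<mu>" using B(1) by (auto simp: approx_def)
    then show U: "(\<Union>i. B i) \<in> sets \<mu>" by auto
    fix e :: real assume "e > 0"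
    then obtain n where n: "measure \<mu> ((\<Union>i. B i) - B n) < e / 2"
      using small_tail[OF Bs B(2), of "e / 2"] by auto
    obtain \<psi> where \<psi>: "\<psi> \<in> W" "err \<psi> (B n) < e / 2"
      using B(1)[of n] \<open>e > 0\<close> unfolding approx_def by (meson half_gt_zero)
    have "err \<psi> (\<Union>i. B i) \<le> err \<psi> (B n) + measure \<mu> ((\<Union>i. B i) - B n)"
      by (rule err_le) (use \<psi> U Bs in \<open>auto simp: indicator_def\<close>)
    with n \<psi> show "\<exists>\<psi>\<in>W. err \<psi> (\<Union>i. B i) < e"
      by (intro bexI[of _ \<psi>]) auto
  qed
  have approx_open: "approx U" if U: "openin X U" for U
    unfolding approx_def
  proof (intro conjI allI impI)
    show Us: "U \<in> sets \<mu>" using openin_borel_sigma[OF U] sets by simp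
    fix e :: real assume "e > 0"
    obtain F where F: "\<forall>n. closedin X (F n)" "\<forall>n. F n \<subseteq> F (Suc n)" "\<Union> (range F) = U"
      using open_imp_fsigma_in[OF X U] unfolding fsigma_in_ascending by blast
    have Fs: "range F \<subseteq> sets \<mu>" using closedin_borel_sigma F(1) sets by auto
    obtain n where n: "measure \<mu> (U - F n) < e"
      using small_tail[OF Fs incseq_SucI \<open>e > 0\<close>] F(2,3) by auto
    have "disjnt (topspace X - U) (F n)" using F(3) by (auto simp: disjnt_def)
    then obtain \<psi> where \<psi>: "continuous_map X (top_of_set {0..1}) \<psi>"
      "\<psi> ` (topspace X - U) \<subseteq> {0::real}" "\<psi> ` F n \<subseteq> {1}"
      using Urysohn_lemma[OF metrizable_imp_normal_space[OF X], of "topspace X - U" "F n" 0 1] U F(1)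
      by (metis closedin_diff closedin_topspace zero_le_one)
    have \<psi>W: "\<psi> \<in> W"
      using \<psi>(1) by (auto simp: W_def cont_functions_def continuous_map_in_subtopology Pi_iff)
    have zero: "(\<lambda>x. 0) \<in> W" by (simp add: W_def)
    have "err \<psi> U \<le> err (\<lambda>x. 0) {} + measure \<mu> (U - F n)"
    proof (rule err_le[OF \<psi>W zero Us])
      fix x assume "x \<in> topspace X"
      then have "0 \<le> \<psi> x" "\<psi> x \<le> 1" "x \<notin> U \<Longrightarrow> \<psi> x = 0" "x \<in> F n \<Longrightarrow> \<psi> x = 1"
        using \<psi>W \<psi>(2,3) by (auto simp: W_def)
      then show "\<bar>\<psi> x - indicat_real U x\<bar> \<le> \<bar>0 - indicat_real {} x\<bar> + indicat_real (U - F n) x"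
        by (cases "x \<in> U"; cases "x \<in> F n") auto
    qed (use Fs Us in auto)
    also have "\<dots> < e" using n by (simp add: err_def)
    finally show "\<exists>\<psi>\<in>W. err \<psi> U < e" using \<psi>W by blast
  qed
  have "A \<in> sigma_sets (topspace X) {U. openin X U}"
    using assms(4) sets by (simp add: borel_sigma_sets)
  then have "approx A"
  proof (induction rule: sigma_sets.induct)
    case (Basic U)
    then show ?case using approx_open by simp
  next
    case Empty
    show ?case using approx_open[OF openin_empty] .
  next
    case (Compl B)
    show ?case
      unfolding approx_def
    proof (intro conjI allI impI)
      show C: "topspace X - B \<in> sets \<mu>"
        using Compl.IH sets.compl_sets[of B \<mu>] by (auto simp: approx_def space)
      fix e :: real assume "e > 0"
      then obtain \<psi> where \<psi>: "\<psi> \<in> W" "err \<psi> B < e"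
        using Compl.IH by (auto simp: approx_def)
      have "(\<lambda>x. 1 - \<psi> x) \<in> W"
        using \<psi>(1) by (auto simp: W_def intro: cont_functions_diff)
      moreover have "err (\<lambda>x. 1 - \<psi> x) (topspace X - B) = err \<psi> B"
        unfolding err_def
        by (intro Bochner_Integration.integral_cong) (auto simp: space indicator_def)
      ultimately show "\<exists>\<psi>\<in>W. err \<psi> (topspace X - B) < e"
        using \<psi> by (intro bexI[of _ "\<lambda>x. 1 - \<psi> x"]) auto
    qed
  next
    case (Union B)
    have "approx (\<Union>i<n. B i)" for n
    proof (induction n)
      case 0
      show ?case using approx_open[OF openin_empty] by simp
    next
      case (Suc n)
      have "(\<Union>i<Suc n. B i) = (\<Union>i<n. B i) \<union> B n"
        by (auto simp: less_Suc_eq)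
      then show ?case using approx_Un[OF Suc Union.IH[of n]] by simp
    qed
    moreover have "incseq (\<lambda>n. \<Union>i<n. B i)"
      by (intro incseq_SucI UN_mono) auto
    moreover have "(\<Union>n. \<Union>i<n. B i) = (\<Union>i. B i)"
      by auto
    ultimately show ?case using approx_incseq[of "\<lambda>n. \<Union>i<n. B i"] by simp
  qed
  with \<open>0 < e\<close> show ?thesis
    by (auto simp: approx_def err_def W_def)
qed

section \<open>Linear combinations of measures\<close>

text \<open>A mixture with arbitrary coefficients, intended for nonnegative ones; negative coefficients
  count as zero. With \<open>b = 0\<close> it serves as scalar multiplication.\<close>

definition measure_comb :: "real \<Rightarrow> 'a measure \<Rightarrow> real \<Rightarrow> 'a measure \<Rightarrow> 'a measure" where
  "measure_comb a \<mu> b \<nu> =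
     measure_of (space \<mu>) (sets \<mu>) (\<lambda>A. ennreal a * emeasure \<mu> A + ennreal b * emeasure \<nu> A)"

lemma sets_measure_comb [simp]: "sets (measure_comb a \<mu> b \<nu>) = sets \<mu>"
  and space_measure_comb [simp]: "space (measure_comb a \<mu> b \<nu>) = space \<mu>"
  by (simp_all add: measure_comb_def)

lemma mixture_eq_measure_comb: "mixture a \<mu> \<nu> = measure_comb a \<mu> (1 - a) \<nu>"
  by (simp add: mixture_def measure_comb_def)

lemma emeasure_measure_comb:
  assumes "sets \<nu> = sets \<mu>" "A \<in> sets \<mu>"
  shows "emeasure (measure_comb a \<mu> b \<nu>) A = ennreal a * emeasure \<mu> A + ennreal b * emeasure \<nu> A"
proof (rule emeasure_measure_of[OF measure_comb_def])
  show "countably_additive (sets (measure_comb a \<mu> b \<nu>))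
      (\<lambda>A. ennreal a * emeasure \<mu> A + ennreal b * emeasure \<nu> A)"
  proof (rule countably_additiveI)
    fix F :: "nat \<Rightarrow> 'a set"
    assume F: "range F \<subseteq> sets (measure_comb a \<mu> b \<nu>)" "disjoint_family F"
    then have "(\<Sum>i. emeasure \<mu> (F i)) = emeasure \<mu> (\<Union>i. F i)"
      and "(\<Sum>i. emeasure \<nu> (F i)) = emeasure \<nu> (\<Union>i. F i)"
      using assms(1) by (auto intro!: suminf_emeasure)
    then show "(\<Sum>i. ennreal a * emeasure \<mu> (F i) + ennreal b * emeasure \<nu> (F i)) =
        ennreal a * emeasure \<mu> (\<Union>i. F i) + ennreal b * emeasure \<nu> (\<Union>i. F i)"
      by (simp add: suminf_add[symmetric])
  qed
qed (use assms sets.space_closed in \<open>auto simp: positive_def\<close>)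

lemma finite_measure_comb:
  assumes "finite_measure \<mu>" "finite_measure \<nu>" "sets \<nu> = sets \<mu>"
  shows "finite_measure (measure_comb a \<mu> b \<nu>)"
proof (rule finite_measureI)
  interpret m: finite_measure \<mu> by fact
  interpret n: finite_measure \<nu> by fact
  show "emeasure (measure_comb a \<mu> b \<nu>) (space (measure_comb a \<mu> b \<nu>)) \<noteq> \<infinity>"
    by (simp add: emeasure_measure_comb[OF assms(3)] m.emeasure_eq_measure n.emeasure_eq_measure
        ennreal_mult_eq_top_iff)
qed

lemma measure_measure_comb:
  assumes "finite_measure \<mu>" "finite_measure \<nu>" "sets \<nu> = sets \<mu>" "A \<in> sets \<mu>" "0 \<le> a" "0 \<le> b"
  shows "measure (measure_comb a \<mu> b \<nu>) A = a * measure \<mu> A + b * measure \<nu> A"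
proof -
  interpret m: finite_measure \<mu> by fact
  interpret n: finite_measure \<nu> by fact
  interpret c: finite_measure "measure_comb a \<mu> b \<nu>"
    by (rule finite_measure_comb) fact+
  have "ennreal (measure (measure_comb a \<mu> b \<nu>) A) = ennreal (a * measure \<mu> A + b * measure \<nu> A)"
    using emeasure_measure_comb[OF assms(3,4), of a b] assms(5,6)
    by (simp add: m.emeasure_eq_measure n.emeasure_eq_measure c.emeasure_eq_measure
        ennreal_mult[symmetric] ennreal_plus[symmetric] del: ennreal_plus)
  then show ?thesis
    using assms(5,6) by (subst (asm) ennreal_inj) auto
qed

lemma nn_integral_measure_comb:
  assumes sets: "sets \<nu> = sets \<mu>" and f: "f \<in> borel_measurable \<mu>"
  shows "(\<integral>\<^sup>+x. f x \<partial>measure_comb a \<mu> b \<nu>) = ennreal a * (\<integral>\<^sup>+x. f x \<partial>\<mu>) + ennreal b * (\<integral>\<^sup>+x. f x \<partial>\<nu>)"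
  using f
proof (induction rule: borel_measurable_induct)
  case (cong f g)
  have "space \<nu> = space \<mu>" by (rule sets_eq_imp_space_eq[OF sets])
  then have "integral\<^sup>N N f = integral\<^sup>N N g" if "N \<in> {\<mu>, \<nu>, measure_comb a \<mu> b \<nu>}" for N
    using that cong(3) by (intro nn_integral_cong) auto
  with cong(4) show ?case by simp
next
  case (set A)
  then show ?case by (simp add: emeasure_measure_comb[OF sets] sets)
next
  case (mult u c)
  have "u \<in> borel_measurable \<nu>" "u \<in> borel_measurable (measure_comb a \<mu> b \<nu>)"
    using mult(2) by (simp_all add: measurable_cong_sets[OF sets refl] measurable_cong_sets[OF sets_measure_comb refl])
  with mult show ?case
    by (simp add: nn_integral_cmult distrib_left mult.left_commute)
next
  case (add u v)
  have "u \<in> borel_measurable \<nu>" "u \<in> borel_measurable (measure_comb a \<mu> b \<nu>)"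
    "v \<in> borel_measurable \<nu>" "v \<in> borel_measurable (measure_comb a \<mu> b \<nu>)"
    using add(1,3) by (simp_all add: measurable_cong_sets[OF sets refl] measurable_cong_sets[OF sets_measure_comb refl])
  with add show ?case
    by (simp add: nn_integral_add distrib_left ac_simps)
next
  case (seq U)
  have m: "\<And>i. U i \<in> borel_measurable \<nu>" "\<And>i. U i \<in> borel_measurable (measure_comb a \<mu> b \<nu>)"
    using seq(1) by (simp_all add: measurable_cong_sets[OF sets refl] measurable_cong_sets[OF sets_measure_comb refl])
  have inc: "incseq (\<lambda>i. c * (\<integral>\<^sup>+x. U i x \<partial>N))" for c :: ennreal and N
    using seq(3) by (auto simp: incseq_def le_fun_def intro!: mult_left_mono nn_integral_mono)
  have "(\<integral>\<^sup>+x. (SUP i. U i) x \<partial>measure_comb a \<mu> b \<nu>) =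
      (SUP i. ennreal a * (\<integral>\<^sup>+x. U i x \<partial>\<mu>) + ennreal b * (\<integral>\<^sup>+x. U i x \<partial>\<nu>))"
    using seq.IH by (simp add: image_comp nn_integral_monotone_convergence_SUP[OF seq(3) m(2)])
  also have "\<dots> = (SUP i. ennreal a * (\<integral>\<^sup>+x. U i x \<partial>\<mu>)) + (SUP i. ennreal b * (\<integral>\<^sup>+x. U i x \<partial>\<nu>))"
    by (rule ennreal_SUP_add[OF inc inc])
  also have "\<dots> = ennreal a * (\<integral>\<^sup>+x. (SUP i. U i) x \<partial>\<mu>) + ennreal b * (\<integral>\<^sup>+x. (SUP i. U i) x \<partial>\<nu>)"
    by (simp add: image_comp nn_integral_monotone_convergence_SUP[OF seq(3) m(1)]
        nn_integral_monotone_convergence_SUP[OF seq(3) seq(1)] SUP_mult_left_ennreal)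
  finally show ?case .
qed

lemma integral_measure_comb:
  fixes f :: "'a \<Rightarrow> real"
  assumes sets: "sets \<nu> = sets \<mu>" and f: "integrable \<mu> f" "integrable \<nu> f" and "0 \<le> a" "0 \<le> b"
  shows "(\<integral>x. f x \<partial>measure_comb a \<mu> b \<nu>) = a * (\<integral>x. f x \<partial>\<mu>) + b * (\<integral>x. f x \<partial>\<nu>)"
proof -
  have pos: "(\<integral>\<^sup>+x. ennreal (g x) \<partial>\<mu>) < \<infinity>" "(\<integral>\<^sup>+x. ennreal (g x) \<partial>\<nu>) < \<infinity>"
    if "g = f \<or> g = (\<lambda>x. - f x)" for g
    using that f integrable_minus[OF f(1)] integrable_minus[OF f(2)]
    by (auto simp: real_integrable_def top.not_eq_extremum)
  have meas: "f \<in> borel_measurable \<mu>" "(\<lambda>x. - f x) \<in> borel_measurable \<mu>"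
    using f by auto
  have eq: "enn2real (\<integral>\<^sup>+x. ennreal (g x) \<partial>measure_comb a \<mu> b \<nu>) =
      a * enn2real (\<integral>\<^sup>+x. ennreal (g x) \<partial>\<mu>) + b * enn2real (\<integral>\<^sup>+x. ennreal (g x) \<partial>\<nu>)"
    and fin: "(\<integral>\<^sup>+x. ennreal (g x) \<partial>measure_comb a \<mu> b \<nu>) < \<infinity>"
    if "g = f \<or> g = (\<lambda>x. - f x)" for g
  proof -
    have g: "(\<lambda>x. ennreal (g x)) \<in> borel_measurable \<mu>"
      using that meas by auto
    show "(\<integral>\<^sup>+x. ennreal (g x) \<partial>measure_comb a \<mu> b \<nu>) < \<infinity>"
      using pos[OF that] by (simp add: nn_integral_measure_comb[OF sets g] ennreal_mult_less_top)
    show "enn2real (\<integral>\<^sup>+x. ennreal (g x) \<partial>measure_comb a \<mu> b \<nu>) =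
      a * enn2real (\<integral>\<^sup>+x. ennreal (g x) \<partial>\<mu>) + b * enn2real (\<integral>\<^sup>+x. ennreal (g x) \<partial>\<nu>)"
      using pos[OF that] assms(4,5)
      by (simp add: nn_integral_measure_comb[OF sets g] enn2real_plus enn2real_mult ennreal_mult_less_top)
  qed
  have "f \<in> borel_measurable (measure_comb a \<mu> b \<nu>)"
    using meas by (simp add: measurable_cong_sets[OF sets_measure_comb refl])
  then have "integrable (measure_comb a \<mu> b \<nu>) f"
    using fin by (auto simp: real_integrable_def top.not_eq_extremum)
  then show ?thesis
    using eq[of f] eq[of "\<lambda>x. - f x"] f
    by (simp add: real_lebesgue_integral_def algebra_simps)
qed

section \<open>Finite invariant measures\<close>

lemma measure_eqI_cont_functions:
  assumes X: "compact_space X" "metrizable_space X"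
    and fin: "finite_measure \<mu>" "finite_measure \<nu>"
    and sets: "sets \<mu> = sets (borel_sigma X)" "sets \<nu> = sets (borel_sigma X)"
    and eq: "\<And>f. f \<in> cont_functions X \<Longrightarrow> integral\<^sup>L \<mu> f = integral\<^sup>L \<nu> f"
  shows "\<mu> = \<nu>"
proof (rule measure_eqI)
  interpret m: finite_measure \<mu> by fact
  interpret n: finite_measure \<nu> by fact
  show sets': "sets \<mu> = sets \<nu>" using sets by simp
  fix A assume A: "A \<in> sets \<mu>"
  have "measure \<mu> A = measure \<nu> A"
  proof (rule ccontr)
    assume ne: "measure \<mu> A \<noteq> measure \<nu> A"
    let ?c = "measure_comb 1 \<mu> 1 \<nu>"
    obtain \<psi> where \<psi>: "\<psi> \<in> cont_functions X"
      "(\<integral>x. \<bar>\<psi> x - indicat_real A x\<bar> \<partial>?c) < \<bar>measure \<mu> A - measure \<nu> A\<bar>"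
      using continuous_dense_in_L1[OF X(2) finite_measure_comb[OF fin sets'[symmetric]], of 1 1 A "\<bar>measure \<mu> A - measure \<nu> A\<bar>"]
        A sets ne by auto
    have i: "integrable \<mu> \<psi>" "integrable \<nu> \<psi>" "integrable \<mu> (indicat_real A)" "integrable \<nu> (indicat_real A)"
      using cont_functions_integrable[OF X(1) \<psi>(1)] fin sets A sets'
      by (auto simp: m.emeasure_eq_measure n.emeasure_eq_measure)
    have "(\<integral>x. \<bar>\<psi> x - indicat_real A x\<bar> \<partial>?c) =
        (\<integral>x. \<bar>\<psi> x - indicat_real A x\<bar> \<partial>\<mu>) + (\<integral>x. \<bar>\<psi> x - indicat_real A x\<bar> \<partial>\<nu>)"
      using i by (subst integral_measure_comb[OF sets'[symmetric]]) auto
    moreover have "\<bar>integral\<^sup>L \<mu> \<psi> - measure \<mu> A\<bar> \<le> (\<integral>x. \<bar>\<psi> x - indicat_real A x\<bar> \<partial>\<mu>)"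
      using integral_abs_bound[of \<mu> "\<lambda>x. \<psi> x - indicat_real A x"] i A by simp
    moreover have "\<bar>integral\<^sup>L \<nu> \<psi> - measure \<nu> A\<bar> \<le> (\<integral>x. \<bar>\<psi> x - indicat_real A x\<bar> \<partial>\<nu>)"
      using integral_abs_bound[of \<nu> "\<lambda>x. \<psi> x - indicat_real A x"] i A sets' by simp
    ultimately show False
      using \<psi>(2) eq[OF \<psi>(1)] by linarith
  qed
  then show "emeasure \<mu> A = emeasure \<nu> A"
    by (simp add: m.emeasure_eq_measure n.emeasure_eq_measure)
qed

locale compact_system =
  fixes X :: "'a topology" and T :: "'a \<Rightarrow> 'a"
  assumes compact: "compact_space X" and metrizable: "metrizable_space X"
    and continuous: "continuous_map X X T"
begin

definition finite_invariant :: "'a measure set" where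
  "finite_invariant = {\<mu>. sets \<mu> = sets (borel_sigma X) \<and> finite_measure \<mu> \<and>
     (\<forall>A\<in>sets \<mu>. emeasure \<mu> (T -` A \<inter> topspace X) = emeasure \<mu> A)}"

lemma finite_invariantD:
  assumes "\<mu> \<in> finite_invariant"
  shows "sets \<mu> = sets (borel_sigma X)" "finite_measure \<mu>" "space \<mu> = topspace X"
    "A \<in> sets (borel_sigma X) \<Longrightarrow> emeasure \<mu> (T -` A \<inter> topspace X) = emeasure \<mu> A"
    "A \<in> sets (borel_sigma X) \<Longrightarrow> measure \<mu> (T -` A \<inter> topspace X) = measure \<mu> A"
    "f \<in> cont_functions X \<Longrightarrow> integrable \<mu> f"
proof -
  show s: "sets \<mu> = sets (borel_sigma X)" and f: "finite_measure \<mu>"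
    using assms by (simp_all add: finite_invariant_def)
  show "space \<mu> = topspace X" using sets_eq_imp_space_eq[OF s] by simp
  show e: "emeasure \<mu> (T -` A \<inter> topspace X) = emeasure \<mu> A" if "A \<in> sets (borel_sigma X)"
    using assms that by (simp add: finite_invariant_def)
  show "measure \<mu> (T -` A \<inter> topspace X) = measure \<mu> A" if "A \<in> sets (borel_sigma X)"
    using e[OF that] by (simp add: measure_def)
  show "integrable \<mu> f" if "f \<in> cont_functions X"
    by (rule cont_functions_integrable[OF compact that f s])
qed

lemma invariant_measures_eq: "\<mu> \<in> invariant_measures X T \<longleftrightarrow> \<mu> \<in> finite_invariant \<and> measure \<mu> (topspace X) = 1"
proof
  assume "\<mu> \<in> invariant_measures X T"
  then show "\<mu> \<in> finite_invariant \<and> measure \<mu> (topspace X) = 1"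
    using sets_eq_imp_space_eq[of \<mu> "borel_sigma X"] prob_space.prob_space[of \<mu>]
    by (auto simp: invariant_measures_def finite_invariant_def prob_space.finite_measure)
next
  assume *: "\<mu> \<in> finite_invariant \<and> measure \<mu> (topspace X) = 1"
  then interpret finite_measure \<mu> by (auto simp: finite_invariantD)
  have "prob_space \<mu>"
    using * by (intro prob_spaceI) (auto simp: finite_invariantD emeasure_eq_measure)
  then show "\<mu> \<in> invariant_measures X T"
    using * by (auto simp: invariant_measures_def finite_invariant_def)
qed

lemma preimage_sets: "A \<in> sets (borel_sigma X) \<Longrightarrow> T -` A \<inter> topspace X \<in> sets (borel_sigma X)"
  using measurable_sets[OF continuous_map_measurable[OF continuous], of A] by simp

lemma finite_invariant_comb:
  assumes "\<mu> \<in> finite_invariant" "\<nu> \<in> finite_invariant"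
  shows "measure_comb a \<mu> b \<nu> \<in> finite_invariant"
proof -
  note \<mu> = finite_invariantD[OF assms(1)] and \<nu> = finite_invariantD[OF assms(2)]
  have "sets \<nu> = sets \<mu>" using \<mu>(1) \<nu>(1) by simp
  note comb = finite_measure_comb[OF \<mu>(2) \<nu>(2) this] emeasure_measure_comb[OF this]
  show ?thesis
    unfolding finite_invariant_def
    by (auto simp: comb \<mu>(1) \<mu>(4) \<nu>(4) preimage_sets)
qed

lemma finite_invariant_measure_comb:
  assumes "\<mu> \<in> finite_invariant" "\<nu> \<in> finite_invariant" "0 \<le> a" "0 \<le> b"
  shows "A \<in> sets (borel_sigma X) \<Longrightarrow> measure (measure_comb a \<mu> b \<nu>) A = a * measure \<mu> A + b * measure \<nu> A"
    and "f \<in> cont_functions X \<Longrightarrow> integral\<^sup>L (measure_comb a \<mu> b \<nu>) f = a * integral\<^sup>L \<mu> f + b * integral\<^sup>L \<nu> f"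
proof -
  note \<mu> = finite_invariantD[OF assms(1)] and \<nu> = finite_invariantD[OF assms(2)]
  have s: "sets \<nu> = sets \<mu>" using \<mu>(1) \<nu>(1) by simp
  show "measure (measure_comb a \<mu> b \<nu>) A = a * measure \<mu> A + b * measure \<nu> A"
    if "A \<in> sets (borel_sigma X)"
    by (rule measure_measure_comb[OF \<mu>(2) \<nu>(2) s _ assms(3,4)]) (simp add: \<mu>(1) that)
  show "integral\<^sup>L (measure_comb a \<mu> b \<nu>) f = a * integral\<^sup>L \<mu> f + b * integral\<^sup>L \<nu> f"
    if "f \<in> cont_functions X"
    by (rule integral_measure_comb[OF s \<mu>(6)[OF that] \<nu>(6)[OF that] assms(3,4)])
qed

lemma integral_abs_le_mass:
  assumes "\<mu> \<in> finite_invariant" "f \<in> cont_functions X" "\<And>x. x \<in> topspace X \<Longrightarrow> \<bar>f x\<bar> \<le> B"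
  shows "\<bar>integral\<^sup>L \<mu> f\<bar> \<le> B * measure \<mu> (topspace X)"
proof -
  have "\<bar>integral\<^sup>L \<mu> f\<bar> \<le> (\<integral>x. \<bar>f x\<bar> \<partial>\<mu>)"
    by (rule integral_abs_bound)
  also have "\<dots> \<le> (\<integral>x. B \<partial>\<mu>)"
    using assms by (intro integral_mono integrable_abs finite_measure.integrable_const)
      (auto simp: finite_invariantD)
  also have "\<dots> = B * measure \<mu> (topspace X)"
    using assms(1) by (simp add: finite_invariantD)
  finally show ?thesis .
qed

lemma finite_invariant_eqI:
  assumes "\<mu> \<in> finite_invariant" "\<nu> \<in> finite_invariant"
    "\<And>A. A \<in> sets (borel_sigma X) \<Longrightarrow> measure \<mu> A = measure \<nu> A"
  shows "\<mu> = \<nu>"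
proof (rule measure_eqI)
  note \<mu> = finite_invariantD[OF assms(1)] and \<nu> = finite_invariantD[OF assms(2)]
  show "sets \<mu> = sets \<nu>" using \<mu>(1) \<nu>(1) by simp
  fix A assume "A \<in> sets \<mu>"
  then show "emeasure \<mu> A = emeasure \<nu> A"
    using assms(3)[of A] \<mu>(1) by (simp add: finite_measure.emeasure_eq_measure \<mu>(2) \<nu>(2))
qed

text \<open>Subtraction of a dominated invariant measure, phrased with a sum so that integrals follow by
  linearity.\<close>

lemma finite_invariant_diff:
  assumes \<mu>: "\<mu> \<in> finite_invariant" and \<nu>: "\<nu> \<in> finite_invariant"
    and le: "\<And>A. A \<in> sets (borel_sigma X) \<Longrightarrow> measure \<nu> A \<le> measure \<mu> A"
  shows "\<exists>\<delta>\<in>finite_invariant. measure_comb 1 \<nu> 1 \<delta> = \<mu>"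
proof
  let ?d = "diff_measure \<mu> \<nu>"
  have sets: "sets \<mu> = sets \<nu>" using \<mu> \<nu> by (simp add: finite_invariantD)
  interpret m: finite_measure \<mu> using \<mu> by (simp add: finite_invariantD)
  interpret n: finite_measure \<nu> using \<nu> by (simp add: finite_invariantD)
  have ed: "emeasure ?d A = emeasure \<mu> A - emeasure \<nu> A" if "A \<in> sets (borel_sigma X)" for A
    using that le \<mu> \<nu>
    by (intro emeasure_diff_measure sets m.finite_measure_axioms n.finite_measure_axioms)
      (auto simp: finite_invariantD m.emeasure_eq_measure n.emeasure_eq_measure)
  have top: "topspace X \<in> sets (borel_sigma X)" by (rule openin_borel_sigma) simp
  show d: "?d \<in> finite_invariant"
    unfolding finite_invariant_def
  proof (intro CollectI conjI ballI)
    show "sets ?d = sets (borel_sigma X)" using \<mu> by (simp add: finite_invariantD)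
    show "finite_measure ?d"
      using \<mu> by (intro finite_measureI)
        (simp add: finite_invariantD ed[OF top] m.emeasure_eq_measure ennreal_minus_eq_top)
    fix A assume "A \<in> sets ?d"
    then have A: "A \<in> sets (borel_sigma X)" using \<mu> by (simp add: finite_invariantD)
    show "emeasure ?d (T -` A \<inter> topspace X) = emeasure ?d A"
      using \<mu> \<nu> A preimage_sets[OF A] by (simp add: ed finite_invariantD)
  qed
  interpret d: finite_measure ?d using d by (simp add: finite_invariantD)
  show "measure_comb 1 \<nu> 1 ?d = \<mu>"
  proof (rule finite_invariant_eqI[OF finite_invariant_comb[OF \<nu> d] \<mu>])
    fix A assume A: "A \<in> sets (borel_sigma X)"
    have "ennreal (measure ?d A) = ennreal (measure \<mu> A - measure \<nu> A)"
      using ed[OF A] by (simp add: m.emeasure_eq_measure n.emeasure_eq_measure d.emeasure_eq_measure ennreal_minus)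
    then have "measure ?d A = measure \<mu> A - measure \<nu> A"
      using le[OF A] by (subst (asm) ennreal_inj) auto
    then show "measure (measure_comb 1 \<nu> 1 ?d) A = measure \<mu> A"
      by (simp add: finite_invariant_measure_comb[OF \<nu> d] A)
  qed
qed

text \<open>The image of the limit under \<open>T\<close> and the limit itself give the same integrals of continuous
  functions, since \<open>f \<circ> T\<close> is continuous.\<close>

lemma invariant_measures_limit:
  assumes \<mu>: "\<And>n. \<mu> n \<in> invariant_measures X T" and \<nu>: "prob_space \<nu>" "sets \<nu> = sets (borel_sigma X)"
    and lim: "\<And>f. f \<in> cont_functions X \<Longrightarrow> (\<lambda>n. integral\<^sup>L (\<mu> n) f) \<longlonglongrightarrow> integral\<^sup>L \<nu> f"
  shows "\<nu> \<in> invariant_measures X T"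
proof -
  interpret prob_space \<nu> by fact
  have space: "space \<nu> = topspace X" using sets_eq_imp_space_eq[OF \<nu>(2)] by simp
  have T: "T \<in> measurable N (borel_sigma X)" if "sets N = sets (borel_sigma X)" for N
    using continuous_map_measurable[OF continuous] by (simp add: measurable_cong_sets[OF that refl])
  let ?\<nu>' = "distr \<nu> (borel_sigma X) T"
  have "?\<nu>' = \<nu>"
  proof (rule measure_eqI_cont_functions[OF compact metrizable])
    show "finite_measure ?\<nu>'"
      by (rule finite_measure_distr[OF T[OF \<nu>(2)]])
    show "finite_measure \<nu>" by unfold_locales
    fix f assume f: "f \<in> cont_functions X"
    have fT: "f \<circ> T \<in> cont_functions X"
      using continuous_map_compose[OF continuous] f unfolding cont_functions_def by blast
    have "integral\<^sup>L (\<mu> n) (f \<circ> T) = integral\<^sup>L (\<mu> n) f" for n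
    proof -
      have \<mu>n: "\<mu> n \<in> finite_invariant" using \<mu> by (simp add: invariant_measures_eq)
      have "distr (\<mu> n) (borel_sigma X) T = \<mu> n"
      proof (rule measure_eqI)
        fix A assume "A \<in> sets (distr (\<mu> n) (borel_sigma X) T)"
        then show "emeasure (distr (\<mu> n) (borel_sigma X) T) A = emeasure (\<mu> n) A"
          using \<mu>n by (simp add: emeasure_distr T finite_invariantD)
      qed (use \<mu>n in \<open>simp add: finite_invariantD\<close>)
      then show ?thesis
        using integral_distr[OF T cont_functions_measurable[OF f], of "\<mu> n"] \<mu>n
        by (simp add: finite_invariantD o_def)
    qed
    with lim[OF fT] lim[OF f] have "integral\<^sup>L \<nu> (f \<circ> T) = integral\<^sup>L \<nu> f"
      using LIMSEQ_unique by fastforce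
    then show "integral\<^sup>L ?\<nu>' f = integral\<^sup>L \<nu> f"
      using integral_distr[OF T[OF \<nu>(2)] cont_functions_measurable[OF f]] by (simp add: o_def)
  qed (use \<nu> in auto)
  then have "emeasure \<nu> (T -` A \<inter> topspace X) = emeasure \<nu> A" if "A \<in> sets (borel_sigma X)" for A
    using emeasure_distr[OF T[OF \<nu>(2)] that] by (simp add: space)
  then show ?thesis using \<nu> by (auto simp: invariant_measures_def)
qed

text \<open>For a Hahn decomposition \<open>Y\<close> of \<open>w = \<mu> - \<nu>\<close>, the positive part is \<open>a = w(Y \<inter> _)\<close>. As \<open>w\<close> is
  invariant, \<open>a A = w (T\<inverse>(Y \<inter> A))\<close>, and this is at most \<open>a (T\<inverse> A)\<close> since \<open>w\<close> is never larger than
  its positive part. The same inequality for the complement of \<open>A\<close> gives equality, because both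
  sides have the same total mass.\<close>

lemma positive_part_invariant:
  assumes \<mu>: "\<mu> \<in> finite_invariant" and \<nu>: "\<nu> \<in> finite_invariant" and Y: "Y \<in> sets (borel_sigma X)"
    and pos: "\<And>A. A \<in> sets (borel_sigma X) \<Longrightarrow> A \<subseteq> Y \<Longrightarrow> measure \<nu> A \<le> measure \<mu> A"
    and neg: "\<And>A. A \<in> sets (borel_sigma X) \<Longrightarrow> A \<inter> Y = {} \<Longrightarrow> measure \<mu> A \<le> measure \<nu> A"
  shows "\<exists>a\<in>finite_invariant. \<forall>A\<in>sets (borel_sigma X). measure a A = measure \<mu> (Y \<inter> A) - measure \<nu> (Y \<inter> A)"
proof -
  interpret m: finite_measure \<mu> using \<mu> by (simp add: finite_invariantD)
  interpret n: finite_measure \<nu> using \<nu> by (simp add: finite_invariantD)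
  have sets: "sets \<mu> = sets (borel_sigma X)" "sets \<nu> = sets (borel_sigma X)"
    using \<mu> \<nu> by (simp_all add: finite_invariantD)
  have top: "topspace X \<in> sets (borel_sigma X)" by (rule openin_borel_sigma) simp
  let ?m = "density \<mu> (indicator Y)" and ?n = "density \<nu> (indicator Y)"
  define a where "a = diff_measure ?m ?n"
  have em: "emeasure ?m A = emeasure \<mu> (Y \<inter> A)" "emeasure ?n A = emeasure \<nu> (Y \<inter> A)"
    if "A \<in> sets (borel_sigma X)" for A
    using that Y sets by (simp_all add: emeasure_restricted)
  have fin: "finite_measure ?m" "finite_measure ?n"
    using em[OF top] \<mu> \<nu>
    by (auto intro!: finite_measureI simp: finite_invariantD m.emeasure_eq_measure n.emeasure_eq_measure)
  have ea: "emeasure a A = emeasure \<mu> (Y \<inter> A) - emeasure \<nu> (Y \<inter> A)" if "A \<in> sets (borel_sigma X)" for A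
    unfolding a_def using that em pos Y
    by (subst emeasure_diff_measure[OF fin])
      (auto simp: sets m.emeasure_eq_measure n.emeasure_eq_measure)
  have sets_a: "sets a = sets (borel_sigma X)" "space a = topspace X"
    using \<mu> by (simp_all add: a_def sets finite_invariantD)
  have fin_a: "finite_measure a"
    by (intro finite_measureI) (simp add: sets_a ea[OF top] m.emeasure_eq_measure ennreal_minus_eq_top)
  interpret a: finite_measure a by (rule fin_a)
  have ma: "measure a A = measure \<mu> (Y \<inter> A) - measure \<nu> (Y \<inter> A)" if A: "A \<in> sets (borel_sigma X)" for A
  proof -
    have le: "measure \<nu> (Y \<inter> A) \<le> measure \<mu> (Y \<inter> A)"
      using pos[of "Y \<inter> A"] A Y by auto
    have "ennreal (measure a A) = ennreal (measure \<mu> (Y \<inter> A) - measure \<nu> (Y \<inter> A))"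
      using ea[OF A] by (simp add: a.emeasure_eq_measure m.emeasure_eq_measure n.emeasure_eq_measure ennreal_minus)
    then show ?thesis using le by (subst (asm) ennreal_inj) auto
  qed
  have le: "measure a A \<le> measure a (T -` A \<inter> topspace X)" if A: "A \<in> sets (borel_sigma X)" for A
  proof -
    let ?Z = "T -` (Y \<inter> A) \<inter> topspace X"
    have YA: "Y \<inter> A \<in> sets (borel_sigma X)" using A Y by auto
    have Z: "?Z \<in> sets (borel_sigma X)" by (rule preimage_sets[OF YA])
    have eq: "(Y \<inter> ?Z) \<union> (?Z - Y) = ?Z" by auto
    have "measure M ((Y \<inter> ?Z) \<union> (?Z - Y)) = measure M (Y \<inter> ?Z) + measure M (?Z - Y)"
      if "finite_measure M" "sets M = sets (borel_sigma X)" for M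
      by (rule finite_measure.finite_measure_Union[OF that(1)]) (use Z Y that(2) in auto)
    from this[OF m.finite_measure_axioms sets(1)] this[OF n.finite_measure_axioms sets(2)]
    have split: "measure \<mu> ?Z = measure \<mu> (Y \<inter> ?Z) + measure \<mu> (?Z - Y)"
      "measure \<nu> ?Z = measure \<nu> (Y \<inter> ?Z) + measure \<nu> (?Z - Y)"
      unfolding eq .
    have "measure a A = measure \<mu> ?Z - measure \<nu> ?Z"
      unfolding ma[OF A] finite_invariantD(5)[OF \<mu> YA] finite_invariantD(5)[OF \<nu> YA] by (rule refl)
    also have "\<dots> \<le> measure \<mu> (Y \<inter> ?Z) - measure \<nu> (Y \<inter> ?Z)"
      using split neg[OF sets.Diff[OF Z Y]] by auto
    also have "\<dots> = measure a ?Z" by (rule ma[OF Z, symmetric])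
    also have "\<dots> \<le> measure a (T -` A \<inter> topspace X)"
      using preimage_sets[OF A] by (intro a.finite_measure_mono) (auto simp: sets_a)
    finally show ?thesis .
  qed
  have "measure a (T -` A \<inter> topspace X) = measure a A" if A: "A \<in> sets (borel_sigma X)" for A
  proof -
    have cA: "topspace X - A \<in> sets (borel_sigma X)" using A top by auto
    have "T -` (topspace X - A) \<inter> topspace X = topspace X - (T -` A \<inter> topspace X)"
      using continuous by (auto simp: continuous_map_def)
    then have "measure a (topspace X - A) \<le> measure a (topspace X - (T -` A \<inter> topspace X))"
      using le[OF cA] by simp
    then show ?thesis
      using a.finite_measure_compl[of A] a.finite_measure_compl[of "T -` A \<inter> topspace X"] A preimage_sets[OF A] le[OF A]
      by (simp add: sets_a)
  qed
  then have "a \<in> finite_invariant"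
    by (auto simp: finite_invariant_def sets_a fin_a a.emeasure_eq_measure)
  with ma show ?thesis by blast
qed

lemma jordan_decomposition_invariant:
  assumes \<mu>: "\<mu> \<in> finite_invariant" and \<nu>: "\<nu> \<in> finite_invariant"
  shows "\<exists>a\<in>finite_invariant. \<exists>b\<in>finite_invariant. \<exists>Y\<in>sets (borel_sigma X).
    (\<forall>A\<in>sets (borel_sigma X). measure b A \<le> measure \<nu> A) \<and>
    (\<forall>f\<in>cont_functions X. integral\<^sup>L \<mu> f - integral\<^sup>L \<nu> f = integral\<^sup>L a f - integral\<^sup>L b f) \<and>
    measure a (topspace X - Y) = 0 \<and> measure b Y = 0"
proof -
  interpret m: finite_measure \<mu> using \<mu> by (simp add: finite_invariantD)
  interpret n: finite_measure \<nu> using \<nu> by (simp add: finite_invariantD)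
  have sets: "sets \<mu> = sets (borel_sigma X)" "sets \<nu> = sets (borel_sigma X)"
    using \<mu> \<nu> by (simp_all add: finite_invariantD)
  have top: "topspace X \<in> sets (borel_sigma X)" by (rule openin_borel_sigma) simp
  obtain Y where Y: "Y \<in> sets (borel_sigma X)"
    and pos: "\<And>A. A \<in> sets (borel_sigma X) \<Longrightarrow> A \<subseteq> Y \<Longrightarrow> measure \<nu> A \<le> measure \<mu> A"
    and neg: "\<And>A. A \<in> sets (borel_sigma X) \<Longrightarrow> A \<inter> Y = {} \<Longrightarrow> measure \<mu> A \<le> measure \<nu> A"
    using finite_unsigned_Hahn_decomposition[OF m.finite_measure_axioms n.finite_measure_axioms] sets
    by (auto simp: m.emeasure_eq_measure n.emeasure_eq_measure)
  obtain a where a: "a \<in> finite_invariant"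
    "\<And>A. A \<in> sets (borel_sigma X) \<Longrightarrow> measure a A = measure \<mu> (Y \<inter> A) - measure \<nu> (Y \<inter> A)"
    using positive_part_invariant[OF \<mu> \<nu> Y pos neg] by blast
  let ?Y' = "topspace X - Y"
  have Y': "?Y' \<in> sets (borel_sigma X)" using Y top by auto
  have sub: "A \<subseteq> topspace X" if "A \<in> sets (borel_sigma X)" for A
    using sets.sets_into_space[OF that] by simp
  have disj: "A \<inter> Y = {}" if "A \<subseteq> ?Y'" for A using that by auto
  have disj': "A \<subseteq> Y" if "A \<inter> ?Y' = {}" "A \<in> sets (borel_sigma X)" for A using that sub[OF that(2)] by auto
  obtain b where b: "b \<in> finite_invariant"
    "\<And>A. A \<in> sets (borel_sigma X) \<Longrightarrow> measure b A = measure \<nu> (?Y' \<inter> A) - measure \<mu> (?Y' \<inter> A)"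
    using positive_part_invariant[OF \<nu> \<mu> Y'] neg disj pos disj' by metis
  have split: "measure \<mu> A = measure \<mu> (Y \<inter> A) + measure \<mu> (?Y' \<inter> A)"
    "measure \<nu> A = measure \<nu> (Y \<inter> A) + measure \<nu> (?Y' \<inter> A)" if A: "A \<in> sets (borel_sigma X)" for A
  proof -
    have eq: "(Y \<inter> A) \<union> (?Y' \<inter> A) = A" using sub[OF A] by auto
    have "measure M ((Y \<inter> A) \<union> (?Y' \<inter> A)) = measure M (Y \<inter> A) + measure M (?Y' \<inter> A)"
      if "finite_measure M" "sets M = sets (borel_sigma X)" for M
      by (rule finite_measure.finite_measure_Union[OF that(1)]) (use A Y Y' that(2) in auto)
    from this[OF m.finite_measure_axioms sets(1)] this[OF n.finite_measure_axioms sets(2)]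
    show "measure \<mu> A = measure \<mu> (Y \<inter> A) + measure \<mu> (?Y' \<inter> A)"
      "measure \<nu> A = measure \<nu> (Y \<inter> A) + measure \<nu> (?Y' \<inter> A)"
      unfolding eq .
  qed
  have eq: "measure_comb 1 \<mu> 1 b = measure_comb 1 \<nu> 1 a"
    using split a b
    by (intro finite_invariant_eqI finite_invariant_comb \<mu> \<nu>)
      (simp_all add: finite_invariant_measure_comb[OF \<mu> b(1)] finite_invariant_measure_comb[OF \<nu> a(1)])
  have "integral\<^sup>L \<mu> f - integral\<^sup>L \<nu> f = integral\<^sup>L a f - integral\<^sup>L b f" if "f \<in> cont_functions X" for f
    using finite_invariant_measure_comb(2)[OF \<mu> b(1) _ _ that, of 1 1]
      finite_invariant_measure_comb(2)[OF \<nu> a(1) _ _ that, of 1 1] by (simp add: eq)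
  moreover have "measure b A \<le> measure \<nu> A" if "A \<in> sets (borel_sigma X)" for A
    using b(2)[OF that] split(2)[OF that] measure_nonneg[of \<mu> "?Y' \<inter> A"] measure_nonneg[of \<nu> "Y \<inter> A"] by linarith
  moreover have "measure a ?Y' = 0" "measure b Y = 0"
    using a(2)[OF Y'] b(2)[OF Y] by (simp_all add: Diff_Int_distrib Int_commute)
  ultimately show ?thesis
    using a(1) b(1) Y by blast
qed

text \<open>If \<open>a\<close> and \<open>b\<close> are mutually singular, the total variation of \<open>a - b\<close> is the sum of the
  masses; a continuous approximation of the function 1 on \<open>Y\<close>, -1 off \<open>Y\<close> attains half of it.\<close>

lemma signed_mass_attained:
  assumes a: "a \<in> finite_invariant" and b: "b \<in> finite_invariant" and Y: "Y \<in> sets (borel_sigma X)"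
    and null: "measure a (topspace X - Y) = 0" "measure b Y = 0"
  shows "\<exists>\<psi>\<in>cont_functions X. (\<forall>x\<in>topspace X. \<bar>\<psi> x\<bar> \<le> 1) \<and>
    measure a (topspace X) + measure b (topspace X) \<le> 2 * (integral\<^sup>L a \<psi> - integral\<^sup>L b \<psi>)"
proof (cases "measure a (topspace X) + measure b (topspace X) = 0")
  case True
  then show ?thesis by (intro bexI[of _ "\<lambda>x. 0"]) auto
next
  case False
  define M where "M = measure a (topspace X) + measure b (topspace X)"
  have M: "M > 0" using False unfolding M_def by (smt (verit) measure_nonneg)
  interpret a: finite_measure a using a by (simp add: finite_invariantD)
  interpret b: finite_measure b using b by (simp add: finite_invariantD)
  have sets: "sets a = sets (borel_sigma X)" "sets b = sets (borel_sigma X)"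
    and space: "space a = topspace X" "space b = topspace X"
    using a b by (simp_all add: finite_invariantD)
  let ?c = "measure_comb 1 a 1 b"
  have c: "?c \<in> finite_invariant" by (rule finite_invariant_comb[OF a b])
  obtain \<psi> where \<psi>: "\<psi> \<in> cont_functions X" "\<And>x. x \<in> topspace X \<Longrightarrow> 0 \<le> \<psi> x \<and> \<psi> x \<le> 1"
    and err: "(\<integral>x. \<bar>\<psi> x - indicat_real Y x\<bar> \<partial>?c) < M / 4"
    using continuous_dense_in_L1[OF metrizable finite_invariantD(2)[OF c] finite_invariantD(1)[OF c], of Y "M / 4"]
      Y M sets by auto
  have i: "integrable a \<psi>" "integrable b \<psi>" "integrable a (indicat_real Y)" "integrable b (indicat_real Y)"
    using finite_invariantD(6)[OF a \<psi>(1)] finite_invariantD(6)[OF b \<psi>(1)] Y sets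
    by (simp_all add: a.emeasure_eq_measure b.emeasure_eq_measure)
  define Ea Eb where "Ea = (\<integral>x. \<bar>\<psi> x - indicat_real Y x\<bar> \<partial>a)"
    and "Eb = (\<integral>x. \<bar>\<psi> x - indicat_real Y x\<bar> \<partial>b)"
  have "(\<integral>x. \<bar>\<psi> x - indicat_real Y x\<bar> \<partial>?c) = Ea + Eb"
    using i sets unfolding Ea_def Eb_def by (subst integral_measure_comb) auto
  with err have "Ea + Eb < M / 4" by simp
  moreover have "\<bar>integral\<^sup>L a \<psi> - measure a Y\<bar> \<le> Ea"
    using integral_abs_bound[of a "\<lambda>x. \<psi> x - indicat_real Y x"] i Y sets by (simp add: Ea_def)
  moreover have "\<bar>integral\<^sup>L b \<psi> - measure b Y\<bar> \<le> Eb"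
    using integral_abs_bound[of b "\<lambda>x. \<psi> x - indicat_real Y x"] i Y sets by (simp add: Eb_def)
  moreover have "measure a Y = measure a (topspace X)"
    using a.finite_measure_compl[of Y] Y null(1) by (simp add: sets space)
  ultimately have est: "2 * (integral\<^sup>L a \<psi> - integral\<^sup>L b \<psi>) \<ge> 2 * measure a (topspace X) - M / 2"
    using null(2) by (simp add: abs_le_iff)
  define \<psi>' where "\<psi>' x = 2 * \<psi> x - 1" for x
  have \<psi>': "\<psi>' \<in> cont_functions X"
    unfolding \<psi>'_def[abs_def] by (intro cont_functions_diff cont_functions_mult \<psi>(1) cont_functions_const)
  have int: "integral\<^sup>L a \<psi>' = 2 * integral\<^sup>L a \<psi> - measure a (topspace X)"
    "integral\<^sup>L b \<psi>' = 2 * integral\<^sup>L b \<psi> - measure b (topspace X)"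
    unfolding \<psi>'_def[abs_def] using i by (simp_all add: space)
  show ?thesis
  proof (intro bexI[of _ \<psi>'] conjI ballI \<psi>')
    fix x assume "x \<in> topspace X"
    then show "\<bar>\<psi>' x\<bar> \<le> 1" using \<psi>(2)[of x] by (auto simp: \<psi>'_def abs_le_iff)
  next
    show "measure a (topspace X) + measure b (topspace X) \<le> 2 * (integral\<^sup>L a \<psi>' - integral\<^sup>L b \<psi>')"
      using est unfolding int M_def by argo
  qed
qed

end

section \<open>The cone generated by a face\<close>

locale constrained_face = compact_system +
  fixes G :: "('a \<Rightarrow> real) set" and K :: "'a measure set"
  assumes finite_G: "finite G" and G_cont: "G \<subseteq> cont_functions X"
    and face: "is_face K (constrained_measures X T G)"
    and closed: "closedin (subtopology (weak_star_topology X T) (constrained_measures X T G)) K"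
begin

abbreviation Q :: "'a measure set" where "Q \<equiv> constrained_measures X T G"

lemma K_subset: "K \<subseteq> Q" and K_nonempty: "K \<noteq> {}" and K_convex: "convex_measures K"
  and K_extreme: "\<And>p q \<alpha>. p \<in> Q \<Longrightarrow> q \<in> Q \<Longrightarrow> 0 < \<alpha> \<Longrightarrow> \<alpha> < 1 \<Longrightarrow> mixture \<alpha> p q \<in> K \<Longrightarrow> p \<in> K \<and> q \<in> K"
  using face unfolding is_face_def by auto

lemma Q_iff: "q \<in> Q \<longleftrightarrow> q \<in> finite_invariant \<and> measure q (topspace X) = 1 \<and> (\<forall>g\<in>G. integral\<^sup>L q g = 0)"
  by (auto simp: constrained_measures_def invariant_measures_eq)

lemma QD: "q \<in> Q \<Longrightarrow> q \<in> finite_invariant" "q \<in> Q \<Longrightarrow> measure q (topspace X) = 1"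
  "q \<in> Q \<Longrightarrow> g \<in> G \<Longrightarrow> integral\<^sup>L q g = 0"
  by (auto simp: Q_iff)

lemma top_sets: "topspace X \<in> sets (borel_sigma X)"
  by (rule openin_borel_sigma) simp

lemma Q_convex: "convex_measures Q"
  unfolding convex_measures_def mixture_eq_measure_comb
proof (intro ballI allI impI)
  fix \<mu> \<nu> and \<alpha> :: real assume \<mu>: "\<mu> \<in> Q" and \<nu>: "\<nu> \<in> Q" and \<alpha>: "0 \<le> \<alpha> \<and> \<alpha> \<le> 1"
  note comb = finite_invariant_measure_comb[OF QD(1)[OF \<mu>] QD(1)[OF \<nu>], of \<alpha> "1 - \<alpha>"]
  show "measure_comb \<alpha> \<mu> (1 - \<alpha>) \<nu> \<in> Q"
    unfolding Q_iff
  proof (intro conjI ballI)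
    show "measure (measure_comb \<alpha> \<mu> (1 - \<alpha>) \<nu>) (topspace X) = 1"
      using \<alpha> by (simp add: comb top_sets QD(2)[OF \<mu>] QD(2)[OF \<nu>])
    fix g assume g: "g \<in> G"
    then have "g \<in> cont_functions X" using G_cont by auto
    then show "integral\<^sup>L (measure_comb \<alpha> \<mu> (1 - \<alpha>) \<nu>) g = 0"
      using \<alpha> by (simp add: comb QD(3)[OF \<mu> g] QD(3)[OF \<nu> g])
  qed (intro finite_invariant_comb QD(1) \<mu> \<nu>)
qed

lemma zero_mass_integral:
  assumes "\<mu> \<in> finite_invariant" "measure \<mu> (topspace X) = 0" "f \<in> cont_functions X"
  shows "integral\<^sup>L \<mu> f = 0"
proof -
  obtain B where "\<And>x. x \<in> topspace X \<Longrightarrow> \<bar>f x\<bar> \<le> B"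
    using cont_functions_bounded[OF compact assms(3)] by blast
  from integral_abs_le_mass[OF assms(1,3) this] assms(2) show ?thesis by simp
qed

lemma normalize_in_Q:
  assumes \<mu>: "\<mu> \<in> finite_invariant" "\<And>g. g \<in> G \<Longrightarrow> integral\<^sup>L \<mu> g = 0" "0 < measure \<mu> (topspace X)"
  shows "measure_comb (1 / measure \<mu> (topspace X)) \<mu> 0 \<mu> \<in> Q"
proof -
  note comb = finite_invariant_measure_comb[OF \<mu>(1) \<mu>(1), of "1 / measure \<mu> (topspace X)" 0]
  have "integral\<^sup>L (measure_comb (1 / measure \<mu> (topspace X)) \<mu> 0 \<mu>) g = 0" if "g \<in> G" for g
  proof -
    have "g \<in> cont_functions X" using that G_cont by auto
    then show ?thesis using comb(2)[of g] \<mu>(2)[OF that] by simp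
  qed
  moreover have "measure (measure_comb (1 / measure \<mu> (topspace X)) \<mu> 0 \<mu>) (topspace X) = 1"
    using comb(1)[OF _ _ top_sets] \<mu>(3) by simp
  ultimately show ?thesis
    unfolding Q_iff using finite_invariant_comb[OF \<mu>(1) \<mu>(1)] by blast
qed

text \<open>A finite invariant measure that annihilates \<open>G\<close> is a multiple of an element of \<open>Q\<close>; for the
  zero measure any element of \<open>Q\<close> will do.\<close>

lemma cone_Q:
  assumes \<mu>: "\<mu> \<in> finite_invariant" "\<And>g. g \<in> G \<Longrightarrow> integral\<^sup>L \<mu> g = 0"
  shows "\<exists>q\<in>Q. \<forall>f\<in>cont_functions X. integral\<^sup>L \<mu> f = measure \<mu> (topspace X) * integral\<^sup>L q f"
proof (cases "measure \<mu> (topspace X) = 0")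
  case True
  then show ?thesis using K_nonempty K_subset zero_mass_integral[OF \<mu>(1)] by auto
next
  case False
  then have m: "0 < measure \<mu> (topspace X)" using zero_less_measure_iff by blast
  show ?thesis
    by (rule bexI[OF _ normalize_in_Q[OF \<mu> m]])
      (use m \<mu>(1) in \<open>auto simp: finite_invariant_measure_comb\<close>)
qed

text \<open>The finite invariant measures dominated by a multiple of an element of \<open>K\<close>. They need not
  annihilate \<open>G\<close>.\<close>

definition face_cone :: "'a measure set" where
  "face_cone = {f \<in> finite_invariant. \<exists>c\<ge>0. \<exists>k\<in>K. \<forall>A\<in>sets (borel_sigma X). measure f A \<le> c * measure k A}"

lemma face_coneI:
  "f \<in> finite_invariant \<Longrightarrow> 0 \<le> c \<Longrightarrow> k \<in> K \<Longrightarrow>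
    (\<And>A. A \<in> sets (borel_sigma X) \<Longrightarrow> measure f A \<le> c * measure k A) \<Longrightarrow> f \<in> face_cone"
  by (auto simp: face_cone_def)

lemma K_finite_invariant: "k \<in> K \<Longrightarrow> k \<in> finite_invariant"
  using K_subset QD(1) by blast

lemma face_cone_comb:
  assumes f: "f1 \<in> face_cone" "f2 \<in> face_cone" and ab: "0 \<le> a" "0 \<le> b"
  shows "measure_comb a f1 b f2 \<in> face_cone"
proof -
  obtain c1 k1 where 1: "f1 \<in> finite_invariant" "0 \<le> c1" "k1 \<in> K"
    "\<And>A. A \<in> sets (borel_sigma X) \<Longrightarrow> measure f1 A \<le> c1 * measure k1 A"
    using f(1) by (auto simp: face_cone_def)
  obtain c2 k2 where 2: "f2 \<in> finite_invariant" "0 \<le> c2" "k2 \<in> K"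
    "\<And>A. A \<in> sets (borel_sigma X) \<Longrightarrow> measure f2 A \<le> c2 * measure k2 A"
    using f(2) by (auto simp: face_cone_def)
  define c where "c = a * c1 + b * c2"
  have "0 \<le> a * c1" "0 \<le> b * c2"
    by (intro mult_nonneg_nonneg ab 1(2) 2(2))+
  have le: "measure (measure_comb a f1 b f2) A \<le> a * c1 * measure k1 A + b * c2 * measure k2 A"
    if "A \<in> sets (borel_sigma X)" for A
    using mult_left_mono[OF 1(4)[OF that] ab(1)] mult_left_mono[OF 2(4)[OF that] ab(2)]
    unfolding finite_invariant_measure_comb(1)[OF 1(1) 2(1) ab that] by (simp add: mult.assoc)
  show ?thesis
  proof (cases "c = 0")
    case True
    then have zero: "a * c1 = 0" "b * c2 = 0"
      using add_nonneg_eq_0_iff[OF \<open>0 \<le> a * c1\<close> \<open>0 \<le> b * c2\<close>] by (simp_all add: c_def)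
    show ?thesis
      by (rule face_coneI[OF finite_invariant_comb[OF 1(1) 2(1)] order_refl 1(3)])
        (use le[unfolded zero] in simp)
  next
    case False
    then have c: "c > 0"
      using add_nonneg_nonneg[OF \<open>0 \<le> a * c1\<close> \<open>0 \<le> b * c2\<close>] by (simp add: c_def)
    let ?t = "a * c1 / c"
    have t: "0 \<le> ?t" "?t \<le> 1"
      using c \<open>0 \<le> a * c1\<close> \<open>0 \<le> b * c2\<close> by (simp_all add: c_def)
    have t3: "1 - ?t = b * c2 / c"
      using c by (simp add: c_def divide_simps)
    have mix: "mixture ?t k1 k2 \<in> K"
      using K_convex 1(3) 2(3) t unfolding convex_measures_def by blast
    have mass: "c * measure (mixture ?t k1 k2) A = a * c1 * measure k1 A + b * c2 * measure k2 A"
      if "A \<in> sets (borel_sigma X)" for A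
    proof -
      have "measure (mixture ?t k1 k2) A = ?t * measure k1 A + (1 - ?t) * measure k2 A"
        unfolding mixture_eq_measure_comb using t that
        by (intro finite_invariant_measure_comb(1) K_finite_invariant 1 2) auto
      then show ?thesis unfolding t3 using c by (simp add: field_simps)
    qed
    show ?thesis
    proof (rule face_coneI[OF finite_invariant_comb[OF 1(1) 2(1)] less_imp_le[OF c] mix])
      fix A assume A: "A \<in> sets (borel_sigma X)"
      show "measure (measure_comb a f1 b f2) A \<le> c * measure (mixture ?t k1 k2) A"
        unfolding mass[OF A] by (rule le[OF A])
    qed
  qed
qed

text \<open>The complementary measure \<open>c k - f\<close>, as \<open>k\<close> annihilates \<open>G\<close>.\<close>

lemma face_cone_negation:
  assumes f: "f \<in> face_cone"
  shows "\<exists>f'\<in>face_cone. \<forall>g\<in>G. integral\<^sup>L f' g = - integral\<^sup>L f g"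
proof -
  obtain c k where ck: "f \<in> finite_invariant" "0 \<le> c" "k \<in> K"
    "\<And>A. A \<in> sets (borel_sigma X) \<Longrightarrow> measure f A \<le> c * measure k A"
    using f by (auto simp: face_cone_def)
  have k: "k \<in> finite_invariant" by (rule K_finite_invariant[OF ck(3)])
  let ?ck = "measure_comb c k 0 k"
  have "?ck \<in> finite_invariant" by (rule finite_invariant_comb[OF k k])
  then obtain f' where f': "f' \<in> finite_invariant" "measure_comb 1 f 1 f' = ?ck"
    using finite_invariant_diff[of ?ck f] ck
      finite_invariant_measure_comb(1)[OF k k ck(2) order_refl] by auto
  have "measure f' A \<le> c * measure k A" if "A \<in> sets (borel_sigma X)" for A
  proof -
    have "measure f A + measure f' A = c * measure k A"
      using finite_invariant_measure_comb(1)[OF ck(1) f'(1) _ _ that, of 1 1]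
        finite_invariant_measure_comb(1)[OF k k _ _ that, of c 0] ck(2) f'(2) by simp
    then show ?thesis using measure_nonneg[of f A] by linarith
  qed
  then have "f' \<in> face_cone" by (rule face_coneI[OF f'(1) ck(2,3)])
  moreover have "integral\<^sup>L f' g = - integral\<^sup>L f g" if "g \<in> G" for g
  proof -
    have "g \<in> cont_functions X" using that G_cont by auto
    then have "integral\<^sup>L f g + integral\<^sup>L f' g = c * integral\<^sup>L k g"
      using finite_invariant_measure_comb(2)[OF ck(1) f'(1), of 1 1 g]
        finite_invariant_measure_comb(2)[OF k k, of c 0 g] ck(2) f'(2) by simp
    then show ?thesis using QD(3)[of k g] K_subset ck(3) that by auto
  qed
  ultimately show ?thesis by blast
qed

text \<open>If \<open>f \<le> c k\<close>, then \<open>k\<close> is a mixture of the normalizations of \<open>f\<close> and of \<open>k - f / (2 c)\<close>, both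
  in \<open>Q\<close>, so the face property applies. The factor 2 keeps the weight of \<open>f\<close> strictly below 1.\<close>

lemma face_cone_null:
  assumes f: "f \<in> face_cone" and null: "\<And>g. g \<in> G \<Longrightarrow> integral\<^sup>L f g = 0"
  shows "\<exists>k\<in>K. \<forall>\<phi>\<in>cont_functions X. integral\<^sup>L f \<phi> = measure f (topspace X) * integral\<^sup>L k \<phi>"
proof (cases "measure f (topspace X) = 0")
  case True
  then show ?thesis using K_nonempty zero_mass_integral[of f] f by (auto simp: face_cone_def)
next
  case False
  define m where "m = measure f (topspace X)"
  have m: "m > 0" using False zero_less_measure_iff unfolding m_def by blast
  obtain c k where ck: "f \<in> finite_invariant" "0 \<le> c" "k \<in> K"
    "\<And>A. A \<in> sets (borel_sigma X) \<Longrightarrow> measure f A \<le> c * measure k A"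
    using f by (auto simp: face_cone_def)
  have k: "k \<in> finite_invariant" "measure k (topspace X) = 1" "\<And>g. g \<in> G \<Longrightarrow> integral\<^sup>L k g = 0"
    using K_subset ck(3) QD by auto
  have "m \<le> c" using ck(4)[OF top_sets] k(2) by (simp add: m_def)
  define t where "t = m / (2 * c)"
  have c: "c > 0" and t: "0 < t" "t < 1" using m \<open>m \<le> c\<close> by (auto simp: t_def field_simps)
  let ?f = "measure_comb (1 / (2 * c)) f 0 f"
  have F: "?f \<in> finite_invariant" by (rule finite_invariant_comb[OF ck(1) ck(1)])
  have mf: "measure ?f A = measure f A / (2 * c)" if "A \<in> sets (borel_sigma X)" for A
    using finite_invariant_measure_comb(1)[OF ck(1) ck(1) _ _ that, of "1 / (2 * c)" 0] c by simp
  have "measure ?f A \<le> measure k A" if "A \<in> sets (borel_sigma X)" for A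
  proof -
    have "measure f A \<le> 2 * c * measure k A"
    proof -
      have "0 \<le> c * measure k A" using c by simp
      then show ?thesis using ck(4)[OF that] by simp
    qed
    then show ?thesis unfolding mf[OF that] using c by (simp add: field_simps)
  qed
  then obtain d where d: "d \<in> finite_invariant" "measure_comb 1 ?f 1 d = k"
    using finite_invariant_diff[OF k(1) F] by blast
  have md: "measure d A = measure k A - measure f A / (2 * c)" if "A \<in> sets (borel_sigma X)" for A
    using finite_invariant_measure_comb(1)[OF F d(1) _ _ that, of 1 1] d(2) mf[OF that] by simp
  have mass_d: "measure d (topspace X) = 1 - t"
    by (simp add: md[OF top_sets] k(2) t_def m_def)
  have null_d: "integral\<^sup>L d g = 0" if "g \<in> G" for g
  proof -
    have g: "g \<in> cont_functions X" using that G_cont by auto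
    show ?thesis
      using finite_invariant_measure_comb(2)[OF F d(1) _ _ g, of 1 1] d(2)
        finite_invariant_measure_comb(2)[OF ck(1) ck(1) _ _ g, of "1 / (2 * c)" 0] c null[OF that] k(3)[OF that]
      by simp
  qed
  let ?p = "measure_comb (1 / m) f 0 f" and ?q = "measure_comb (1 / (1 - t)) d 0 d"
  have p: "?p \<in> Q" using normalize_in_Q[OF ck(1) null] m by (simp add: m_def)
  have q: "?q \<in> Q" using normalize_in_Q[OF d(1) null_d] t by (simp add: mass_d)
  have "mixture t ?p ?q = k"
  proof (rule finite_invariant_eqI)
    show "mixture t ?p ?q \<in> finite_invariant"
      unfolding mixture_eq_measure_comb by (intro finite_invariant_comb ck(1) d(1))
    fix A assume A: "A \<in> sets (borel_sigma X)"
    have "measure (mixture t ?p ?q) A = t * (measure f A / m) + (1 - t) * (measure d A / (1 - t))"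
      proof -
      have "measure (mixture t ?p ?q) A = t * measure ?p A + (1 - t) * measure ?q A"
        unfolding mixture_eq_measure_comb using t
        by (intro finite_invariant_measure_comb(1) QD(1) p q A) auto
      then show ?thesis
        using finite_invariant_measure_comb(1)[OF ck(1) ck(1) _ _ A, of "1 / m" 0]
          finite_invariant_measure_comb(1)[OF d(1) d(1) _ _ A, of "1 / (1 - t)" 0] t m by simp
    qed
    also have "\<dots> = t / m * measure f A + measure d A"
      using t by simp
    also have "t / m = 1 / (2 * c)"
      using m by (simp add: t_def)
    also have "1 / (2 * c) * measure f A + measure d A = measure f A / (2 * c) + measure d A"
      by simp
    also have "\<dots> = measure k A" by (simp add: md[OF A])
    finally show "measure (mixture t ?p ?q) A = measure k A" .
  qed (rule k(1))
  then have "?p \<in> K" using K_extreme[OF p q t] ck(3) by simp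
  moreover have "integral\<^sup>L f \<phi> = measure f (topspace X) * integral\<^sup>L ?p \<phi>" if "\<phi> \<in> cont_functions X" for \<phi>
    using finite_invariant_measure_comb(2)[OF ck(1) ck(1) _ _ that, of "1 / m" 0] m by (simp add: m_def)
  ultimately show ?thesis by blast
qed

text \<open>Induction over the constraints, which replaces an argument about a finite-dimensional subspace.
  Suppose the integrals over \<open>H\<close> can be negated at bounded cost. If some member of the cone that
  annihilates \<open>H\<close> has nonzero integral of \<open>h\<close>, then multiples of it and of its negation correct the
  integral of \<open>h\<close> by any amount, at a cost proportional to the amount. Otherwise the integral of
  \<open>h\<close> is already right: \<open>f + f'\<close> annihilates \<open>H\<close> and therefore \<open>h\<close>.\<close>

lemma bounded_negation:
  "\<exists>c\<ge>0. \<forall>f\<in>face_cone. \<exists>f'\<in>face_cone. (\<forall>g\<in>G. integral\<^sup>L f' g = - integral\<^sup>L f g) \<and>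
    measure f' (topspace X) \<le> c * measure f (topspace X)"
proof -
  have FI: "f \<in> finite_invariant" if "f \<in> face_cone" for f using that by (simp add: face_cone_def)
  have "finite H \<Longrightarrow> H \<subseteq> G \<Longrightarrow> \<exists>c\<ge>0. \<forall>f\<in>face_cone. \<exists>f'\<in>face_cone.
      (\<forall>g\<in>H. integral\<^sup>L f' g = - integral\<^sup>L f g) \<and> measure f' (topspace X) \<le> c * measure f (topspace X)" for H
  proof (induction H rule: finite_induct)
    case empty
    show ?case by (intro exI[of _ 1]) auto
  next
    case (insert h H)
    then obtain c where "0 \<le> c" and c: "\<And>f. f \<in> face_cone \<Longrightarrow> \<exists>f'\<in>face_cone.
      (\<forall>g\<in>H. integral\<^sup>L f' g = - integral\<^sup>L f g) \<and> measure f' (topspace X) \<le> c * measure f (topspace X)"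
      by auto
    have cont: "g \<in> cont_functions X" if "g \<in> insert h H" for g using that insert.prems G_cont by auto
    obtain B where "0 \<le> B" and B: "\<And>x. x \<in> topspace X \<Longrightarrow> \<bar>h x\<bar> \<le> B"
      using cont_functions_bounded[OF compact cont[OF insertI1]] by blast
    have hB: "\<bar>integral\<^sup>L f h\<bar> \<le> B * measure f (topspace X)" if "f \<in> face_cone" for f
      by (rule integral_abs_le_mass[OF FI[OF that] cont[OF insertI1] B])
    show ?case
    proof (cases "\<exists>f\<in>face_cone. (\<forall>g\<in>H. integral\<^sup>L f g = 0) \<and> integral\<^sup>L f h \<noteq> 0")
      case False
      have "integral\<^sup>L f' h = - integral\<^sup>L f h"
        if f: "f \<in> face_cone" "f' \<in> face_cone" "\<forall>g\<in>H. integral\<^sup>L f' g = - integral\<^sup>L f g" for f f'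
      proof -
        have "measure_comb 1 f 1 f' \<in> face_cone" by (rule face_cone_comb[OF f(1,2)]) auto
        moreover have "integral\<^sup>L (measure_comb 1 f 1 f') g = integral\<^sup>L f g + integral\<^sup>L f' g"
          if "g \<in> insert h H" for g
          using finite_invariant_measure_comb(2)[OF FI[OF f(1)] FI[OF f(2)] _ _ cont[OF that], of 1 1] by simp
        ultimately have "integral\<^sup>L f h + integral\<^sup>L f' h = 0" using False f(3) by fastforce
        then show ?thesis by simp
      qed
      then show ?thesis using \<open>0 \<le> c\<close> c by (metis insert_iff)
    next
      case True
      then obtain f0 where f0: "f0 \<in> face_cone" "\<forall>g\<in>H. integral\<^sup>L f0 g = 0" "integral\<^sup>L f0 h \<noteq> 0" by auto
      obtain f1 where f1: "f1 \<in> face_cone" "\<forall>g\<in>insert h H. integral\<^sup>L f1 g = - integral\<^sup>L f0 g"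
        using face_cone_negation[OF f0(1)] insert.prems by blast
      define v where "v = integral\<^sup>L f0 h"
      define D where "D = (measure f0 (topspace X) + measure f1 (topspace X)) / \<bar>v\<bar>"
      have "0 \<le> D" by (simp add: D_def)
      have corr: "\<exists>u\<in>face_cone. (\<forall>g\<in>H. integral\<^sup>L u g = 0) \<and> integral\<^sup>L u h = s \<and> measure u (topspace X) \<le> D * \<bar>s\<bar>" for s
      proof -
        \<comment> \<open>The sign of the required correction decides between \<open>f0\<close> and its negation.\<close>
        define u where "u = (if 0 \<le> s * v then f0 else f1)"
        have u: "u \<in> face_cone" "\<forall>g\<in>H. integral\<^sup>L u g = 0"
          "measure u (topspace X) \<le> measure f0 (topspace X) + measure f1 (topspace X)"
          using f0(1,2) f1 by (auto simp: u_def)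
        have uh: "integral\<^sup>L u h = (if 0 \<le> s * v then v else - v)"
          using f1(2) by (simp add: u_def v_def)
        have us: "\<bar>s\<bar> / \<bar>v\<bar> * integral\<^sup>L u h = s"
          unfolding uh using f0(3) unfolding v_def[symmetric]
          by (cases s "0::real" rule: linorder_cases; cases v "0::real" rule: linorder_cases)
            (simp_all add: zero_le_mult_iff)
        let ?u = "measure_comb (\<bar>s\<bar> / \<bar>v\<bar>) u 0 u"
        have r: "0 \<le> \<bar>s\<bar> / \<bar>v\<bar>" by simp
        have int: "integral\<^sup>L ?u g = \<bar>s\<bar> / \<bar>v\<bar> * integral\<^sup>L u g" if "g \<in> insert h H" for g
          using finite_invariant_measure_comb(2)[OF FI[OF u(1)] FI[OF u(1)] r order_refl cont[OF that]]
          unfolding mult_zero_left add_0_right .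
        have "measure ?u (topspace X) = \<bar>s\<bar> / \<bar>v\<bar> * measure u (topspace X)"
          using finite_invariant_measure_comb(1)[OF FI[OF u(1)] FI[OF u(1)] r order_refl top_sets]
          unfolding mult_zero_left add_0_right .
        also have "\<dots> \<le> \<bar>s\<bar> / \<bar>v\<bar> * (measure f0 (topspace X) + measure f1 (topspace X))"
          using u(3) by (intro mult_left_mono) auto
        also have "\<dots> = D * \<bar>s\<bar>" by (simp add: D_def)
        finally show ?thesis
        proof (intro bexI[of _ ?u] conjI ballI face_cone_comb u(1) r order_refl)
          fix g assume "g \<in> H"
          then show "integral\<^sup>L ?u g = 0" using int[of g] u(2) by simp
        next
          show "integral\<^sup>L ?u h = s" using int[of h] us by simp
        qed
      qed
      show ?thesis
      proof (intro exI conjI ballI)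
        show "0 \<le> c + D * (B + B * c)" using \<open>0 \<le> c\<close> \<open>0 \<le> D\<close> \<open>0 \<le> B\<close> by simp
        fix f assume f: "f \<in> face_cone"
        obtain f' where f': "f' \<in> face_cone" "\<forall>g\<in>H. integral\<^sup>L f' g = - integral\<^sup>L f g"
          "measure f' (topspace X) \<le> c * measure f (topspace X)" using c[OF f] by blast
        define s where "s = - integral\<^sup>L f h - integral\<^sup>L f' h"
        obtain u where u: "u \<in> face_cone" "\<forall>g\<in>H. integral\<^sup>L u g = 0" "integral\<^sup>L u h = s"
          "measure u (topspace X) \<le> D * \<bar>s\<bar>" using corr by blast
        have "\<bar>s\<bar> \<le> B * measure f (topspace X) + B * measure f' (topspace X)"
          unfolding s_def using hB[OF f] hB[OF f'(1)] by linarith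
        also have "\<dots> \<le> B * measure f (topspace X) + B * (c * measure f (topspace X))"
          using f'(3) \<open>0 \<le> B\<close> by (intro add_left_mono mult_left_mono)
        finally have "D * \<bar>s\<bar> \<le> D * (B * measure f (topspace X) + B * (c * measure f (topspace X)))"
          using \<open>0 \<le> D\<close> by (rule mult_left_mono)
        with u(4) f'(3) have bound: "measure f' (topspace X) + measure u (topspace X) \<le> (c + D * (B + B * c)) * measure f (topspace X)"
          by (simp add: algebra_simps)
        have sum_mass: "measure (measure_comb 1 f' 1 u) (topspace X) = measure f' (topspace X) + measure u (topspace X)"
          using finite_invariant_measure_comb(1)[OF FI[OF f'(1)] FI[OF u(1)] _ _ top_sets, of 1 1] by simp
        have sum_int: "integral\<^sup>L (measure_comb 1 f' 1 u) g = integral\<^sup>L f' g + integral\<^sup>L u g"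
          if "g \<in> insert h H" for g
          using finite_invariant_measure_comb(2)[OF FI[OF f'(1)] FI[OF u(1)] _ _ cont[OF that], of 1 1] by simp
        show "\<exists>f'\<in>face_cone. (\<forall>g\<in>insert h H. integral\<^sup>L f' g = - integral\<^sup>L f g) \<and>
            measure f' (topspace X) \<le> (c + D * (B + B * c)) * measure f (topspace X)"
        proof (intro bexI[of _ "measure_comb 1 f' 1 u"] conjI ballI face_cone_comb f'(1) u(1) zero_le_one)
          fix g assume g: "g \<in> insert h H"
          show "integral\<^sup>L (measure_comb 1 f' 1 u) g = - integral\<^sup>L f g"
            using sum_int[OF g] g f'(2) u(2,3) by (auto simp: s_def)
        next
          show "measure (measure_comb 1 f' 1 u) (topspace X) \<le> (c + D * (B + B * c)) * measure f (topspace X)"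
            unfolding sum_mass by (rule bound)
        qed
      qed
    qed
  qed
  from this[OF finite_G order_refl] show ?thesis .
qed

text \<open>Start with the Jordan decomposition \<open>a - b\<close> of \<open>w = \<alpha> q - (1 - \<alpha>) k\<close>. Since \<open>b\<close> is dominated
  by \<open>(1 - \<alpha>) k\<close>, there is a bounded \<open>f\<close> in the cone of the face whose integrals over \<open>G\<close> cancel
  those of \<open>b\<close>. They also cancel those of \<open>a\<close>, because \<open>w\<close> annihilates \<open>G\<close>. So \<open>a + f\<close> and
  \<open>b + f\<close> are multiples of elements of \<open>Q\<close> and \<open>K\<close>. The function \<open>\<psi>\<close> stands for the total variation
  of \<open>w\<close>.\<close>

lemma bounded_decomposition:
  "\<exists>c>0. \<forall>q\<in>Q. \<forall>k\<in>K. \<forall>\<alpha>. 0 \<le> \<alpha> \<and> \<alpha> \<le> 1 \<longrightarrow>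
    (\<exists>q'\<in>Q. \<exists>k'\<in>K. \<exists>a\<ge>0. \<exists>b\<ge>0. \<exists>\<psi>\<in>cont_functions X. (\<forall>x\<in>topspace X. \<bar>\<psi> x\<bar> \<le> 1) \<and>
      (\<forall>\<phi>\<in>cont_functions X. \<alpha> * integral\<^sup>L q \<phi> - (1 - \<alpha>) * integral\<^sup>L k \<phi> = a * integral\<^sup>L q' \<phi> - b * integral\<^sup>L k' \<phi>) \<and>
      a + b \<le> c * (\<alpha> * integral\<^sup>L q \<psi> - (1 - \<alpha>) * integral\<^sup>L k \<psi>))"
proof -
  obtain c where "0 \<le> c" and c: "\<forall>f\<in>face_cone. \<exists>f'\<in>face_cone. (\<forall>g\<in>G. integral\<^sup>L f' g = - integral\<^sup>L f g) \<and>
    measure f' (topspace X) \<le> c * measure f (topspace X)" using bounded_negation by blast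
  show ?thesis
  proof (rule exI[of _ "2 * (1 + 2 * c)"], intro conjI ballI allI impI)
    show "0 < 2 * (1 + 2 * c)" using \<open>0 \<le> c\<close> by simp
    fix q k and \<alpha> :: real assume q: "q \<in> Q" and k: "k \<in> K" and \<alpha>: "0 \<le> \<alpha> \<and> \<alpha> \<le> 1"
    note q' = QD(1)[OF q] and k' = K_finite_invariant[OF k]
    let ?\<mu> = "measure_comb \<alpha> q 0 q" and ?\<nu> = "measure_comb (1 - \<alpha>) k 0 k"
    have \<mu>: "?\<mu> \<in> finite_invariant" and \<nu>: "?\<nu> \<in> finite_invariant"
      by (intro finite_invariant_comb q' k')+
    have \<mu>\<nu>: "integral\<^sup>L ?\<mu> \<phi> - integral\<^sup>L ?\<nu> \<phi> = \<alpha> * integral\<^sup>L q \<phi> - (1 - \<alpha>) * integral\<^sup>L k \<phi>"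
      if "\<phi> \<in> cont_functions X" for \<phi>
      using finite_invariant_measure_comb(2)[OF q' q' _ _ that, of \<alpha> 0]
        finite_invariant_measure_comb(2)[OF k' k' _ _ that, of "1 - \<alpha>" 0] \<alpha> by simp
    obtain a b Y where a: "a \<in> finite_invariant" and b: "b \<in> finite_invariant" and Y: "Y \<in> sets (borel_sigma X)"
      and b\<nu>: "\<forall>A\<in>sets (borel_sigma X). measure b A \<le> measure ?\<nu> A"
      and ab: "\<forall>f\<in>cont_functions X. integral\<^sup>L ?\<mu> f - integral\<^sup>L ?\<nu> f = integral\<^sup>L a f - integral\<^sup>L b f"
      and null: "measure a (topspace X - Y) = 0" "measure b Y = 0"
      using jordan_decomposition_invariant[OF \<mu> \<nu>] by blast
    obtain \<psi> where \<psi>: "\<psi> \<in> cont_functions X" "\<forall>x\<in>topspace X. \<bar>\<psi> x\<bar> \<le> 1"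
      "measure a (topspace X) + measure b (topspace X) \<le> 2 * (integral\<^sup>L a \<psi> - integral\<^sup>L b \<psi>)"
      using signed_mass_attained[OF a b Y null] by blast
    have "b \<in> face_cone"
    proof (rule face_coneI[OF b _ k])
      show "0 \<le> 1 - \<alpha>" using \<alpha> by simp
      fix A assume A: "A \<in> sets (borel_sigma X)"
      show "measure b A \<le> (1 - \<alpha>) * measure k A"
        using b\<nu>[rule_format, OF A] finite_invariant_measure_comb(1)[OF k' k' _ _ A, of "1 - \<alpha>" 0] \<alpha> by simp
    qed
    then obtain f where f: "f \<in> face_cone" "\<forall>g\<in>G. integral\<^sup>L f g = - integral\<^sup>L b g"
      "measure f (topspace X) \<le> c * measure b (topspace X)" using c by blast
    have f': "f \<in> finite_invariant" using f(1) by (simp add: face_cone_def)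
    let ?P = "measure_comb 1 a 1 f" and ?N = "measure_comb 1 b 1 f"
    have P: "?P \<in> finite_invariant" by (rule finite_invariant_comb[OF a f'])
    have N: "?N \<in> face_cone" by (rule face_cone_comb[OF \<open>b \<in> face_cone\<close> f(1)]) auto
    have int: "integral\<^sup>L ?P \<phi> = integral\<^sup>L a \<phi> + integral\<^sup>L f \<phi>" "integral\<^sup>L ?N \<phi> = integral\<^sup>L b \<phi> + integral\<^sup>L f \<phi>"
      if "\<phi> \<in> cont_functions X" for \<phi>
      using finite_invariant_measure_comb(2)[OF a f' _ _ that, of 1 1]
        finite_invariant_measure_comb(2)[OF b f' _ _ that, of 1 1] by auto
    have mass: "measure ?P (topspace X) = measure a (topspace X) + measure f (topspace X)"
      "measure ?N (topspace X) = measure b (topspace X) + measure f (topspace X)"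
      using finite_invariant_measure_comb(1)[OF a f' zero_le_one zero_le_one top_sets]
        finite_invariant_measure_comb(1)[OF b f' zero_le_one zero_le_one top_sets]
      unfolding mult_1_left .
    have "integral\<^sup>L ?N g = 0" "integral\<^sup>L ?P g = 0" if g: "g \<in> G" for g
    proof -
      have gc: "g \<in> cont_functions X" using g G_cont by auto
      show "integral\<^sup>L ?N g = 0" using int[OF gc] f(2) g by simp
      have "integral\<^sup>L a g - integral\<^sup>L b g = 0"
        using ab[rule_format, OF gc] \<mu>\<nu>[OF gc] QD(3)[OF q g] QD(3)[of k g] k K_subset g by auto
      then show "integral\<^sup>L ?P g = 0" using int[OF gc] f(2) g by simp
    qed
    then obtain qq kk where qq: "qq \<in> Q" "\<forall>\<phi>\<in>cont_functions X. integral\<^sup>L ?P \<phi> = measure ?P (topspace X) * integral\<^sup>L qq \<phi>"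
      and kk: "kk \<in> K" "\<forall>\<phi>\<in>cont_functions X. integral\<^sup>L ?N \<phi> = measure ?N (topspace X) * integral\<^sup>L kk \<phi>"
      using cone_Q[OF P] face_cone_null[OF N] by metis
    show "\<exists>q'\<in>Q. \<exists>k'\<in>K. \<exists>a\<ge>0. \<exists>b\<ge>0. \<exists>\<psi>\<in>cont_functions X. (\<forall>x\<in>topspace X. \<bar>\<psi> x\<bar> \<le> 1) \<and>
      (\<forall>\<phi>\<in>cont_functions X. \<alpha> * integral\<^sup>L q \<phi> - (1 - \<alpha>) * integral\<^sup>L k \<phi> = a * integral\<^sup>L q' \<phi> - b * integral\<^sup>L k' \<phi>) \<and>
      a + b \<le> 2 * (1 + 2 * c) * (\<alpha> * integral\<^sup>L q \<psi> - (1 - \<alpha>) * integral\<^sup>L k \<psi>)"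
    proof (rule bexI[OF _ qq(1)], rule bexI[OF _ kk(1)], rule exI[of _ "measure ?P (topspace X)"], intro conjI,
        simp, rule exI[of _ "measure ?N (topspace X)"], intro conjI, simp, rule bexI[OF _ \<psi>(1)], intro conjI ballI)
      fix x assume "x \<in> topspace X"
      then show "\<bar>\<psi> x\<bar> \<le> 1" using \<psi>(2) by auto
    next
      fix \<phi> assume \<phi>: "\<phi> \<in> cont_functions X"
      show "\<alpha> * integral\<^sup>L q \<phi> - (1 - \<alpha>) * integral\<^sup>L k \<phi> =
          measure ?P (topspace X) * integral\<^sup>L qq \<phi> - measure ?N (topspace X) * integral\<^sup>L kk \<phi>"
        using int[OF \<phi>] ab[rule_format, OF \<phi>] \<mu>\<nu>[OF \<phi>]
        unfolding qq(2)[rule_format, OF \<phi>] kk(2)[rule_format, OF \<phi>] by linarith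
    next
      have "measure ?P (topspace X) + measure ?N (topspace X)
          \<le> measure a (topspace X) + measure b (topspace X) + 2 * (c * measure b (topspace X))"
        unfolding mass using f(3) by linarith
      also have "\<dots> \<le> (1 + 2 * c) * (measure a (topspace X) + measure b (topspace X))"
        using \<open>0 \<le> c\<close> by (simp add: algebra_simps)
      also have "\<dots> \<le> (1 + 2 * c) * (2 * (integral\<^sup>L a \<psi> - integral\<^sup>L b \<psi>))"
        using \<psi>(3) \<open>0 \<le> c\<close> by (intro mult_left_mono) auto
      also have "\<dots> = 2 * (1 + 2 * c) * (\<alpha> * integral\<^sup>L q \<psi> - (1 - \<alpha>) * integral\<^sup>L k \<psi>)"
        unfolding \<mu>\<nu>[OF \<psi>(1), symmetric] ab[rule_format, OF \<psi>(1)] by (simp add: algebra_simps)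
      finally show "measure ?P (topspace X) + measure ?N (topspace X)
          \<le> 2 * (1 + 2 * c) * (\<alpha> * integral\<^sup>L q \<psi> - (1 - \<alpha>) * integral\<^sup>L k \<psi>)" .
    qed
  qed
qed

end

section \<open>A minimax theorem\<close>

text \<open>Separate \<open>S\<close> from the closed negative quadrant; the normal vector is nonnegative because the
  quadrant is unbounded in both directions.\<close>

lemma pair_minimax:
  fixes S :: "(real \<times> real) set"
  assumes "convex S" "compact S" and pos: "\<And>u v. (u, v) \<in> S \<Longrightarrow> 0 < u \<or> 0 < v"
  shows "\<exists>t. 0 \<le> t \<and> t \<le> 1 \<and> (\<forall>(u, v)\<in>S. 0 < t * u + (1 - t) * v)"
proof (cases "S = {}")
  case True
  then show ?thesis by (intro exI[of _ 0]) auto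
next
  case False
  have quadrant: "{p :: real \<times> real. fst p \<le> 0 \<and> snd p \<le> 0} = {..0} \<times> {..0}"
    by auto
  have "convex ({..0::real} \<times> {..0::real})" "closed ({..0::real} \<times> {..0::real})"
    by (intro convex_Times convex_real_interval closed_Times closed_atMost)+
  moreover have "({..0} \<times> {..0}) \<inter> S = {}"
    using pos by fastforce
  ultimately obtain p b where neg: "\<And>x. x \<in> {..0} \<times> {..0} \<Longrightarrow> inner p x < b"
    and S: "\<And>x. x \<in> S \<Longrightarrow> b < inner p x"
    using separating_hyperplane_closed_compact[of "{..0::real} \<times> {..0::real}" S] assms(1,2) False
    by metis
  obtain p1 p2 where p: "p = (p1, p2)" by (cases p)
  have b: "0 < b" using neg[of "(0, 0)"] by (simp add: p)
  have p1: "0 \<le> p1"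
  proof (rule ccontr)
    assume "\<not> 0 \<le> p1"
    then show False using neg[of "(b / p1, 0)"] b by (simp add: p divide_simps)
  qed
  have p2: "0 \<le> p2"
  proof (rule ccontr)
    assume "\<not> 0 \<le> p2"
    then show False using neg[of "(0, b / p2)"] b by (simp add: p divide_simps)
  qed
  have S': "0 < p1 * u + p2 * v" if "(u, v) \<in> S" for u v
    using S[OF that] b by (simp add: p)
  obtain u0 v0 where "(u0, v0) \<in> S" using False by auto
  from S'[OF this] have "p1 \<noteq> 0 \<or> p2 \<noteq> 0" by auto
  with p1 p2 have s: "0 < p1 + p2" by auto
  have t: "1 - p1 / (p1 + p2) = p2 / (p1 + p2)" using s by (simp add: field_simps)
  show ?thesis
  proof (intro exI[of _ "p1 / (p1 + p2)"] conjI)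
    show "\<forall>(u, v)\<in>S. 0 < p1 / (p1 + p2) * u + (1 - p1 / (p1 + p2)) * v"
    proof (clarify)
      fix u v assume "(u, v) \<in> S"
      then have "0 < (p1 * u + p2 * v) / (p1 + p2)" using S' s by simp
      then show "0 < p1 / (p1 + p2) * u + (1 - p1 / (p1 + p2)) * v"
        unfolding t by (simp add: add_divide_distrib)
    qed
  qed (use p1 p2 s in auto)
qed

definition convex_functions :: "('a \<Rightarrow> real) set \<Rightarrow> bool" where
  "convex_functions \<Psi> \<longleftrightarrow> (\<forall>\<psi>\<in>\<Psi>. \<forall>\<eta>\<in>\<Psi>. \<forall>t. 0 \<le> t \<and> t \<le> 1 \<longrightarrow> (\<lambda>x. t * \<psi> x + (1 - t) * \<eta> x) \<in> \<Psi>)"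

text \<open>Convexity and sequential compactness are required only of the values \<open>L i \<psi>\<close>, so the index set
  needs no structure of its own.\<close>

definition compact_convex_family :: "('i \<Rightarrow> ('a \<Rightarrow> real) \<Rightarrow> real) \<Rightarrow> 'i set \<Rightarrow> ('a \<Rightarrow> real) set \<Rightarrow> bool" where
  "compact_convex_family L I \<Psi> \<longleftrightarrow>
     (\<forall>i\<in>I. \<forall>j\<in>I. \<forall>t. 0 \<le> t \<and> t \<le> 1 \<longrightarrow> (\<exists>k\<in>I. \<forall>\<psi>\<in>\<Psi>. L k \<psi> = t * L i \<psi> + (1 - t) * L j \<psi>)) \<and>
     (\<forall>f :: nat \<Rightarrow> 'i. range f \<subseteq> I \<longrightarrow> (\<exists>r i. strict_mono r \<and> i \<in> I \<and> (\<forall>\<psi>\<in>\<Psi>. (\<lambda>n. L (f (r n)) \<psi>) \<longlonglongrightarrow> L i \<psi>)))"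

lemma compact_convex_family_mix:
  assumes "compact_convex_family L I \<Psi>" "i \<in> I" "j \<in> I" "0 \<le> t" "t \<le> 1"
  shows "\<exists>k\<in>I. \<forall>\<psi>\<in>\<Psi>. L k \<psi> = t * L i \<psi> + (1 - t) * L j \<psi>"
  using assms unfolding compact_convex_family_def by blast

lemma compact_convex_family_limit:
  assumes "compact_convex_family L I \<Psi>" "\<And>n. f n \<in> I"
  shows "\<exists>r i. strict_mono (r :: nat \<Rightarrow> nat) \<and> i \<in> I \<and> (\<forall>\<psi>\<in>\<Psi>. (\<lambda>n. L (f (r n)) \<psi>) \<longlonglongrightarrow> L i \<psi>)"
proof -
  have "range f \<subseteq> I" using assms(2) by auto
  then show ?thesis using assms(1) unfolding compact_convex_family_def by blast
qed

lemma compact_convex_family_restrict: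
  assumes fam: "compact_convex_family L I \<Psi>" and \<psi>: "\<psi> \<in> \<Psi>"
  shows "compact_convex_family L {i \<in> I. L i \<psi> \<le> 0} \<Psi>"
  unfolding compact_convex_family_def
proof (intro conjI ballI allI impI)
  fix i j and t :: real
  assume ij: "i \<in> {i \<in> I. L i \<psi> \<le> 0}" "j \<in> {i \<in> I. L i \<psi> \<le> 0}" and t: "0 \<le> t \<and> t \<le> 1"
  then obtain k where k: "k \<in> I" "\<forall>\<psi>\<in>\<Psi>. L k \<psi> = t * L i \<psi> + (1 - t) * L j \<psi>"
    using compact_convex_family_mix[OF fam, of i j t] by auto
  have "t * L i \<psi> + (1 - t) * L j \<psi> \<le> 0"
    using ij t by (intro add_nonpos_nonpos mult_nonneg_nonpos) auto
  then show "\<exists>k\<in>{i \<in> I. L i \<psi> \<le> 0}. \<forall>\<psi>\<in>\<Psi>. L k \<psi> = t * L i \<psi> + (1 - t) * L j \<psi>"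
    using k \<psi> by (intro bexI[of _ k]) auto
next
  fix f :: "nat \<Rightarrow> 'a" assume f: "range f \<subseteq> {i \<in> I. L i \<psi> \<le> 0}"
  then have f': "f n \<in> I" "L (f n) \<psi> \<le> 0" for n by auto
  obtain r i where r: "strict_mono (r :: nat \<Rightarrow> nat)" "i \<in> I" "\<forall>\<psi>\<in>\<Psi>. (\<lambda>n. L (f (r n)) \<psi>) \<longlonglongrightarrow> L i \<psi>"
    using compact_convex_family_limit[where f = f, OF fam f'(1)] by blast
  have "L i \<psi> \<le> 0"
    by (rule LIMSEQ_le_const2[OF r(3)[rule_format, OF \<psi>]]) (use f'(2) in auto)
  with r show "\<exists>r i. strict_mono r \<and> i \<in> {i \<in> I. L i \<psi> \<le> 0} \<and> (\<forall>\<psi>\<in>\<Psi>. (\<lambda>n. L (f (r n)) \<psi>) \<longlonglongrightarrow> L i \<psi>)"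
    by blast
qed

text \<open>Induction on the number of functions: the induction hypothesis on the indices where \<open>\<psi>\<close> fails
  gives \<open>\<eta>\<close>, and everywhere one of \<open>\<psi>\<close>, \<open>\<eta>\<close> is positive. A convex combination of just these two
  works for all indices.\<close>

lemma finite_minimax:
  fixes L :: "'i \<Rightarrow> ('a \<Rightarrow> real) \<Rightarrow> real"
  assumes \<Psi>: "convex_functions \<Psi>"
    and aff: "\<And>i \<psi> \<eta> t. i \<in> I \<Longrightarrow> \<psi> \<in> \<Psi> \<Longrightarrow> \<eta> \<in> \<Psi> \<Longrightarrow> L i (\<lambda>x. t * \<psi> x + (1 - t) * \<eta> x) = t * L i \<psi> + (1 - t) * L i \<eta>"
    and "finite B" "B \<noteq> {}" "B \<subseteq> \<Psi>"
    and "compact_convex_family L I \<Psi>" "\<And>i. i \<in> I \<Longrightarrow> \<exists>\<psi>\<in>B. 0 < L i \<psi>"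
  shows "\<exists>\<psi>\<in>\<Psi>. \<forall>i\<in>I. 0 < L i \<psi>"
  using assms(3-7) aff
proof (induction B arbitrary: I rule: finite_ne_induct)
  case (singleton \<psi>)
  then show ?case by auto
next
  case (insert \<psi> B)
  have \<psi>: "\<psi> \<in> \<Psi>" using insert.prems(1) by simp
  have fam: "compact_convex_family L I \<Psi>" by (rule insert.prems(2))
  have "\<exists>\<eta>\<in>\<Psi>. \<forall>i\<in>{i \<in> I. L i \<psi> \<le> 0}. 0 < L i \<eta>"
  proof (rule insert.IH)
    show "compact_convex_family L {i \<in> I. L i \<psi> \<le> 0} \<Psi>"
      by (rule compact_convex_family_restrict[OF fam \<psi>])
    show "\<exists>\<psi>\<in>B. 0 < L i \<psi>" if "i \<in> {i \<in> I. L i \<psi> \<le> 0}" for i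
      using insert.prems(3)[of i] that by auto
  qed (use insert.prems(1,4) in auto)
  then obtain \<eta> where \<eta>: "\<eta> \<in> \<Psi>" "\<And>i. i \<in> I \<Longrightarrow> L i \<psi> \<le> 0 \<Longrightarrow> 0 < L i \<eta>" by blast
  let ?S = "(\<lambda>i. (L i \<psi>, L i \<eta>)) ` I"
  have "convex ?S"
    unfolding convex_alt
  proof (clarify)
    fix i j and u :: real assume ij: "i \<in> I" "j \<in> I" and u: "0 \<le> u" "u \<le> 1"
    obtain k where "k \<in> I" "\<forall>\<psi>\<in>\<Psi>. L k \<psi> = u * L j \<psi> + (1 - u) * L i \<psi>"
      using compact_convex_family_mix[OF fam ij(2,1) u] by blast
    then show "(1 - u) *\<^sub>R (L i \<psi>, L i \<eta>) + u *\<^sub>R (L j \<psi>, L j \<eta>) \<in> ?S"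
      using \<psi> \<eta>(1) by (intro image_eqI[of _ _ k]) auto
  qed
  moreover have "compact ?S"
    unfolding compact_eq_seq_compact_metric seq_compact_def
  proof (intro allI impI)
    fix z :: "nat \<Rightarrow> real \<times> real" assume "\<forall>n. z n \<in> ?S"
    then have "\<forall>n. \<exists>i. i \<in> I \<and> z n = (L i \<psi>, L i \<eta>)" by blast
    from choice[OF this] obtain f where f: "\<And>n. f n \<in> I" "\<And>n. z n = (L (f n) \<psi>, L (f n) \<eta>)"
      by blast
    obtain r i where r: "strict_mono (r :: nat \<Rightarrow> nat)" "i \<in> I" "\<forall>\<psi>\<in>\<Psi>. (\<lambda>n. L (f (r n)) \<psi>) \<longlonglongrightarrow> L i \<psi>"
      using compact_convex_family_limit[where f = f, OF fam f(1)] by blast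
    have "(z \<circ> r) \<longlonglongrightarrow> (L i \<psi>, L i \<eta>)"
      unfolding o_def f(2) using r(3) \<psi> \<eta>(1) by (intro tendsto_Pair) auto
    with r show "\<exists>l\<in>?S. \<exists>r. strict_mono r \<and> (z \<circ> r) \<longlonglongrightarrow> l" by blast
  qed
  moreover have "0 < u \<or> 0 < v" if "(u, v) \<in> ?S" for u v
    using that \<eta>(2) by fastforce
  ultimately obtain t where t: "0 \<le> t" "t \<le> 1" "\<forall>(u, v)\<in>?S. 0 < t * u + (1 - t) * v"
    using pair_minimax[of ?S] by blast
  have "0 < L i (\<lambda>x. t * \<psi> x + (1 - t) * \<eta> x)" if "i \<in> I" for i
    using t(3) that insert.prems(4)[OF that \<psi> \<eta>(1), of t] by auto
  moreover have "(\<lambda>x. t * \<psi> x + (1 - t) * \<eta> x) \<in> \<Psi>"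
    using \<Psi> \<psi> \<eta>(1) t(1,2) unfolding convex_functions_def by blast
  ultimately show ?case by blast
qed

text \<open>Otherwise, for each \<open>n\<close> some index makes the first \<open>n\<close> functions of \<open>D\<close> nonpositive, and a
  limit of these indices makes all of \<open>D\<close> nonpositive.\<close>

lemma countable_minimax:
  fixes L :: "'i \<Rightarrow> ('a \<Rightarrow> real) \<Rightarrow> real"
  assumes \<Psi>: "convex_functions \<Psi>"
    and aff: "\<And>i \<psi> \<eta> t. i \<in> I \<Longrightarrow> \<psi> \<in> \<Psi> \<Longrightarrow> \<eta> \<in> \<Psi> \<Longrightarrow> L i (\<lambda>x. t * \<psi> x + (1 - t) * \<eta> x) = t * L i \<psi> + (1 - t) * L i \<eta>"
    and fam: "compact_convex_family L I \<Psi>"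
    and D: "countable D" "D \<subseteq> \<Psi>" "D \<noteq> {}" and pos: "\<And>i. i \<in> I \<Longrightarrow> \<exists>\<psi>\<in>D. 0 < L i \<psi>"
  shows "\<exists>\<psi>\<in>\<Psi>. \<forall>i\<in>I. 0 < L i \<psi>"
proof (rule ccontr)
  assume no: "\<not> ?thesis"
  have D_range: "range (from_nat_into D) = D" using D(1,3) by (simp add: range_from_nat_into)
  have "\<exists>i. i \<in> I \<and> (\<forall>m\<le>n. L i (from_nat_into D m) \<le> 0)" for n
  proof (rule ccontr)
    assume *: "\<not> (\<exists>i. i \<in> I \<and> (\<forall>m\<le>n. L i (from_nat_into D m) \<le> 0))"
    have "\<exists>\<psi>\<in>\<Psi>. \<forall>i\<in>I. 0 < L i \<psi>"
    proof (rule finite_minimax[OF \<Psi> aff, where B = "from_nat_into D ` {..n}"])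
      show "\<exists>\<psi>\<in>from_nat_into D ` {..n}. 0 < L i \<psi>" if "i \<in> I" for i
        using * that by (auto simp: not_le)
      show "from_nat_into D ` {..n} \<subseteq> \<Psi>" using D(2) D_range by auto
    qed (use fam in auto)
    with no show False by blast
  qed
  then have "\<forall>n. \<exists>i. i \<in> I \<and> (\<forall>m\<le>n. L i (from_nat_into D m) \<le> 0)" by blast
  from choice[OF this] obtain f
    where f: "\<And>n. f n \<in> I" "\<And>n m. m \<le> n \<Longrightarrow> L (f n) (from_nat_into D m) \<le> 0"
    by blast
  obtain r i where r: "strict_mono (r :: nat \<Rightarrow> nat)" "i \<in> I" "\<forall>\<psi>\<in>\<Psi>. (\<lambda>n. L (f (r n)) \<psi>) \<longlonglongrightarrow> L i \<psi>"
    using compact_convex_family_limit[where f = f, OF fam f(1)] by blast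
  obtain \<psi> where \<psi>: "\<psi> \<in> D" "0 < L i \<psi>" using pos[OF r(2)] by blast
  obtain m where m: "\<psi> = from_nat_into D m" using D_range \<psi>(1) by (metis rangeE)
  have "L i \<psi> \<le> 0"
  proof (rule LIMSEQ_le_const2)
    show "(\<lambda>n. L (f (r n)) \<psi>) \<longlonglongrightarrow> L i \<psi>" using r(3) D(2) \<psi>(1) by blast
    show "\<exists>N. \<forall>n\<ge>N. L (f (r n)) \<psi> \<le> 0"
      using f(2) seq_suble[OF r(1)] unfolding m by (intro exI[of _ m]) (meson le_trans)
  qed
  with \<psi>(2) show False by simp
qed

lemma cont_functions_geometric_limit:
  fixes f :: "nat \<Rightarrow> 'a \<Rightarrow> real"
  assumes f: "\<And>n. f n \<in> cont_functions X"
    and step: "\<And>n x. x \<in> topspace X \<Longrightarrow> \<bar>f (Suc n) x - f n x\<bar> \<le> B / 2 ^ n"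
  shows "\<exists>g\<in>cont_functions X. \<forall>n. \<forall>x\<in>topspace X. \<bar>g x - f n x\<bar> \<le> 2 * B / 2 ^ n"
proof -
  have half: "summable (\<lambda>n. (1 / 2 :: real) ^ n)" by (rule summable_geometric) simp
  have summ: "summable (\<lambda>n. B / 2 ^ n)"
    using summable_mult[OF half, of B] by (simp add: power_one_over)
  have tail_sum: "(\<Sum>i. B / 2 ^ (i + n)) = 2 * B / 2 ^ n" for n
  proof -
    have "(\<Sum>i. B / 2 ^ (i + n)) = (\<Sum>i. B / 2 ^ n * (1 / 2) ^ i)"
      by (simp add: power_add power_one_over mult.commute)
    also have "\<dots> = B / 2 ^ n * (\<Sum>i. (1 / 2) ^ i)"
      by (rule suminf_mult[OF half])
    also have "(\<Sum>i. (1 / 2 :: real) ^ i) = 2"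
      using suminf_geometric[of "1 / 2 :: real"] by simp
    finally show ?thesis by simp
  qed
  define g where "g x = f 0 x + (\<Sum>i. f (Suc i) x - f i x)" for x
  have "g \<in> cont_functions X"
    unfolding g_def[abs_def]
  proof (rule cont_functions_add[OF f])
    show "(\<lambda>x. \<Sum>i. f (Suc i) x - f i x) \<in> cont_functions X"
      unfolding cont_functions_def mem_Collect_eq
      by (rule continuous_map_suminf[OF _ step summ])
        (use f in \<open>auto simp: cont_functions_def intro!: continuous_map_diff\<close>)
  qed
  moreover have "\<bar>g x - f n x\<bar> \<le> 2 * B / 2 ^ n" if x: "x \<in> topspace X" for n x
  proof -
    have s: "summable (\<lambda>i. f (Suc i) x - f i x)"
      by (rule summable_comparison_test'[OF summ]) (use step[OF x] in auto)
    have s': "summable (\<lambda>i. f (Suc (i + n)) x - f (i + n) x)"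
      using s summable_ignore_initial_segment[of "\<lambda>i. f (Suc i) x - f i x" n] by simp
    have t: "summable (\<lambda>i. B / 2 ^ (i + n))"
      by (rule summable_ignore_initial_segment[OF summ])
    have "(\<Sum>i<n. f (Suc i) x - f i x) = f n x - f 0 x"
      by (rule sum_lessThan_telescope)
    then have eq: "g x - f n x = (\<Sum>i. f (Suc (i + n)) x - f (i + n) x)"
      using suminf_split_initial_segment[OF s, of n] by (simp add: g_def)
    have s'': "summable (\<lambda>i. \<bar>f (Suc (i + n)) x - f (i + n) x\<bar>)"
      by (rule summable_comparison_test'[OF t]) (use step[OF x] in auto)
    have "\<bar>g x - f n x\<bar> \<le> (\<Sum>i. \<bar>f (Suc (i + n)) x - f (i + n) x\<bar>)"
      unfolding eq by (rule summable_rabs[OF s''])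
    also have "\<dots> \<le> (\<Sum>i. B / 2 ^ (i + n))"
      by (rule suminf_le[OF _ s'' t]) (rule step[OF x])
    finally show ?thesis using tail_sum by simp
  qed
  ultimately show ?thesis by blast
qed

section \<open>Separation of a face by continuous functions\<close>

context constrained_face
begin

lemma Q_sequentially_compact:
  assumes q: "\<And>n. q n \<in> Q"
  shows "\<exists>r p. strict_mono (r :: nat \<Rightarrow> nat) \<and> p \<in> Q \<and>
    (\<forall>f\<in>cont_functions X. (\<lambda>n. integral\<^sup>L (q (r n)) f) \<longlonglongrightarrow> integral\<^sup>L p f)"
proof -
  have inv: "q n \<in> invariant_measures X T" for n
    using q[of n] by (simp add: constrained_measures_def)
  obtain r p where r: "strict_mono (r :: nat \<Rightarrow> nat)" and p: "prob_space p" "sets p = sets (borel_sigma X)"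
    and lim: "\<forall>f\<in>cont_functions X. (\<lambda>n. integral\<^sup>L (q (r n)) f) \<longlonglongrightarrow> integral\<^sup>L p f"
    using measures_sequentially_compact[OF compact metrizable, of q] inv
    unfolding invariant_measures_def by blast
  have "p \<in> invariant_measures X T"
    by (rule invariant_measures_limit[OF inv p lim[rule_format]])
  moreover have "integral\<^sup>L p g = 0" if g: "g \<in> G" for g
  proof -
    have "(\<lambda>n. integral\<^sup>L (q (r n)) g) \<longlonglongrightarrow> integral\<^sup>L p g" using lim g G_cont by blast
    then show ?thesis using QD(3)[OF q g] by (simp add: LIMSEQ_const_iff)
  qed
  ultimately have "p \<in> Q" by (simp add: constrained_measures_def)
  with r lim show ?thesis by blast
qed

lemma K_sequentially_closed:
  assumes k: "\<And>n. k n \<in> K" and p: "p \<in> Q"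
    and lim: "\<And>f. f \<in> cont_functions X \<Longrightarrow> (\<lambda>n. integral\<^sup>L (k n) f) \<longlonglongrightarrow> integral\<^sup>L p f"
  shows "p \<in> K"
proof -
  let ?P = "product_topology (\<lambda>_. euclideanreal) (cont_functions X)"
  let ?ev = "\<lambda>\<mu>. \<lambda>f\<in>cont_functions X. integral\<^sup>L \<mu> f"
  obtain Z where Z: "closedin (weak_star_topology X T) Z" and KZ: "K = Z \<inter> Q"
    using closed unfolding closedin_subtopology by blast
  have "p \<in> Z"
  proof (rule ccontr)
    assume "p \<notin> Z"
    have "openin (weak_star_topology X T) (topspace (weak_star_topology X T) - Z)"
      using Z by (simp add: closedin_def)
    then obtain U where U: "openin ?P U"
      and eq: "topspace (weak_star_topology X T) - Z = ?ev -` U \<inter> invariant_measures X T"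
      unfolding weak_star_topology_def openin_pullback_topology by blast
    have inv: "\<mu> \<in> invariant_measures X T" if "\<mu> \<in> Q" for \<mu>
      using that by (simp add: constrained_measures_def)
    have top: "topspace (weak_star_topology X T) = invariant_measures X T"
      unfolding weak_star_topology_def topspace_pullback_topology by auto
    have "?ev p \<in> U"
      using eq inv[OF p] \<open>p \<notin> Z\<close> unfolding top by blast
    have "limitin ?P (\<lambda>n. ?ev (k n)) (?ev p) sequentially"
      unfolding limitin_componentwise using lim by (auto simp: PiE_def)
    then have "\<forall>\<^sub>F n in sequentially. ?ev (k n) \<in> U"
      using U \<open>?ev p \<in> U\<close> unfolding limitin_def by blast
    then obtain n where "?ev (k n) \<in> U"
      by (auto simp: eventually_sequentially)
    then have "k n \<notin> Z" using eq inv k K_subset unfolding top by blast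
    then show False using k KZ by blast
  qed
  then show ?thesis using p KZ by blast
qed

text \<open>Addition in the cone generated by a convex set of measures; \<open>S\<close> will be \<open>Q\<close> or \<open>K\<close>.\<close>

lemma cone_sum:
  assumes S: "convex_measures S" "S \<subseteq> Q" and pq: "p \<in> S" "q \<in> S" and ab: "0 \<le> a" "0 \<le> b"
  shows "\<exists>s\<in>S. \<forall>f\<in>cont_functions X. a * integral\<^sup>L p f + b * integral\<^sup>L q f = (a + b) * integral\<^sup>L s f"
proof (cases "a + b = 0")
  case True
  then have "a = 0" "b = 0" using ab by linarith+
  then show ?thesis using pq by auto
next
  case False
  then have pos: "0 < a + b" using ab by linarith
  let ?t = "a / (a + b)"
  have t: "0 \<le> ?t" "?t \<le> 1" using pos ab by simp_all
  have t': "1 - ?t = b / (a + b)" using pos by (simp add: field_simps)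
  have "mixture ?t p q \<in> S" using S(1) pq t unfolding convex_measures_def by blast
  moreover have "a * integral\<^sup>L p f + b * integral\<^sup>L q f = (a + b) * integral\<^sup>L (mixture ?t p q) f"
    if f: "f \<in> cont_functions X" for f
  proof -
    have "p \<in> finite_invariant" "q \<in> finite_invariant" using pq S(2) QD(1) by auto
    moreover have "0 \<le> 1 - ?t" using t by simp
    ultimately have "integral\<^sup>L (mixture ?t p q) f = ?t * integral\<^sup>L p f + (1 - ?t) * integral\<^sup>L q f"
      unfolding mixture_eq_measure_comb using t(1) f by (intro finite_invariant_measure_comb(2))
    then have "integral\<^sup>L (mixture ?t p q) f = (a * integral\<^sup>L p f + b * integral\<^sup>L q f) / (a + b)"
      unfolding t' by (simp add: add_divide_distrib)
    then show ?thesis using pos by simp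
  qed
  ultimately show ?thesis by blast
qed

lemma integral_difference_le:
  assumes q: "q \<in> Q" and fg: "f \<in> cont_functions X" "g \<in> cont_functions X"
    and le: "\<And>x. x \<in> topspace X \<Longrightarrow> \<bar>f x - g x\<bar> \<le> e"
  shows "\<bar>integral\<^sup>L q f - integral\<^sup>L q g\<bar> \<le> e"
proof -
  have "integral\<^sup>L q (\<lambda>x. f x - g x) = integral\<^sup>L q f - integral\<^sup>L q g"
    using finite_invariantD(6)[OF QD(1)[OF q]] fg by (intro Bochner_Integration.integral_diff) auto
  moreover have "\<bar>integral\<^sup>L q (\<lambda>x. f x - g x)\<bar> \<le> e * measure q (topspace X)"
    by (rule integral_abs_le_mass[OF QD(1)[OF q] cont_functions_diff[OF fg] le])
  ultimately show ?thesis using QD(2)[OF q] by simp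
qed

lemma integral_affine:
  assumes q: "q \<in> Q" and fg: "f \<in> cont_functions X" "g \<in> cont_functions X"
  shows "integral\<^sup>L q (\<lambda>x. s * f x + t * g x) = s * integral\<^sup>L q f + t * integral\<^sup>L q g"
  using finite_invariantD(6)[OF QD(1)[OF q]] fg by (subst Bochner_Integration.integral_add) auto

text \<open>The affine functionals of the minimax theorem. With the weights 1 and 0 of \<open>\<alpha>\<close> they express that
  \<open>\<psi>\<close> is above \<open>-e\<close> on \<open>Q\<close> and below \<open>e\<close> on \<open>K\<close>; the weights in between make the family convex.\<close>

definition gap :: "real \<Rightarrow> real \<times> 'a measure \<times> 'a measure \<Rightarrow> ('a \<Rightarrow> real) \<Rightarrow> real" where
  "gap e = (\<lambda>(\<alpha>, q, k) \<psi>. \<alpha> * integral\<^sup>L q \<psi> - (1 - \<alpha>) * integral\<^sup>L k \<psi> + e)"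

lemma gap_family:
  assumes "\<Psi> \<subseteq> cont_functions X"
  shows "compact_convex_family (gap e) ({0..1} \<times> Q \<times> K) \<Psi>"
  unfolding compact_convex_family_def
proof (intro conjI ballI allI impI)
  fix i j :: "real \<times> 'a measure \<times> 'a measure" and t :: real
  assume ij: "i \<in> {0..1} \<times> Q \<times> K" "j \<in> {0..1} \<times> Q \<times> K" and t: "0 \<le> t \<and> t \<le> 1"
  obtain a q k where i: "i = (a, q, k)" "0 \<le> a" "a \<le> 1" "q \<in> Q" "k \<in> K" using ij by auto
  obtain b p l where j: "j = (b, p, l)" "0 \<le> b" "b \<le> 1" "p \<in> Q" "l \<in> K" using ij by auto
  obtain s where s: "s \<in> Q" "\<forall>f\<in>cont_functions X. t * a * integral\<^sup>L q f + (1 - t) * b * integral\<^sup>L p f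
      = (t * a + (1 - t) * b) * integral\<^sup>L s f"
    using cone_sum[OF Q_convex order_refl i(4) j(4), of "t * a" "(1 - t) * b"] i(2) j(2) t by auto
  obtain m where m: "m \<in> K" "\<forall>f\<in>cont_functions X. t * (1 - a) * integral\<^sup>L k f + (1 - t) * (1 - b) * integral\<^sup>L l f
      = (t * (1 - a) + (1 - t) * (1 - b)) * integral\<^sup>L m f"
    using cone_sum[OF K_convex K_subset i(5) j(5), of "t * (1 - a)" "(1 - t) * (1 - b)"] i(3) j(3) t by auto
  have "0 \<le> t * a + (1 - t) * b" using i(2) j(2) t by simp
  moreover have "t * a + (1 - t) * b \<le> 1" using convex_bound_le[of a 1 b t "1 - t"] i(3) j(3) t by simp
  moreover have "gap e (t * a + (1 - t) * b, s, m) \<psi> = t * gap e i \<psi> + (1 - t) * gap e j \<psi>" if "\<psi> \<in> \<Psi>" for \<psi>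
  proof -
    have \<psi>: "\<psi> \<in> cont_functions X" using that assms by auto
    have e: "1 - (t * a + (1 - t) * b) = t * (1 - a) + (1 - t) * (1 - b)" by algebra
    show ?thesis
      unfolding gap_def i(1) j(1) prod.case e s(2)[rule_format, OF \<psi>, symmetric] m(2)[rule_format, OF \<psi>, symmetric]
      by (simp add: algebra_simps)
  qed
  ultimately show "\<exists>k\<in>{0..1} \<times> Q \<times> K. \<forall>\<psi>\<in>\<Psi>. gap e k \<psi> = t * gap e i \<psi> + (1 - t) * gap e j \<psi>"
    using s(1) m(1) by (intro bexI[of _ "(t * a + (1 - t) * b, s, m)"]) auto
next
  fix f :: "nat \<Rightarrow> real \<times> 'a measure \<times> 'a measure" assume f: "range f \<subseteq> {0..1} \<times> Q \<times> K"
  define a q k where "a n = fst (f n)" and "q n = fst (snd (f n))" and "k n = snd (snd (f n))" for n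
  have fn: "f n = (a n, q n, k n)" for n by (simp add: a_def q_def k_def)
  have mem: "a n \<in> {0..1}" "q n \<in> Q" "k n \<in> K" for n
    using f fn[of n] by (metis SigmaE UNIV_I image_subset_iff prod.inject)+
  obtain r1 p where r1: "strict_mono (r1 :: nat \<Rightarrow> nat)" "p \<in> Q"
    "\<forall>f\<in>cont_functions X. (\<lambda>n. integral\<^sup>L (q (r1 n)) f) \<longlonglongrightarrow> integral\<^sup>L p f"
    using Q_sequentially_compact[of q] mem(2) by blast
  have "k (r1 n) \<in> Q" for n using mem(3) K_subset by auto
  then obtain r2 l where r2: "strict_mono (r2 :: nat \<Rightarrow> nat)" "l \<in> Q"
    "\<forall>f\<in>cont_functions X. (\<lambda>n. integral\<^sup>L (k (r1 (r2 n))) f) \<longlonglongrightarrow> integral\<^sup>L l f"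
    using Q_sequentially_compact[of "\<lambda>n. k (r1 n)"] by blast
  have l: "l \<in> K" by (rule K_sequentially_closed[where k = "\<lambda>n. k (r1 (r2 n))", OF mem(3) r2(2)]) (rule r2(3)[rule_format])
  have "\<exists>l\<in>{0..1}. \<exists>r. strict_mono r \<and> ((\<lambda>n. a (r1 (r2 n))) \<circ> r) \<longlonglongrightarrow> l"
    by (rule compact_imp_seq_compact[OF compact_Icc, unfolded seq_compact_def, rule_format]) (rule mem(1))
  then obtain \<alpha> r3 where r3: "strict_mono (r3 :: nat \<Rightarrow> nat)" "\<alpha> \<in> {0..1}" "(\<lambda>n. a (r1 (r2 (r3 n)))) \<longlonglongrightarrow> \<alpha>"
    unfolding o_def by blast
  let ?r = "\<lambda>n. r1 (r2 (r3 n))"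
  have r23: "strict_mono (\<lambda>n. r2 (r3 n))" and r: "strict_mono ?r"
    using r1(1) r2(1) r3(1) by (auto simp: strict_mono_def)
  have "(\<lambda>n. gap e (f (?r n)) \<psi>) \<longlonglongrightarrow> gap e (\<alpha>, p, l) \<psi>" if "\<psi> \<in> \<Psi>" for \<psi>
  proof -
    have \<psi>: "\<psi> \<in> cont_functions X" using that assms by auto
    have "(\<lambda>n. integral\<^sup>L (q (?r n)) \<psi>) \<longlonglongrightarrow> integral\<^sup>L p \<psi>"
      using LIMSEQ_subseq_LIMSEQ[OF r1(3)[rule_format, OF \<psi>] r23] by (simp add: o_def)
    moreover have "(\<lambda>n. integral\<^sup>L (k (?r n)) \<psi>) \<longlonglongrightarrow> integral\<^sup>L l \<psi>"
      using LIMSEQ_subseq_LIMSEQ[OF r2(3)[rule_format, OF \<psi>] r3(1)] by (simp add: o_def)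
    ultimately show ?thesis
      unfolding fn gap_def prod.case by (intro tendsto_intros r3(3))
  qed
  then show "\<exists>r i. strict_mono r \<and> i \<in> {0..1} \<times> Q \<times> K \<and> (\<forall>\<psi>\<in>\<Psi>. (\<lambda>n. gap e (f (r n)) \<psi>) \<longlonglongrightarrow> gap e i \<psi>)"
    using r r1(2) l r3(2) by (intro exI[of _ ?r] exI[of _ "(\<alpha>, p, l)"]) auto
qed

text \<open>It suffices to satisfy each weighted condition with its own function from \<open>\<Psi>\<close>: the minimax
  theorem makes the function uniform.\<close>

lemma separation:
  assumes \<Psi>: "\<Psi> \<subseteq> cont_functions X" "convex_functions \<Psi>"
    and pos: "\<And>\<alpha> q k. 0 \<le> \<alpha> \<Longrightarrow> \<alpha> \<le> 1 \<Longrightarrow> q \<in> Q \<Longrightarrow> k \<in> K \<Longrightarrow>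
      \<exists>\<psi>\<in>\<Psi>. 0 < \<alpha> * integral\<^sup>L q \<psi> - (1 - \<alpha>) * integral\<^sup>L k \<psi> + e"
  shows "\<exists>\<psi>\<in>\<Psi>. (\<forall>q\<in>Q. - e < integral\<^sup>L q \<psi>) \<and> (\<forall>k\<in>K. integral\<^sup>L k \<psi> < e)"
proof -
  obtain k0 where k0: "k0 \<in> K" using K_nonempty by auto
  then have k0Q: "k0 \<in> Q" using K_subset by auto
  obtain D where D: "D \<subseteq> \<Psi>" "countable D" and dense: "\<forall>f\<in>\<Psi>. \<forall>e>0. \<exists>g\<in>D. \<forall>x\<in>topspace X. \<bar>f x - g x\<bar> < e"
    using countable_dense_subset[OF compact metrizable \<Psi>(1)] by blast
  have D_pos: "\<exists>\<psi>\<in>D. 0 < gap e i \<psi>" if i: "i \<in> {0..1} \<times> Q \<times> K" for i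
  proof -
    obtain a q k where i: "i = (a, q, k)" "0 \<le> a" "a \<le> 1" "q \<in> Q" "k \<in> K" using i by auto
    have kQ: "k \<in> Q" using i(5) K_subset by auto
    obtain \<psi> where \<psi>: "\<psi> \<in> \<Psi>" "0 < gap e i \<psi>"
      using pos[OF i(2-5)] unfolding gap_def i(1) prod.case by blast
    obtain g where g: "g \<in> D" "\<forall>x\<in>topspace X. \<bar>\<psi> x - g x\<bar> < gap e i \<psi> / 2"
      using dense \<psi> half_gt_zero by blast
    have cont: "\<psi> \<in> cont_functions X" "g \<in> cont_functions X" using \<psi>(1) g(1) D(1) \<Psi>(1) by auto
    have 1: "\<bar>integral\<^sup>L q \<psi> - integral\<^sup>L q g\<bar> \<le> gap e i \<psi> / 2" "\<bar>integral\<^sup>L k \<psi> - integral\<^sup>L k g\<bar> \<le> gap e i \<psi> / 2"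
      by (rule integral_difference_le[OF i(4) cont], use g(2) in force,
          rule integral_difference_le[OF kQ cont], use g(2) in force)
    have "a * (integral\<^sup>L q \<psi> - integral\<^sup>L q g) \<le> a * (gap e i \<psi> / 2)"
      using 1(1) i(2) by (intro mult_left_mono) linarith+
    moreover have "(1 - a) * (integral\<^sup>L k g - integral\<^sup>L k \<psi>) \<le> (1 - a) * (gap e i \<psi> / 2)"
      using 1(2) i(3) by (intro mult_left_mono) linarith+
    moreover have "gap e i \<psi> - gap e i g = a * (integral\<^sup>L q \<psi> - integral\<^sup>L q g) + (1 - a) * (integral\<^sup>L k g - integral\<^sup>L k \<psi>)"
      unfolding gap_def i(1) prod.case by (simp add: algebra_simps)
    ultimately have "gap e i \<psi> - gap e i g \<le> a * (gap e i \<psi> / 2) + (1 - a) * (gap e i \<psi> / 2)"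
      by linarith
    also have "\<dots> = gap e i \<psi> / 2" by (simp add: field_simps)
    finally show ?thesis using g(1) \<psi>(2) by (intro bexI[of _ g]) linarith+
  qed
  have "\<exists>\<psi>\<in>\<Psi>. \<forall>i\<in>{0..1} \<times> Q \<times> K. 0 < gap e i \<psi>"
  proof (rule countable_minimax[OF \<Psi>(2) _ gap_family[OF \<Psi>(1)] D(2,1) _ D_pos])
    fix i :: "real \<times> 'a measure \<times> 'a measure" and \<psi> \<eta> and t :: real
    assume i: "i \<in> {0..1} \<times> Q \<times> K" and \<psi>: "\<psi> \<in> \<Psi>" and \<eta>: "\<eta> \<in> \<Psi>"
    obtain a q k where i: "i = (a, q, k)" "q \<in> Q" "k \<in> K" using i by auto
    have kQ: "k \<in> Q" using i(3) K_subset by auto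
    have cont: "\<psi> \<in> cont_functions X" "\<eta> \<in> cont_functions X" using \<psi> \<eta> \<Psi>(1) by auto
    show "gap e i (\<lambda>x. t * \<psi> x + (1 - t) * \<eta> x) = t * gap e i \<psi> + (1 - t) * gap e i \<eta>"
      unfolding gap_def i(1) prod.case integral_affine[OF i(2) cont] integral_affine[OF kQ cont]
      by (simp add: algebra_simps)
  next
    show "D \<noteq> {}" using D_pos[of "(1, k0, k0)"] k0 k0Q by auto
  qed
  then obtain \<psi> where \<psi>: "\<psi> \<in> \<Psi>" "\<forall>i\<in>{0..1} \<times> Q \<times> K. 0 < gap e i \<psi>" by blast
  have "- e < integral\<^sup>L q \<psi>" if "q \<in> Q" for q
    using \<psi>(2)[rule_format, of "(1, q, k0)"] that k0 by (simp add: gap_def)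
  moreover have "integral\<^sup>L k \<psi> < e" if "k \<in> K" for k
    using \<psi>(2)[rule_format, of "(0, k0, k)"] that k0Q by (simp add: gap_def)
  ultimately show ?thesis using \<psi>(1) by blast
qed

definition almost_exposing :: "real \<Rightarrow> ('a \<Rightarrow> real) \<Rightarrow> bool" where
  "almost_exposing e \<phi> \<longleftrightarrow> \<phi> \<in> cont_functions X \<and>
     (\<forall>q\<in>Q. - e \<le> integral\<^sup>L q \<phi>) \<and> (\<forall>k\<in>K. integral\<^sup>L k \<phi> \<le> e)"

text \<open>Apply \<open>separation\<close> to the functions within \<open>c e\<close> of \<open>\<phi>\<close>. For \<open>w = a q' - b k'\<close> with
  \<open>a + b \<le> c w(\<psi>)\<close>, the error of \<open>\<phi>\<close> gives \<open>w(\<phi>) \<ge> - e (a + b)\<close>, so \<open>\<phi> + c e \<psi>\<close> has a nonnegative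
  integral with respect to \<open>w\<close>. It is essential here that the decomposition is the bounded one.\<close>

lemma almost_exposing_improve:
  "\<exists>c>0. \<forall>e>0. \<forall>\<phi>. almost_exposing e \<phi> \<longrightarrow>
     (\<exists>\<psi>. almost_exposing (e / 2) \<psi> \<and> (\<forall>x\<in>topspace X. \<bar>\<psi> x - \<phi> x\<bar> \<le> c * e))"
proof -
  obtain c where c: "0 < c" and dec: "\<forall>q\<in>Q. \<forall>k\<in>K. \<forall>\<alpha>. 0 \<le> \<alpha> \<and> \<alpha> \<le> 1 \<longrightarrow>
    (\<exists>q'\<in>Q. \<exists>k'\<in>K. \<exists>a\<ge>0. \<exists>b\<ge>0. \<exists>\<psi>\<in>cont_functions X. (\<forall>x\<in>topspace X. \<bar>\<psi> x\<bar> \<le> 1) \<and>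
      (\<forall>\<phi>\<in>cont_functions X. \<alpha> * integral\<^sup>L q \<phi> - (1 - \<alpha>) * integral\<^sup>L k \<phi> = a * integral\<^sup>L q' \<phi> - b * integral\<^sup>L k' \<phi>) \<and>
      a + b \<le> c * (\<alpha> * integral\<^sup>L q \<psi> - (1 - \<alpha>) * integral\<^sup>L k \<psi>))"
    using bounded_decomposition by blast
  have "\<exists>\<psi>. almost_exposing (e / 2) \<psi> \<and> (\<forall>x\<in>topspace X. \<bar>\<psi> x - \<phi> x\<bar> \<le> c * e)"
    if e: "0 < e" and \<phi>: "almost_exposing e \<phi>" for e \<phi>
  proof -
    have \<phi>c: "\<phi> \<in> cont_functions X" using \<phi> by (simp add: almost_exposing_def)
    define \<Psi> where "\<Psi> = {\<psi> \<in> cont_functions X. \<forall>x\<in>topspace X. \<bar>\<psi> x - \<phi> x\<bar> \<le> c * e}"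
    have "convex_functions \<Psi>"
      unfolding convex_functions_def
    proof (intro ballI allI impI)
      fix \<psi> \<eta> and t :: real assume \<psi>: "\<psi> \<in> \<Psi>" and \<eta>: "\<eta> \<in> \<Psi>" and t: "0 \<le> t \<and> t \<le> 1"
      have "\<bar>t * \<psi> x + (1 - t) * \<eta> x - \<phi> x\<bar> \<le> c * e" if x: "x \<in> topspace X" for x
      proof -
        have "\<bar>t * \<psi> x + (1 - t) * \<eta> x - \<phi> x\<bar> = \<bar>t * (\<psi> x - \<phi> x) + (1 - t) * (\<eta> x - \<phi> x)\<bar>"
          by (simp add: algebra_simps)
        also have "\<dots> \<le> \<bar>t * (\<psi> x - \<phi> x)\<bar> + \<bar>(1 - t) * (\<eta> x - \<phi> x)\<bar>"
          by (rule abs_triangle_ineq)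
        also have "\<dots> = t * \<bar>\<psi> x - \<phi> x\<bar> + (1 - t) * \<bar>\<eta> x - \<phi> x\<bar>"
          using t by (simp add: abs_mult)
        also have "\<dots> \<le> t * (c * e) + (1 - t) * (c * e)"
          using \<psi> \<eta> t x by (intro add_mono mult_left_mono) (auto simp: \<Psi>_def)
        also have "\<dots> = c * e" by (simp add: algebra_simps)
        finally show ?thesis .
      qed
      then show "(\<lambda>x. t * \<psi> x + (1 - t) * \<eta> x) \<in> \<Psi>"
        using \<psi> \<eta> by (auto simp: \<Psi>_def intro!: cont_functions_add cont_functions_mult)
    qed
    moreover have "\<exists>\<psi>\<in>\<Psi>. 0 < \<alpha> * integral\<^sup>L q \<psi> - (1 - \<alpha>) * integral\<^sup>L k \<psi> + e / 2"
      if \<alpha>: "0 \<le> \<alpha>" "\<alpha> \<le> 1" and q: "q \<in> Q" and k: "k \<in> K" for \<alpha> q k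
    proof -
      have kQ: "k \<in> Q" using k K_subset by auto
      obtain q' k' a b \<psi> where q': "q' \<in> Q" and k': "k' \<in> K" and ab: "0 \<le> a" "0 \<le> b"
        and \<psi>: "\<psi> \<in> cont_functions X" "\<forall>x\<in>topspace X. \<bar>\<psi> x\<bar> \<le> 1"
        and eq: "\<forall>\<phi>\<in>cont_functions X. \<alpha> * integral\<^sup>L q \<phi> - (1 - \<alpha>) * integral\<^sup>L k \<phi> = a * integral\<^sup>L q' \<phi> - b * integral\<^sup>L k' \<phi>"
        and bound: "a + b \<le> c * (\<alpha> * integral\<^sup>L q \<psi> - (1 - \<alpha>) * integral\<^sup>L k \<psi>)"
        using dec[rule_format, OF q k conjI[OF \<alpha>]]
        by (elim bexE exE conjE) (rule that)
      define \<rho> where "\<rho> = (\<lambda>x. 1 * \<phi> x + (c * e) * \<psi> x)"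
      have \<rho>: "\<rho> \<in> \<Psi>"
      proof -
        have "\<bar>c * e * \<psi> x\<bar> \<le> c * e" if "x \<in> topspace X" for x
          using mult_left_mono[OF \<psi>(2)[rule_format, OF that], of "c * e"] c e by (simp add: abs_mult)
        then show ?thesis unfolding \<Psi>_def \<rho>_def
          by (auto intro!: cont_functions_add cont_functions_mult \<phi>c \<psi>(1))
      qed
      have "- e \<le> integral\<^sup>L q' \<phi>" "integral\<^sup>L k' \<phi> \<le> e"
        using \<phi> q' k' by (auto simp: almost_exposing_def)
      then have "a * (- e) \<le> a * integral\<^sup>L q' \<phi>" "b * integral\<^sup>L k' \<phi> \<le> b * e"
        using ab by (simp_all only: mult_left_mono)
      then have 1: "- (e * (a + b)) \<le> \<alpha> * integral\<^sup>L q \<phi> - (1 - \<alpha>) * integral\<^sup>L k \<phi>"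
        unfolding eq[rule_format, OF \<phi>c] by (simp add: algebra_simps)
      have 2: "e * (a + b) \<le> e * (c * (\<alpha> * integral\<^sup>L q \<psi> - (1 - \<alpha>) * integral\<^sup>L k \<psi>))"
        using bound e by (intro mult_left_mono) auto
      have "\<alpha> * integral\<^sup>L q \<rho> - (1 - \<alpha>) * integral\<^sup>L k \<rho> =
          (\<alpha> * integral\<^sup>L q \<phi> - (1 - \<alpha>) * integral\<^sup>L k \<phi>) + e * (c * (\<alpha> * integral\<^sup>L q \<psi> - (1 - \<alpha>) * integral\<^sup>L k \<psi>))"
        unfolding \<rho>_def integral_affine[OF q \<phi>c \<psi>(1)] integral_affine[OF kQ \<phi>c \<psi>(1)]
        by (simp add: algebra_simps)
      then show ?thesis using 1 2 e \<rho> by (intro bexI[of _ \<rho>]) linarith+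
    qed
    moreover have "\<Psi> \<subseteq> cont_functions X" by (auto simp: \<Psi>_def)
    ultimately obtain \<psi> where "\<psi> \<in> \<Psi>" "\<forall>q\<in>Q. - (e / 2) < integral\<^sup>L q \<psi>" "\<forall>k\<in>K. integral\<^sup>L k \<psi> < e / 2"
      using separation[of \<Psi> "e / 2"] by blast
    then show ?thesis
      by (intro exI[of _ \<psi>]) (auto simp: almost_exposing_def \<Psi>_def less_imp_le)
  qed
  with c show ?thesis by blast
qed

lemma almost_exposing_perturb:
  "\<exists>c>0. \<forall>e>0. \<forall>\<phi>. almost_exposing e \<phi> \<longrightarrow>
     (\<exists>\<psi>. almost_exposing 0 \<psi> \<and> (\<forall>x\<in>topspace X. \<bar>\<psi> x - \<phi> x\<bar> \<le> c * e))"
proof -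
  obtain c where c: "0 < c" and imp: "\<forall>e>0. \<forall>\<phi>. almost_exposing e \<phi> \<longrightarrow>
     (\<exists>\<psi>. almost_exposing (e / 2) \<psi> \<and> (\<forall>x\<in>topspace X. \<bar>\<psi> x - \<phi> x\<bar> \<le> c * e))"
    using almost_exposing_improve by blast
  have "\<exists>\<psi>. almost_exposing 0 \<psi> \<and> (\<forall>x\<in>topspace X. \<bar>\<psi> x - \<phi> x\<bar> \<le> 2 * c * e)"
    if e: "0 < e" and \<phi>: "almost_exposing e \<phi>" for e \<phi>
  proof -
    have "\<exists>f. \<forall>n. (almost_exposing (e / 2 ^ n) (f n) \<and> (n = 0 \<longrightarrow> f n = \<phi>)) \<and>
        (\<forall>x\<in>topspace X. \<bar>f (Suc n) x - f n x\<bar> \<le> c * e / 2 ^ n)"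
    proof (rule dependent_nat_choice)
      show "\<exists>f. almost_exposing (e / 2 ^ 0) f \<and> (0 = (0::nat) \<longrightarrow> f = \<phi>)" using \<phi> by auto
      fix f and n :: nat assume "almost_exposing (e / 2 ^ n) f \<and> (n = 0 \<longrightarrow> f = \<phi>)"
      moreover have "0 < e / 2 ^ n" using e by simp
      ultimately obtain \<psi> where "almost_exposing (e / 2 ^ n / 2) \<psi>" "\<forall>x\<in>topspace X. \<bar>\<psi> x - f x\<bar> \<le> c * (e / 2 ^ n)"
        using imp by blast
      then show "\<exists>\<psi>. (almost_exposing (e / 2 ^ Suc n) \<psi> \<and> (Suc n = 0 \<longrightarrow> \<psi> = \<phi>)) \<and>
          (\<forall>x\<in>topspace X. \<bar>\<psi> x - f x\<bar> \<le> c * e / 2 ^ n)"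
        by (intro exI[of _ \<psi>]) (simp add: mult.commute)
    qed
    then obtain f where f: "\<And>n. almost_exposing (e / 2 ^ n) (f n)" "f 0 = \<phi>"
      and step: "\<And>n x. x \<in> topspace X \<Longrightarrow> \<bar>f (Suc n) x - f n x\<bar> \<le> c * e / 2 ^ n"
      by blast
    have fc: "f n \<in> cont_functions X" for n using f(1)[of n] by (simp add: almost_exposing_def)
    obtain g where g: "g \<in> cont_functions X" "\<And>n x. x \<in> topspace X \<Longrightarrow> \<bar>g x - f n x\<bar> \<le> 2 * (c * e) / 2 ^ n"
      using cont_functions_geometric_limit[OF fc step] by blast
    have lim: "(\<lambda>n. b / 2 ^ n) \<longlonglongrightarrow> 0" for b :: real
      using tendsto_mult[OF tendsto_const LIMSEQ_power_zero[of "1 / 2 :: real"], of b] by (simp add: power_one_over)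
    have close: "\<bar>integral\<^sup>L q g - integral\<^sup>L q (f n)\<bar> \<le> 2 * (c * e) / 2 ^ n" if "q \<in> Q" for q n
      by (rule integral_difference_le[OF that g(1) fc g(2)])
    have "0 \<le> integral\<^sup>L q g" if q: "q \<in> Q" for q
    proof (rule LIMSEQ_le_const2[OF lim[of "- e - 2 * (c * e)"]], intro exI allI impI)
      fix n
      have "- (e / 2 ^ n) \<le> integral\<^sup>L q (f n)" using f(1)[of n] q by (simp add: almost_exposing_def)
      then have "- (e / 2 ^ n) - 2 * (c * e) / 2 ^ n \<le> integral\<^sup>L q g" using close[OF q, of n] by linarith
      then show "(- e - 2 * (c * e)) / 2 ^ n \<le> integral\<^sup>L q g" by (simp add: diff_divide_distrib)
    qed
    moreover have "integral\<^sup>L k g \<le> 0" if k: "k \<in> K" for k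
    proof (rule LIMSEQ_le_const[OF lim[of "e + 2 * (c * e)"]], intro exI allI impI)
      fix n
      have kQ: "k \<in> Q" using k K_subset by auto
      have "integral\<^sup>L k (f n) \<le> e / 2 ^ n" using f(1)[of n] k by (simp add: almost_exposing_def)
      then have "integral\<^sup>L k g \<le> e / 2 ^ n + 2 * (c * e) / 2 ^ n" using close[OF kQ, of n] by linarith
      then show "integral\<^sup>L k g \<le> (e + 2 * (c * e)) / 2 ^ n" by (simp add: add_divide_distrib)
    qed
    ultimately have "almost_exposing 0 g" using g(1) by (simp add: almost_exposing_def)
    moreover have "\<bar>g x - \<phi> x\<bar> \<le> 2 * c * e" if "x \<in> topspace X" for x
      using g(2)[OF that, of 0] f(2) by simp
    ultimately show ?thesis by blast
  qed
  with c show ?thesis by (intro exI[of _ "2 * c"]) auto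
qed

text \<open>Apply \<open>separation\<close> to the functions with integral 1 against \<open>\<mu>\<close>. They take every value on
  \<open>w = \<alpha> q - (1 - \<alpha>) k\<close> unless \<open>w\<close> is a multiple of \<open>\<mu>\<close>. A nonnegative multiple causes no problem,
  and a negative one would make \<open>k\<close> a mixture of \<open>\<mu>\<close> and \<open>q\<close>, so that \<open>\<mu> \<in> K\<close>.\<close>

lemma almost_exposing_start:
  assumes \<mu>: "\<mu> \<in> Q" "\<mu> \<notin> K" and e: "0 < e"
  shows "\<exists>\<phi>. almost_exposing e \<phi> \<and> integral\<^sup>L \<mu> \<phi> = 1"
proof -
  define \<Psi> where "\<Psi> = {\<psi> \<in> cont_functions X. integral\<^sup>L \<mu> \<psi> = 1}"
  have \<Psi>: "\<Psi> \<subseteq> cont_functions X" by (auto simp: \<Psi>_def)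
  have one: "integral\<^sup>L q (\<lambda>x. c) = c" if "q \<in> Q" for q and c :: real
    using QD(2)[OF that] finite_invariantD(3)[OF QD(1)[OF that]] by simp
  have "convex_functions \<Psi>"
    unfolding convex_functions_def
    by (auto simp: \<Psi>_def integral_affine[OF \<mu>(1)] intro!: cont_functions_add cont_functions_mult)
  moreover have "\<exists>\<psi>\<in>\<Psi>. 0 < \<alpha> * integral\<^sup>L q \<psi> - (1 - \<alpha>) * integral\<^sup>L k \<psi> + e"
    if \<alpha>: "0 \<le> \<alpha>" "\<alpha> \<le> 1" and q: "q \<in> Q" and k: "k \<in> K" for \<alpha> q k
  proof -
    have kQ: "k \<in> Q" using k K_subset by auto
    define w where "w \<psi> = \<alpha> * integral\<^sup>L q \<psi> - (1 - \<alpha>) * integral\<^sup>L k \<psi>" for \<psi>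
    have w_affine: "w (\<lambda>x. s * f x + t * g x) = s * w f + t * w g"
      if "f \<in> cont_functions X" "g \<in> cont_functions X" for s t f g
      unfolding w_def integral_affine[OF q that] integral_affine[OF kQ that] by (simp add: algebra_simps)
    have w1: "w (\<lambda>x. 1) = 2 * \<alpha> - 1"
      unfolding w_def one[OF q] one[OF kQ] by simp
    show ?thesis
    proof (cases "\<exists>\<eta>\<in>cont_functions X. w \<eta> \<noteq> w (\<lambda>x. 1) * integral\<^sup>L \<mu> \<eta>")
      case True
      then obtain \<eta> where \<eta>: "\<eta> \<in> cont_functions X" "w \<eta> \<noteq> w (\<lambda>x. 1) * integral\<^sup>L \<mu> \<eta>" by blast
      define d where "d = w \<eta> - w (\<lambda>x. 1) * integral\<^sup>L \<mu> \<eta>"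
      \<comment> \<open>The value of \<open>w\<close> at \<open>1 + s (\<eta> - \<integral>\<eta> d\<mu>)\<close> is \<open>w 1 + s d\<close>; this choice of \<open>s\<close> makes it 0.\<close>
      define s where "s = - w (\<lambda>x. 1) / d"
      define \<psi> where "\<psi> = (\<lambda>x. s * \<eta> x + (1 - s * integral\<^sup>L \<mu> \<eta>) * 1)"
      have d: "d \<noteq> 0" using \<eta>(2) by (simp add: d_def)
      have c1: "(\<lambda>x. 1) \<in> cont_functions X" by simp
      have "\<psi> \<in> cont_functions X"
        unfolding \<psi>_def by (intro cont_functions_add cont_functions_mult \<eta>(1) c1)
      moreover have "integral\<^sup>L \<mu> \<psi> = 1"
        unfolding \<psi>_def integral_affine[OF \<mu>(1) \<eta>(1) c1] one[OF \<mu>(1)] by simp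
      moreover have "w \<psi> = 0"
      proof -
        have "w \<psi> = s * d + w (\<lambda>x. 1)"
          unfolding \<psi>_def w_affine[OF \<eta>(1) c1] d_def by (simp add: algebra_simps)
        then show ?thesis using d by (simp add: s_def)
      qed
      ultimately show ?thesis using e unfolding w_def \<Psi>_def by (intro bexI[of _ \<psi>]) auto
    next
      case False
      then have w_\<mu>: "w \<eta> = (2 * \<alpha> - 1) * integral\<^sup>L \<mu> \<eta>" if "\<eta> \<in> cont_functions X" for \<eta>
        using that w1 by auto
      show ?thesis
      proof (cases "0 \<le> 2 * \<alpha> - 1")
        case True
        have "(\<lambda>x. 1) \<in> \<Psi>"
          unfolding \<Psi>_def mem_Collect_eq by (intro conjI cont_functions_const one \<mu>(1))
        moreover have "0 < w (\<lambda>x. 1) + e" using True e w1 by simp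
        ultimately show ?thesis unfolding w_def by blast
      next
        case False
        \<comment> \<open>Here \<open>\<alpha> q + (1 - 2 \<alpha>) \<mu> = (1 - \<alpha>) k\<close>.\<close>
        define t where "t = (1 - 2 * \<alpha>) / (1 - \<alpha>)"
        have pos: "0 < 1 - \<alpha>" using False \<alpha> by linarith
        have t: "0 < t" "t \<le> 1" and t': "1 - t = \<alpha> / (1 - \<alpha>)"
          using False \<alpha> pos by (simp_all add: t_def field_simps)
        have k_eq: "mixture t \<mu> q = k"
        proof (rule measure_eqI_cont_functions[OF compact metrizable])
          have mix: "mixture t \<mu> q \<in> finite_invariant"
            unfolding mixture_eq_measure_comb by (intro finite_invariant_comb QD(1) \<mu>(1) q)
          note mixD = finite_invariantD[OF mix] and kD = finite_invariantD[OF QD(1)[OF kQ]]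
          show "finite_measure (mixture t \<mu> q)" "finite_measure k"
            "sets (mixture t \<mu> q) = sets (borel_sigma X)" "sets k = sets (borel_sigma X)"
            by (rule mixD(2), rule kD(2), rule mixD(1), rule kD(1))
          fix f assume f: "f \<in> cont_functions X"
          have "0 \<le> t" "0 \<le> 1 - t" using t by linarith+
          then have "integral\<^sup>L (mixture t \<mu> q) f = t * integral\<^sup>L \<mu> f + (1 - t) * integral\<^sup>L q f"
            unfolding mixture_eq_measure_comb by (intro finite_invariant_measure_comb(2) QD(1) \<mu>(1) q f)
          also have "\<dots> = ((1 - 2 * \<alpha>) * integral\<^sup>L \<mu> f + \<alpha> * integral\<^sup>L q f) / (1 - \<alpha>)"
            unfolding t' by (simp add: t_def add_divide_distrib)
          also have "(1 - 2 * \<alpha>) * integral\<^sup>L \<mu> f + \<alpha> * integral\<^sup>L q f = (1 - \<alpha>) * integral\<^sup>L k f"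
            using w_\<mu>[OF f] unfolding w_def by (simp add: algebra_simps)
          also have "(1 - \<alpha>) * integral\<^sup>L k f / (1 - \<alpha>) = integral\<^sup>L k f" using pos by simp
          finally show "integral\<^sup>L (mixture t \<mu> q) f = integral\<^sup>L k f" .
        qed
        have "\<mu> \<in> K"
        proof (cases "t = 1")
          case True
          have "\<mu> = k"
          proof (rule finite_invariant_eqI[OF QD(1)[OF \<mu>(1)] QD(1)[OF kQ]])
            fix A assume A: "A \<in> sets (borel_sigma X)"
            have "measure (measure_comb 1 \<mu> 0 q) A = 1 * measure \<mu> A + 0 * measure q A"
              by (intro finite_invariant_measure_comb(1) QD(1) \<mu>(1) q A) auto
            then show "measure \<mu> A = measure k A"
              using k_eq True unfolding mixture_eq_measure_comb by simp
          qed
          with k show ?thesis by simp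
        next
          case False
          then have "t < 1" using t(2) by simp
          from K_extreme[OF \<mu>(1) q t(1) this] k show ?thesis unfolding k_eq by blast
        qed
        with \<mu>(2) show ?thesis by blast
      qed
    qed
  qed
  ultimately obtain \<psi> where "\<psi> \<in> \<Psi>" "\<forall>q\<in>Q. - e < integral\<^sup>L q \<psi>" "\<forall>k\<in>K. integral\<^sup>L k \<psi> < e"
    using separation[OF \<Psi>] by blast
  then show ?thesis
    by (intro exI[of _ \<psi>]) (auto simp: almost_exposing_def \<Psi>_def less_imp_le)
qed

lemma separating_function:
  assumes \<mu>: "\<mu> \<in> Q" "\<mu> \<notin> K"
  shows "\<exists>\<phi>. almost_exposing 0 \<phi> \<and> 0 < integral\<^sup>L \<mu> \<phi>"
proof -
  obtain c where c: "0 < c" and pert: "\<forall>e>0. \<forall>\<phi>. almost_exposing e \<phi> \<longrightarrow>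
     (\<exists>\<psi>. almost_exposing 0 \<psi> \<and> (\<forall>x\<in>topspace X. \<bar>\<psi> x - \<phi> x\<bar> \<le> c * e))"
    using almost_exposing_perturb by blast
  have e: "0 < 1 / (2 * c)" using c by simp
  obtain \<phi> where \<phi>: "almost_exposing (1 / (2 * c)) \<phi>" "integral\<^sup>L \<mu> \<phi> = 1"
    using almost_exposing_start[OF \<mu> e] by blast
  obtain \<psi> where \<psi>: "almost_exposing 0 \<psi>" "\<forall>x\<in>topspace X. \<bar>\<psi> x - \<phi> x\<bar> \<le> c * (1 / (2 * c))"
    using pert e \<phi>(1) by blast
  have "\<bar>integral\<^sup>L \<mu> \<psi> - integral\<^sup>L \<mu> \<phi>\<bar> \<le> c * (1 / (2 * c))"
    using \<psi> \<phi>(1) by (intro integral_difference_le[OF \<mu>(1)]) (auto simp: almost_exposing_def)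
  also have "\<dots> = 1 / 2" using c by simp
  finally have "0 < integral\<^sup>L \<mu> \<psi>" using \<phi>(2) by linarith
  with \<psi>(1) show ?thesis by blast
qed

text \<open>A sum over a countable dense set of the functions that are nonnegative on \<open>Q\<close> and zero on \<open>K\<close>,
  with weights that make it converge uniformly.\<close>

lemma exposing_function:
  "\<exists>\<phi>\<in>cont_functions X. (\<forall>q\<in>Q. 0 \<le> integral\<^sup>L q \<phi>) \<and> (\<forall>q\<in>Q. integral\<^sup>L q \<phi> = 0 \<longleftrightarrow> q \<in> K)"
proof -
  define P where "P = {\<phi>. almost_exposing 0 \<phi>}"
  have P_cont: "P \<subseteq> cont_functions X" by (auto simp: P_def almost_exposing_def)
  have P_nonneg: "0 \<le> integral\<^sup>L q \<phi>" if "\<phi> \<in> P" "q \<in> Q" for \<phi> q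
    using that by (auto simp: P_def almost_exposing_def)
  have P_zero: "integral\<^sup>L k \<phi> = 0" if "\<phi> \<in> P" "k \<in> K" for \<phi> k
    using that K_subset by (fastforce simp: P_def almost_exposing_def)
  obtain D where D: "D \<subseteq> P" "countable D" and dense: "\<forall>f\<in>P. \<forall>e>0. \<exists>g\<in>D. \<forall>x\<in>topspace X. \<bar>f x - g x\<bar> < e"
    using countable_dense_subset[OF compact metrizable P_cont] by blast
  have "(\<lambda>x. 0) \<in> P" by (simp add: P_def almost_exposing_def)
  then have "D \<noteq> {}" using dense zero_less_one by blast
  define f where "f = from_nat_into D"
  have f_range: "range f = D" using D(2) \<open>D \<noteq> {}\<close> by (simp add: f_def range_from_nat_into)
  have fP: "f n \<in> P" for n using f_range D(1) by auto
  then have fc: "f n \<in> cont_functions X" for n using P_cont by auto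
  have "\<forall>n. \<exists>B. 0 \<le> B \<and> (\<forall>x\<in>topspace X. \<bar>f n x\<bar> \<le> B)"
    using cont_functions_bounded[OF compact fc] by metis
  from choice[OF this] obtain B where B: "\<And>n. 0 \<le> B n" "\<And>n x. x \<in> topspace X \<Longrightarrow> \<bar>f n x\<bar> \<le> B n" by blast
  define h where "h n x = 1 / (2 ^ n * (1 + B n)) * f n x" for n x
  have w: "0 < 1 / (2 ^ n * (1 + B n))" for n using B(1)[of n] by (simp add: add_pos_nonneg)
  have hc: "h n \<in> cont_functions X" for n
    unfolding h_def[abs_def] by (rule cont_functions_mult[OF fc])
  have h_bound: "\<bar>h n x\<bar> \<le> 1 / 2 ^ n" if "x \<in> topspace X" for n x
  proof -
    have "\<bar>h n x\<bar> = \<bar>f n x\<bar> / (1 + B n) / 2 ^ n"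
      using B(1)[of n] by (simp add: h_def abs_mult)
    also have "\<dots> \<le> 1 / 2 ^ n"
      using B(1)[of n] B(2)[OF that, of n] by (intro divide_right_mono) auto
    finally show ?thesis .
  qed
  have summ: "summable (\<lambda>n. 1 / 2 ^ n :: real)"
    using summable_geometric[of "1 / 2 :: real"] by (simp add: power_one_over)
  define \<phi> where "\<phi> x = (\<Sum>n. h n x)" for x
  have \<phi>c: "\<phi> \<in> cont_functions X"
    unfolding cont_functions_def mem_Collect_eq \<phi>_def[abs_def]
    by (rule continuous_map_suminf[OF _ h_bound summ]) (use hc in \<open>auto simp: cont_functions_def\<close>)
  have int_h: "integral\<^sup>L q (h n) = 1 / (2 ^ n * (1 + B n)) * integral\<^sup>L q (f n)" for q n
    unfolding h_def[abs_def] by simp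
  have sums: "(\<lambda>n. integral\<^sup>L q (h n)) sums integral\<^sup>L q \<phi>" if q: "q \<in> Q" for q
    unfolding \<phi>_def[abs_def]
  proof (rule sums_integral)
    note qD = finite_invariantD[OF QD(1)[OF q]]
    show "integrable q (h n)" for n by (rule qD(6)[OF hc])
    show "AE x in q. summable (\<lambda>n. norm (h n x))"
      by (rule AE_I2, rule summable_comparison_test'[OF summ]) (use h_bound qD(3) in auto)
    show "summable (\<lambda>n. \<integral>x. norm (h n x) \<partial>q)"
    proof (rule summable_comparison_test'[OF summ])
      fix n :: nat
      have "\<bar>\<integral>x. \<bar>h n x\<bar> \<partial>q\<bar> \<le> 1 / 2 ^ n * measure q (topspace X)"
      proof (rule integral_abs_le_mass[OF QD(1)[OF q]])
        show "(\<lambda>x. \<bar>h n x\<bar>) \<in> cont_functions X"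
          using continuous_map_norm[of X "h n"] hc by (simp add: cont_functions_def)
      qed (use h_bound in auto)
      then show "norm (\<integral>x. norm (h n x) \<partial>q) \<le> 1 / 2 ^ n" using QD(2)[OF q] by simp
    qed
  qed
  have terms: "0 \<le> integral\<^sup>L q (h n)" if "q \<in> Q" for q n
    unfolding int_h using P_nonneg[OF fP that] w[of n] by (intro mult_nonneg_nonneg) auto
  have nonneg: "0 \<le> integral\<^sup>L q \<phi>" if "q \<in> Q" for q
    using sums_le[OF terms[OF that] sums_zero sums[OF that]] by simp
  have zero: "integral\<^sup>L k \<phi> = 0" if "k \<in> K" for k
  proof -
    have "integral\<^sup>L k (h n) = 0" for n unfolding int_h P_zero[OF fP that] by simp
    moreover have "k \<in> Q" using that K_subset by auto
    ultimately have "(\<lambda>n. 0) sums integral\<^sup>L k \<phi>" using sums[of k] by simp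
    then show ?thesis using sums_unique2[OF sums_zero] by metis
  qed
  have pos: "0 < integral\<^sup>L q \<phi>" if q: "q \<in> Q" "q \<notin> K" for q
  proof -
    obtain g where g: "g \<in> P" "0 < integral\<^sup>L q g" using separating_function[OF q] by (auto simp: P_def)
    obtain g' where g': "g' \<in> D" "\<forall>x\<in>topspace X. \<bar>g x - g' x\<bar> < integral\<^sup>L q g / 2"
      using dense g half_gt_zero by blast
    have cont: "g \<in> cont_functions X" "g' \<in> cont_functions X" using g(1) g'(1) D(1) P_cont by auto
    have "\<bar>integral\<^sup>L q g - integral\<^sup>L q g'\<bar> \<le> integral\<^sup>L q g / 2"
      by (rule integral_difference_le[OF q(1) cont]) (use g'(2) in force)
    then have "0 < integral\<^sup>L q g'" using g(2) by linarith
    moreover obtain n where n: "g' = f n" using g'(1) f_range by auto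
    ultimately have "0 < integral\<^sup>L q (h n)" unfolding int_h using w[of n] by (intro mult_pos_pos) auto
    then have "0 < (\<Sum>n. integral\<^sup>L q (h n))"
      by (rule suminf_pos2[OF sums_summable[OF sums[OF q(1)]] terms[OF q(1)]])
    then show ?thesis using sums_unique[OF sums[OF q(1)]] by simp
  qed
  show ?thesis using \<phi>c nonneg zero pos by (metis less_irrefl)
qed

lemma face_exposed: "\<exists>\<phi>\<in>cont_functions X. K = maximizing_measures X T G \<phi>"
proof -
  obtain \<phi> where \<phi>: "\<phi> \<in> cont_functions X" "\<forall>q\<in>Q. 0 \<le> integral\<^sup>L q \<phi>"
    "\<forall>q\<in>Q. integral\<^sup>L q \<phi> = 0 \<longleftrightarrow> q \<in> K" using exposing_function by blast
  obtain k where k: "k \<in> K" using K_nonempty by auto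
  then have kQ: "k \<in> Q" using K_subset by auto
  have neg: "(\<lambda>x. (- 1) * \<phi> x) \<in> cont_functions X" by (rule cont_functions_mult[OF \<phi>(1)])
  have int: "integral\<^sup>L q (\<lambda>x. (- 1) * \<phi> x) = - integral\<^sup>L q \<phi>" for q by simp
  have "(SUP q\<in>Q. integral\<^sup>L q (\<lambda>x. (- 1) * \<phi> x)) = 0"
  proof (rule cSup_eq_maximum)
    show "0 \<in> (\<lambda>q. integral\<^sup>L q (\<lambda>x. (- 1) * \<phi> x)) ` Q"
      using \<phi>(3) k kQ by (intro image_eqI[of _ _ k]) (auto simp: int)
  qed (use \<phi>(2) in \<open>auto simp: int\<close>)
  then have "maximizing_measures X T G (\<lambda>x. (- 1) * \<phi> x) = K"
    unfolding maximizing_measures_def int using \<phi>(3) K_subset by auto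
  with neg show ?thesis by blast
qed

end

theorem theorem1p9:
  fixes X :: "'a topology" and T :: "'a \<Rightarrow> 'a" and C :: "('a \<Rightarrow> real) set"
    and K :: "'a measure set"
  assumes "topspace X \<noteq> {}" and "compact_space X" and "metrizable_space X"
    and "continuous_map X X T"
    and "C \<subseteq> cont_functions X"
    and "finite_type X T C"
    and "is_face K (constrained_measures X T C)"
    and "closedin (subtopology (weak_star_topology X T) (constrained_measures X T C)) K"
  shows "\<exists>\<phi>\<in>cont_functions X. K = maximizing_measures X T C \<phi>"
proof -
  obtain G where G: "finite G" "G \<subseteq> cont_functions X"
    and eq: "constrained_measures X T C = constrained_measures X T G"
    using assms(6) unfolding finite_type_def by blast
  interpret constrained_face X T G K
    by unfold_locales (use assms G in \<open>simp_all add: eq\<close>)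
  show ?thesis
    using face_exposed unfolding maximizing_measures_def eq .
qed

end
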